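(* Let $a,b,s\in\mathbb{R}$ with $s\neq 0$ and let $\delta>0$ be arbitrary. Let $N_0,M_0\geq 0$ be integers such that $\lambda_{1,N_0+1}<-\delta$ and $\lambda_{2,M_0+1}<-\delta$, with $N_0\geq\max\Delta_1(a,b)$ and $M_0\geq\max\Delta_2(a,b)$. Assume that $\Theta(a,b)\cap\{0,\ldots,N_0\}=\emptyset$, and let $K\in\mathbb{R}^{1\times(N_0+M_0+3)}$ be a matrix such that $A_{1,a}-B_{1,a}K$ is Hurwitz with spectral abscissa less than $-\delta$. Then there exists $C>0$ such that, for all initial conditions $y_0,z_0\in L^2(0,1)$ and $u(0)=u_0\in\mathbb{R}$, the solutions of the system $$\partial_t y=\partial_{xx}y+ay,\quad \partial_t z=\partial_{xx}z+bz,\quad \partial_x y(t,0)=s\,z(t,0),\quad y(t,1)=\partial_x z(t,1)=0,\quad \partial_x z(t,0)=u(t),$$ $$y(0,x)=y_0(x),\quad z(0,x)=z_0(x)\qquad (t>0,\ x\in(0,1)),$$ in closed loop with the feedback $\dot u=v$, $v=-KX_{1,a}$, satisfy $$\Vert(y(t,\cdot),z(t,\cdot))\Vert_Y^2+u(t)^2\leq C e^{-2\delta t}\left(\Vert(y_0,z_0)\Vert_Y^2+u_0^2\right)\qquad\forall t\geq 0$$ with $Y=\mathcal{H}^0$. If the initial conditions are such that $y_0,z_0\in H^2(0,1)$ with $y_0(1)=z_0'(1)=0$, $y_0'(0)=s z_0(0)$ and $z_0'(0)=u(0)$, then the same estimate holds with $Y=\mathcal{H}^1$.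
   Context: $\mathbb{N}=\{0,1,2,\ldots\}$. Spaces. $\mathcal{H}^0=L^2(0,1)\times L^2(0,1)$ with inner product $\langle(f_1,g_1),(f_2,g_2)\rangle=\int_0^1(f_1f_2+g_1g_2)\,dx$. $H^1_{(1)}(0,1)=\{f\in H^1(0,1)\mid f(1)=0\}$ with inner product $\int_0^1 f_1'f_2'\,dx$; $\mathcal{H}^1=H^1_{(1)}(0,1)\times H^1(0,1)$ with inner product $\int_0^1(f_1'f_2'+g_1g_2+g_1'g_2')\,dx$. Below $\langle\cdot,\cdot\rangle$ is the inner product of $\mathcal{H}^0$. Eigenvalues and index sets. For $n,m\in\mathbb{N}$: $\lambda_{1,n}=a-(n+1/2)^2\pi^2$, $\lambda_{2,m}=b-m^2\pi^2$. $\Delta(a,b)=\{(n,m)\in\mathbb{N}^2\mid 4(b-a)=(4m^2-(2n+1)^2)\pi^2\}$ (a finite set, equivalently the set of $(n,m)$ with $\lambda_{1,n}=\lambda_{2,m}$); $\Delta_1(a,b)$ and $\Delta_2(a,b)$ are its projections on the first and second coordinate (the conditions $N_0\ge\max\Delta_1(a,b)$, $M_0\ge\max\Delta_2(a,b)$ are vacuous if these sets are empty). $\Theta(a,b)=\{n\in\mathbb{N}\mid\exists k\in\mathbb{N},\ 4(b-a)=((2k+1)^2-(2n+1)^2)\pi^2\}$. $\mu_0=1$ and $\mu_m=\sqrt2$ for $m\geq1$. Functions $\psi_{i,k}=(\psi_{i,k}^1,\psi_{i,k}^2)$. $\psi_{2,m}^1=0$ and $\psi_{2,m}^2(x)=\mu_m\cos(m\pi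 x)$. $\psi_{1,n}^1(x)=\sqrt2\cos((n+1/2)\pi x)$, and: if $n\notin\Delta_1(a,b)$, $\psi_{1,n}^2(x)=-\frac{\sqrt2 s}{r_n^*\sinh(r_n^* )}\cosh(r_n^*(1-x))$ where $r_n^*$ is one of the two (complex) square roots of $\lambda_{1,n}-b$; if $(n,0)\in\Delta(a,b)$, $\psi_{1,n}^2(x)=c_0+\sqrt2 s x-\frac{\sqrt2}{2}s x^2$ with $c_0=-s\sqrt2\left(\frac13+\frac1{(2n+1)^2\pi^2}\right)$; if $(n,k)\in\Delta(a,b)$ with $k\geq1$, $\psi_{1,n}^2(x)=\frac{\sqrt2 s}{k\pi}(1-x)\sin(k\pi x)+c_n\sqrt2\cos(k\pi x)$ with $c_n=-\frac{2s}{\pi^2}\left(\frac1{(2n+1)^2}+\frac1{4k^2}\right)$. Homogenized state. $\varphi(x)=x-x^2/2$, $\alpha=\varphi''+b\varphi$, $\beta=-\varphi$, $\tilde z(t,x)=z(t,x)-\varphi(x)u(t)$, $\tilde{\mathcal X}(t)=(y(t,\cdot),\tilde z(t,\cdot))$, $v=\dot u$. The system is equivalent to $\frac{d}{dt}\tilde{\mathcal X}=\mathcal{A}\tilde{\mathcal X}+(0,\alpha)u+(0,\beta)v$, $\dot u=v$, where $\mathcal{A}(f,g)=(f''+af,g''+bg)$ on $D(\mathcal{A})=\{(f,g)\in H^2(0,1)^2\mid f(1)=g'(0)=g'(1)=0,\ f'(0)=s g(0)\}$; solutions are understood in this sense (mild solutions for $L^2$ data). Set $\tilde x_{i,k}=\langle\tilde{\mathcal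 X},\psi_{i,k}\rangle$, $\alpha_{i,k}=\langle(0,\alpha),\psi_{i,k}\rangle$, $\beta_{i,k}=\langle(0,\beta),\psi_{i,k}\rangle$. Finite-dimensional model. Let $N_\Delta=\mathrm{Card}(\Delta(a,b))$ and write $\Delta(a,b)=\{(\theta_1(i),\theta_2(i))\mid 0\le i\le N_\Delta-1\}$ with $\theta_1,\theta_2$ increasing. Let $\varphi_1$ be the permutation of $\{0,\ldots,N_0\}$ with $\varphi_1(i)=\theta_1(i)$ for $0\le i\le N_\Delta-1$ and $\varphi_1$ increasing on $\{N_\Delta,\ldots,N_0\}$; let $\varphi_2$ be the permutation of $\{0,\ldots,M_0\}$ with $\varphi_2(i)=\theta_2(i)$ for $0\le i\le N_\Delta-1$ and $\varphi_2$ increasing on $\{N_\Delta,\ldots,M_0\}$. For a family $w=(w_{i,k})$ write $[w]$ for the column vector of $\mathbb{R}^{N_0+M_0+2}$ with successive entries $w_{1,\varphi_1(0)},w_{2,\varphi_2(0)},\ldots,w_{1,\varphi_1(N_\Delta-1)},w_{2,\varphi_2(N_\Delta-1)},\ w_{1,\varphi_1(N_\Delta)},\ldots,w_{1,\varphi_1(N_0)},\ w_{2,\varphi_2(N_\Delta)},\ldots,w_{2,\varphi_2(M_0)}$. For $(n,m)\in\Delta(a,b)$ with $\lambda=\lambda_{1,n}=\lambda_{2,m}$ let $M_n=\begin{bmatrix}\lambda&-\sqrt2 s\mu_m\\0&\lambda\end{bmatrix}$. Set $X_1=[\tilde x]$, $B_{1,u}=[\alpha]$ (entries $\alpha_{i,k}$),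 $B_{1,v}=[\beta]$ (entries $\beta_{i,k}$), $A_1$ the block-diagonal matrix with successive diagonal blocks $M_{\varphi_1(0)},\ldots,M_{\varphi_1(N_\Delta-1)},\lambda_{1,\varphi_1(N_\Delta)},\ldots,\lambda_{1,\varphi_1(N_0)},\lambda_{2,\varphi_2(N_\Delta)},\ldots,\lambda_{2,\varphi_2(M_0)}$, and $$X_{1,a}=\begin{bmatrix} X_1 \\ u \end{bmatrix},\quad A_{1,a}=\begin{bmatrix}A_1&B_{1,u}\\0&0\end{bmatrix},\quad B_{1,a}=\begin{bmatrix}B_{1,v}\\1\end{bmatrix}.$$ The spectral abscissa of a matrix is the maximum of the real parts of its eigenvalues. *)

theory Defs
  imports
    "HOL-Analysis.Analysis"
    "Jordan_Normal_Form.Spectral_Radius"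
begin

section \<open>The Hilbert space \<open>L\<^sup>2(0,1)\<close>\<close>

abbreviation leb01 :: "real measure" where
  "leb01 \<equiv> lebesgue_on {0<..<1}"

definition square_integrable :: "(real \<Rightarrow> real) \<Rightarrow> bool" where
  "square_integrable f \<longleftrightarrow> f \<in> borel_measurable leb01 \<and> integrable leb01 (\<lambda>x. (f x)\<^sup>2)"

lemma square_integrable_mult:
  assumes "square_integrable f" "square_integrable g"
  shows "integrable leb01 (\<lambda>x. f x * g x)"
proof (rule Bochner_Integration.integrable_bound)
  show "integrable leb01 (\<lambda>x. (f x)\<^sup>2 + (g x)\<^sup>2)"
    using assms by (auto simp: square_integrable_def)
  show "(\<lambda>x. f x * g x) \<in> borel_measurable leb01"
    using assms by (auto simp: square_integrable_def)
  show "AE x in leb01. norm (f x * g x) \<le> norm ((f x)\<^sup>2 + (g x)\<^sup>2)"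
  proof (rule AE_I2)
    fix x
    have "2 * \<bar>f x * g x\<bar> \<le> (f x)\<^sup>2 + (g x)\<^sup>2"
      using sum_squares_bound[of "\<bar>f x\<bar>" "\<bar>g x\<bar>"] by (simp add: abs_mult)
    then show "norm (f x * g x) \<le> norm ((f x)\<^sup>2 + (g x)\<^sup>2)"
      by simp
  qed
qed

lemma square_integrable_add:
  assumes "square_integrable f" "square_integrable g"
  shows "square_integrable (\<lambda>x. f x + g x)"
  using assms square_integrable_mult[OF assms]
  by (auto simp: square_integrable_def power2_sum mult.assoc)

lemma square_integrable_scale:
  "square_integrable f \<Longrightarrow> square_integrable (\<lambda>x. c * f x)"
  by (auto simp: square_integrable_def power_mult_distrib)

lemma square_integrable_zero: "square_integrable (\<lambda>x. 0)"
  by (simp add: square_integrable_def)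

lemma square_integrable_minus:
  "square_integrable f \<Longrightarrow> square_integrable (\<lambda>x. - f x)"
  using square_integrable_scale[of f "-1"] by simp

lemma square_integrable_diff:
  assumes "square_integrable f" "square_integrable g"
  shows "square_integrable (\<lambda>x. f x - g x)"
  using square_integrable_add[OF assms(1) square_integrable_minus[OF assms(2)]] by simp

definition L2_rel :: "(real \<Rightarrow> real) \<Rightarrow> (real \<Rightarrow> real) \<Rightarrow> bool" where
  "L2_rel f g \<longleftrightarrow> square_integrable f \<and> square_integrable g \<and> (AE x in leb01. f x = g x)"

quotient_type L2 = "real \<Rightarrow> real" / partial: L2_rel
  morphisms L2_rep L2_of
proof (rule part_equivpI)
  show "\<exists>f. L2_rel f f"
    by (rule exI[of _ "\<lambda>_. 0"]) (simp add: L2_rel_def square_integrable_zero)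
  show "symp L2_rel"
    by (auto simp: symp_def L2_rel_def)
  show "transp L2_rel"
    by (force simp: transp_def L2_rel_def)
qed

instantiation L2 :: real_inner
begin

lift_definition zero_L2 :: L2 is "\<lambda>x. 0"
  by (simp add: L2_rel_def square_integrable_zero)

lift_definition plus_L2 :: "L2 \<Rightarrow> L2 \<Rightarrow> L2" is "\<lambda>f g x. f x + g x"
  by (force simp: L2_rel_def intro: square_integrable_add)

lift_definition minus_L2 :: "L2 \<Rightarrow> L2 \<Rightarrow> L2" is "\<lambda>f g x. f x - g x"
  by (force simp: L2_rel_def intro: square_integrable_diff)

lift_definition uminus_L2 :: "L2 \<Rightarrow> L2" is "\<lambda>f x. - f x"
  by (force simp: L2_rel_def intro: square_integrable_minus)

lift_definition scaleR_L2 :: "real \<Rightarrow> L2 \<Rightarrow> L2" is "\<lambda>c f x. c * f x"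
  by (force simp: L2_rel_def intro: square_integrable_scale)

lift_definition inner_L2 :: "L2 \<Rightarrow> L2 \<Rightarrow> real" is "\<lambda>f g. LINT x|leb01. f x * g x"
proof -
  fix f f' g g' :: "real \<Rightarrow> real"
  assume "L2_rel f f'" "L2_rel g g'"
  then show "(LINT x|leb01. f x * g x) = (LINT x|leb01. f' x * g' x)"
    by (intro integral_cong_AE) (auto simp: L2_rel_def square_integrable_def)
qed

definition norm_L2 :: "L2 \<Rightarrow> real" where
  "norm_L2 f = sqrt (inner f f)"

definition sgn_L2 :: "L2 \<Rightarrow> L2" where
  "sgn_L2 f = scaleR (inverse (norm f)) f"

definition dist_L2 :: "L2 \<Rightarrow> L2 \<Rightarrow> real" where
  "dist_L2 f g = norm (f - g)"

definition uniformity_L2 :: "(L2 \<times> L2) filter" where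
  "uniformity_L2 = (INF e\<in>{0<..}. principal {(x, y). dist x y < e})"

definition open_L2 :: "L2 set \<Rightarrow> bool" where
  "open_L2 U \<longleftrightarrow> (\<forall>x\<in>U. eventually (\<lambda>(x', y). x' = x \<longrightarrow> y \<in> U) uniformity)"

instance
proof
  fix f g h :: L2 and c d :: real
  show "f + g + h = f + (g + h)"
    by transfer (auto simp: L2_rel_def add.assoc intro: square_integrable_add)
  show "f + g = g + f"
    by transfer (auto simp: L2_rel_def add.commute intro: square_integrable_add)
  show "0 + f = f"
    by transfer (auto simp: L2_rel_def)
  show "- f + f = 0"
    by transfer (auto simp: L2_rel_def square_integrable_zero)
  show "f - g = f + - g"
    by transfer (auto simp: L2_rel_def intro: square_integrable_diff)
  show "scaleR c (f + g) = scaleR c f + scaleR c g"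
    by transfer (auto simp: L2_rel_def distrib_left
        intro!: square_integrable_add square_integrable_scale)
  show "scaleR (c + d) f = scaleR c f + scaleR d f"
    by transfer (auto simp: L2_rel_def distrib_right
        intro!: square_integrable_add square_integrable_scale)
  show "scaleR c (scaleR d f) = scaleR (c * d) f"
    by transfer (auto simp: L2_rel_def mult.assoc intro!: square_integrable_scale)
  show "scaleR 1 f = f"
    by transfer (auto simp: L2_rel_def)
  show "dist f g = norm (f - g)"
    by (rule dist_L2_def)
  show "sgn f = scaleR (inverse (norm f)) f"
    by (rule sgn_L2_def)
  show "(uniformity :: (L2 \<times> L2) filter) = (INF e\<in>{0<..}. principal {(x, y). dist x y < e})"
    by (rule uniformity_L2_def)
  show "open U \<longleftrightarrow> (\<forall>x\<in>U. eventually (\<lambda>(x', y). x' = x \<longrightarrow> y \<in> U) uniformity)" for U :: "L2 set"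
    by (rule open_L2_def)
  show "inner f g = inner g f"
    by transfer (simp add: mult.commute)
  show "inner (f + g) h = inner f h + inner g h"
    by transfer (auto simp: L2_rel_def distrib_right square_integrable_mult)
  show "inner (scaleR c f) g = c * inner f g"
    by transfer (simp add: mult.assoc)
  show "0 \<le> inner f f"
    by transfer simp
  show "inner f f = 0 \<longleftrightarrow> f = 0"
    by transfer
      (auto simp: L2_rel_def square_integrable_def square_integrable_zero
        integral_nonneg_eq_0_iff_AE simp flip: power2_eq_square)
  show "norm f = sqrt (inner f f)"
    by (rule norm_L2_def)
qed

end

lemma L2_rep_square_integrable: "square_integrable (L2_rep f)"
  using Quotient_rep_reflp[OF Quotient_L2, of f] by (simp add: L2_rel_def)


lemma L2_of_L2_rep: "L2_of (L2_rep f) = f"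
  using Quotient_abs_rep[OF Quotient_L2] .

lemma L2_of_eq_iff:
  assumes "square_integrable f" "square_integrable g"
  shows "L2_of f = L2_of g \<longleftrightarrow> (AE x in leb01. f x = g x)"
  using Quotient_rel[OF Quotient_L2, of f g] assms by (auto simp: L2_rel_def)

lemma inner_L2_of:
  assumes "square_integrable f" "square_integrable g"
  shows "inner (L2_of f) (L2_of g) = (LINT x|leb01. f x * g x)"
  using assms by (auto simp: inner_L2.abs_eq L2_rel_def)

lemma diff_L2_of:
  assumes "square_integrable f" "square_integrable g"
  shows "L2_of f - L2_of g = L2_of (\<lambda>x. f x - g x)"
  using assms by (auto simp: minus_L2.abs_eq L2_rel_def)

lemma norm_L2_of_sq:
  assumes "square_integrable f"
  shows "(norm (L2_of f))\<^sup>2 = (LINT x|leb01. (f x)\<^sup>2)"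
  unfolding power2_norm_eq_inner by (simp add: inner_L2_of[OF assms assms] power2_eq_square)

lemma nn_integral_L2_of_sq:
  assumes "square_integrable f"
  shows "(\<integral>\<^sup>+x. ennreal ((f x)\<^sup>2) \<partial>leb01) = ennreal ((norm (L2_of f))\<^sup>2)"
  using assms by (simp add: norm_L2_of_sq nn_integral_eq_integral square_integrable_def)

interpretation leb01: finite_measure leb01
  by (rule finite_measure_lebesgue_on) auto

lemma nn_integral_abs_le_norm_L2_of:
  assumes "square_integrable f"
  shows "(\<integral>\<^sup>+x. ennreal \<bar>f x\<bar> \<partial>leb01) \<le> ennreal (norm (L2_of f))"
proof -
  have m: "f \<in> borel_measurable leb01"
    using assms by (simp add: square_integrable_def)
  have "(\<integral>\<^sup>+x. ennreal \<bar>f x\<bar> * 1 \<partial>leb01)\<^sup>2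
      \<le> (\<integral>\<^sup>+x. (ennreal \<bar>f x\<bar>)\<^sup>2 \<partial>leb01) * (\<integral>\<^sup>+x. 1\<^sup>2 \<partial>leb01)"
    using m by (intro Cauchy_Schwarz_nn_integral) auto
  also have "(\<integral>\<^sup>+x. (ennreal \<bar>f x\<bar>)\<^sup>2 \<partial>leb01) = (\<integral>\<^sup>+x. ennreal ((f x)\<^sup>2) \<partial>leb01)"
    by (simp add: ennreal_power)
  also have "\<dots> = ennreal ((norm (L2_of f))\<^sup>2)"
    by (rule nn_integral_L2_of_sq[OF assms])
  also have "(\<integral>\<^sup>+x. 1\<^sup>2 \<partial>leb01) = 1"
    by (simp add: emeasure_restrict_space)
  finally have "(\<integral>\<^sup>+x. ennreal \<bar>f x\<bar> \<partial>leb01)\<^sup>2 \<le> (ennreal (norm (L2_of f)))\<^sup>2"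
    by (simp add: ennreal_power)
  then show ?thesis
    by (cases "\<integral>\<^sup>+x. ennreal \<bar>f x\<bar> \<partial>leb01" rule: ennreal_cases)
      (auto simp: ennreal_power power2_eq_square[of "Orderings.top_class.top :: ennreal"] top_unique intro!: ennreal_leI power2_le_imp_le)
qed

instance L2 :: complete_space
proof
  fix X :: "nat \<Rightarrow> L2"
  assume C: "Cauchy X"
  have "\<exists>N. \<forall>m\<ge>N. \<forall>n\<ge>N. dist (X m) (X n) < (1/2)^k" for k
    using C by (auto simp: Cauchy_def)
  then obtain N where N: "\<And>k m n. N k \<le> m \<Longrightarrow> N k \<le> n \<Longrightarrow> dist (X m) (X n) < (1/2)^k"
    by metis
  define r where "r k = (\<Sum>i\<le>k. N i)" for k
  have rN: "N k \<le> r j" if "k \<le> j" for k j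
    unfolding r_def using that by (intro member_le_sum) auto
  define f where "f k = L2_rep (X (r k))" for k
  have sf: "square_integrable (f k)" for k
    by (simp add: f_def L2_rep_square_integrable)
  have Xf: "X (r k) = L2_of (f k)" for k
    by (simp add: f_def L2_of_L2_rep)
  have mf [measurable]: "f k \<in> borel_measurable leb01" for k
    using sf[of k] by (simp add: square_integrable_def)
  have sd: "square_integrable (\<lambda>x. f j x - f k x)" for j k
    by (rule square_integrable_diff[OF sf sf])
  have nd: "norm (L2_of (\<lambda>x. f j x - f k x)) \<le> (1/2)^k" if "k \<le> j" for j k
    using N[of k "r j" "r k"] rN[of k j] rN[of k k] that
    by (simp add: Xf dist_norm diff_L2_of[OF sf sf])
  have "(\<integral>\<^sup>+x. (\<Sum>k. ennreal \<bar>f (Suc k) x - f k x\<bar>) \<partial>leb01)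
      = (\<Sum>k. \<integral>\<^sup>+x. ennreal \<bar>f (Suc k) x - f k x\<bar> \<partial>leb01)"
    by (rule nn_integral_suminf) measurable
  also have "\<dots> \<le> (\<Sum>k. ennreal ((1/2)^k))"
  proof (intro suminf_le allI)
    fix k
    show "(\<integral>\<^sup>+x. ennreal \<bar>f (Suc k) x - f k x\<bar> \<partial>leb01) \<le> ennreal ((1/2)^k)"
      using nn_integral_abs_le_norm_L2_of[OF sd[of "Suc k" k]] nd[of k "Suc k"]
      by (simp add: order_trans[OF _ ennreal_leI])
  qed auto
  also have "\<dots> = ennreal (\<Sum>k. (1/2)^k)"
    by (intro suminf_ennreal2) (auto intro: summable_geometric)
  also have "\<dots> < \<infinity>"
    by simp
  finally have "(\<integral>\<^sup>+x. (\<Sum>k. ennreal \<bar>f (Suc k) x - f k x\<bar>) \<partial>leb01) \<noteq> \<infinity>"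
    by simp
  then have "AE x in leb01. (\<Sum>k. ennreal \<bar>f (Suc k) x - f k x\<bar>) \<noteq> \<infinity>"
    by (intro nn_integral_PInf_AE) auto
  then have conv: "AE x in leb01. (\<lambda>k. f k x) \<longlonglongrightarrow> lim (\<lambda>k. f k x)"
  proof eventually_elim
    case (elim x)
    then have "summable (\<lambda>k. \<bar>f (Suc k) x - f k x\<bar>)"
      by (intro summable_suminf_not_top) auto
    then have "summable (\<lambda>k. f (Suc k) x - f k x)"
      by (rule summable_rabs_cancel)
    then have "convergent (\<lambda>n. \<Sum>k<n. f (Suc k) x - f k x)"
      by (simp add: summable_iff_convergent)
    then have "convergent (\<lambda>n. f n x - f 0 x)"
      unfolding sum_lessThan_telescope[of "\<lambda>k. f k x"] .
    then have "convergent (\<lambda>n. f n x)"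
      using convergent_diff_const_right_iff by blast
    then show ?case
      by (simp add: convergent_LIMSEQ_iff)
  qed
  define g where "g x = lim (\<lambda>k. f k x)" for x
  have mg [measurable]: "g \<in> borel_measurable leb01"
    unfolding g_def by measurable
  have fatou: "(\<integral>\<^sup>+x. ennreal ((g x - f k x)\<^sup>2) \<partial>leb01) \<le> ennreal (((1/2)^k)\<^sup>2)" for k
  proof -
    have "(\<integral>\<^sup>+x. ennreal ((g x - f k x)\<^sup>2) \<partial>leb01)
        = (\<integral>\<^sup>+x. liminf (\<lambda>j. ennreal ((f j x - f k x)\<^sup>2)) \<partial>leb01)"
    proof (rule nn_integral_cong_AE, use conv in eventually_elim)
      case (elim x)
      then have "(\<lambda>j. ennreal ((f j x - f k x)\<^sup>2)) \<longlonglongrightarrow> ennreal ((g x - f k x)\<^sup>2)"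
        unfolding g_def by (intro tendsto_intros)
      then show ?case
        by (metis lim_imp_Liminf trivial_limit_sequentially)
    qed
    also have "\<dots> \<le> liminf (\<lambda>j. \<integral>\<^sup>+x. ennreal ((f j x - f k x)\<^sup>2) \<partial>leb01)"
      by (rule nn_integral_liminf) measurable
    also have "\<dots> \<le> ennreal (((1/2)^k)\<^sup>2)"
    proof (rule Liminf_le)
      show "\<forall>\<^sub>F j in sequentially.
          (\<integral>\<^sup>+x. ennreal ((f j x - f k x)\<^sup>2) \<partial>leb01) \<le> ennreal (((1/2)^k)\<^sup>2)"
        using eventually_ge_at_top[of k]
      proof eventually_elim
        case (elim j)
        show ?case
          unfolding nn_integral_L2_of_sq[OF sd]
          by (intro ennreal_leI power_mono nd elim norm_ge_zero)
      qed
    qed simp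
    finally show ?thesis .
  qed
  have sgf: "square_integrable (\<lambda>x. g x - f k x)" for k
    unfolding square_integrable_def
  proof (intro conjI integrableI_nonneg)
    show "(\<integral>\<^sup>+x. ennreal ((g x - f k x)\<^sup>2) \<partial>leb01) < \<infinity>"
      using fatou[of k] by (simp add: order_le_less_trans)
  qed auto
  have sg: "square_integrable g"
    using square_integrable_add[OF sgf[of 0] sf[of 0]] by simp
  have dg: "dist (X (r k)) (L2_of g) \<le> (1/2)^k" for k
  proof -
    have "ennreal ((norm (L2_of (\<lambda>x. g x - f k x)))\<^sup>2) \<le> ennreal (((1/2)^k)\<^sup>2)"
      using fatou[of k] nn_integral_L2_of_sq[OF sgf[of k]] by simp
    then have "norm (L2_of (\<lambda>x. g x - f k x)) \<le> (1/2)^k"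
      by (simp add: power2_le_iff_abs_le)
    then show ?thesis
      by (simp add: Xf dist_commute[of "L2_of (f k)"] dist_norm[of "L2_of g"] diff_L2_of[OF sg sf])
  qed
  have "X \<longlonglongrightarrow> L2_of g"
  proof (rule metric_LIMSEQ_I)
    fix e :: real
    assume "0 < e"
    then obtain k where k: "(1/2)^k < e / 2"
      using real_arch_pow_inv[of "e/2" "1/2"] by auto
    have "dist (X n) (L2_of g) < e" if "n \<ge> N k" for n
      using dist_triangle[of "X n" "L2_of g" "X (r k)"] N[of k n "r k"] rN[of k k] dg[of k] k that
      by simp
    then show "\<exists>no. \<forall>n\<ge>no. dist (X n) (L2_of g) < e"
      by blast
  qed
  then show "convergent X"
    by (rule convergentI)
qed

instance L2 :: banach ..


section \<open>Sobolev spaces on \<open>(0,1)\<close>\<close>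

text \<open>Test functions are taken in \<open>C\<^sup>1\<^sub>c(0,1)\<close>, the usual choice in dimension one.\<close>

definition test_function :: "(real \<Rightarrow> real) \<Rightarrow> (real \<Rightarrow> real) \<Rightarrow> bool" where
  "test_function \<eta> \<eta>' \<longleftrightarrow>
     (\<forall>x. (\<eta> has_real_derivative \<eta>' x) (at x)) \<and> continuous_on UNIV \<eta>' \<and>
     (\<exists>c d. 0 < c \<and> d < 1 \<and> (\<forall>x. x \<notin> {c..d} \<longrightarrow> \<eta> x = 0))"

definition has_weak_deriv :: "L2 \<Rightarrow> L2 \<Rightarrow> bool" where
  "has_weak_deriv f g \<longleftrightarrow>
     (\<forall>\<eta> \<eta>'. test_function \<eta> \<eta>' \<longrightarrow> inner f (L2_of \<eta>') = - inner g (L2_of \<eta>))"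

definition weak_deriv :: "L2 \<Rightarrow> L2" where
  "weak_deriv f = (THE g. has_weak_deriv f g)"

definition H1 :: "L2 set" where
  "H1 = {f. \<exists>g. has_weak_deriv f g}"

definition H2 :: "L2 set" where
  "H2 = {f \<in> H1. weak_deriv f \<in> H1}"

text \<open>Point values of elements of \<open>H\<^sup>1(0,1)\<close>, in particular at the boundary, are those of the
  representative that is continuous on \<open>[0,1]\<close> (unique there).\<close>

definition point_value :: "L2 \<Rightarrow> real \<Rightarrow> real" where
  "point_value f x = (SOME h. continuous_on {0..1} h \<and> L2_of h = f) x"

section \<open>State spaces\<close>

text \<open>\<open>\<H>\<^sup>0\<close> is the product type \<^typ>\<open>L2 \<times> L2\<close>, whose library inner product is the required one.\<close>

type_synonym state = "L2 \<times> L2"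

definition calH1 :: "state set" where
  "calH1 = {(f, g). f \<in> H1 \<and> point_value f 1 = 0 \<and> g \<in> H1}"

definition inner_calH1 :: "state \<Rightarrow> state \<Rightarrow> real" where
  "inner_calH1 p q = inner (weak_deriv (fst p)) (weak_deriv (fst q))
     + inner (snd p) (snd q) + inner (weak_deriv (snd p)) (weak_deriv (snd q))"

definition norm_calH1 :: "state \<Rightarrow> real" where
  "norm_calH1 p = sqrt (inner_calH1 p p)"

section \<open>Eigenvalues and index sets\<close>

definition lambda1 :: "real \<Rightarrow> nat \<Rightarrow> real" where
  "lambda1 a n = a - (real n + 1/2)\<^sup>2 * pi\<^sup>2"

definition lambda2 :: "real \<Rightarrow> nat \<Rightarrow> real" where
  "lambda2 b m = b - (real m)\<^sup>2 * pi\<^sup>2"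

definition Delta :: "real \<Rightarrow> real \<Rightarrow> (nat \<times> nat) set" where
  "Delta a b = {(n, m). 4 * (b - a) = (4 * (real m)\<^sup>2 - (2 * real n + 1)\<^sup>2) * pi\<^sup>2}"

definition Delta1 :: "real \<Rightarrow> real \<Rightarrow> nat set" where
  "Delta1 a b = fst ` Delta a b"

definition Delta2 :: "real \<Rightarrow> real \<Rightarrow> nat set" where
  "Delta2 a b = snd ` Delta a b"

definition Theta :: "real \<Rightarrow> real \<Rightarrow> nat set" where
  "Theta a b = {n. \<exists>k :: nat. 4 * (b - a) = ((2 * real k + 1)\<^sup>2 - (2 * real n + 1)\<^sup>2) * pi\<^sup>2}"

text \<open>For \<open>n \<in> \<Delta>\<^sub>1(a,b)\<close>, the unique \<open>m\<close> with \<open>(n,m) \<in> \<Delta>(a,b)\<close>.\<close>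

definition partner :: "real \<Rightarrow> real \<Rightarrow> nat \<Rightarrow> nat" where
  "partner a b n = (THE m. (n, m) \<in> Delta a b)"

definition mu :: "nat \<Rightarrow> real" where
  "mu m = (if m = 0 then 1 else sqrt 2)"

section \<open>The functions \<open>\<psi>\<^sub>1\<^sub>,\<^sub>n\<close> and \<open>\<psi>\<^sub>2\<^sub>,\<^sub>m\<close>\<close>

text \<open>In the first case below the complex expression is even in \<open>r\<close>, hence independent of the
  choice of the square root \<open>r\<^sub>n\<^sup>*\<close> of \<open>\<lambda>\<^sub>1\<^sub>,\<^sub>n - b\<close>; as \<open>r\<close> is real or purely imaginary, its value is real.\<close>

definition psi1_snd :: "real \<Rightarrow> real \<Rightarrow> real \<Rightarrow> nat \<Rightarrow> real \<Rightarrow> real" where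
  "psi1_snd a b s n x =
     (if n \<notin> Delta1 a b then
        (let r = csqrt (complex_of_real (lambda1 a n - b))
         in Re (- (complex_of_real (sqrt 2 * s) / (r * sinh r)) * cosh (r * complex_of_real (1 - x))))
      else if partner a b n = 0 then
        - s * sqrt 2 * (1/3 + 1 / ((2 * real n + 1)\<^sup>2 * pi\<^sup>2)) + sqrt 2 * s * x - sqrt 2 / 2 * s * x\<^sup>2
      else
        (let k = real (partner a b n)
         in sqrt 2 * s / (k * pi) * (1 - x) * sin (k * pi * x)
            + - (2 * s / pi\<^sup>2) * (1 / (2 * real n + 1)\<^sup>2 + 1 / (4 * k\<^sup>2)) * sqrt 2 * cos (k * pi * x)))"

definition psi1 :: "real \<Rightarrow> real \<Rightarrow> real \<Rightarrow> nat \<Rightarrow> state" where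
  "psi1 a b s n =
     (L2_of (\<lambda>x. sqrt 2 * cos ((real n + 1/2) * pi * x)), L2_of (psi1_snd a b s n))"

definition psi2 :: "nat \<Rightarrow> state" where
  "psi2 m = (0, L2_of (\<lambda>x. mu m * cos (real m * pi * x)))"

section \<open>The homogenized system\<close>

definition phi :: "real \<Rightarrow> real" where
  "phi x = x - x\<^sup>2 / 2"

definition alpha :: "real \<Rightarrow> L2" where
  "alpha b = L2_of (\<lambda>x. deriv (deriv phi) x + b * phi x)"

definition beta :: L2 where
  "beta = L2_of (\<lambda>x. - phi x)"

definition dom_A :: "real \<Rightarrow> state set" where
  "dom_A s = {(f, g). f \<in> H2 \<and> g \<in> H2 \<and>
     point_value f 1 = 0 \<and> point_value (weak_deriv g) 0 = 0 \<and> point_value (weak_deriv g) 1 = 0 \<and>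
     point_value (weak_deriv f) 0 = s * point_value g 0}"

definition op_A :: "real \<Rightarrow> real \<Rightarrow> state \<Rightarrow> state" where
  "op_A a b = (\<lambda>(f, g). (weak_deriv (weak_deriv f) + a *\<^sub>R f, weak_deriv (weak_deriv g) + b *\<^sub>R g))"

text \<open>Mild solutions on \<open>[0,\<infinity>)\<close> of the inhomogeneous abstract Cauchy problem
  \<open>X' = \<A> X + (0,\<alpha>) u + (0,\<beta>) v\<close>, \<open>X(0) = X\<^sub>0\<close>, in the integrated form (Arendt, Batty,
  Hieber, Neubrander, \<open>Vector-valued Laplace Transforms and Cauchy Problems\<close>, Section 3.1).
  The integrals are integrals of continuous functions with values in the Hilbert space
  \<open>\<H>\<^sup>0\<close>.\<close>

definition mild_solution ::
  "real \<Rightarrow> real \<Rightarrow> real \<Rightarrow> state \<Rightarrow> (real \<Rightarrow> state) \<Rightarrow> (real \<Rightarrow> real) \<Rightarrow> (real \<Rightarrow> real) \<Rightarrow> bool" where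
  "mild_solution a b s X0 X u v \<longleftrightarrow>
     continuous_on {0..} X \<and>
     (\<forall>t\<ge>0. integral {0..t} X \<in> dom_A s \<and>
        X t = X0 + op_A a b (integral {0..t} X)
              + integral {0..t} (\<lambda>\<tau>. u \<tau> *\<^sub>R (0, alpha b) + v \<tau> *\<^sub>R (0, beta)))"

section \<open>The finite-dimensional model\<close>

text \<open>\<open>mode_ordering a b N0 M0 p1 p2\<close>: \<open>p1\<close> and \<open>p2\<close> are the permutations \<open>\<phi>\<^sub>1\<close> of
  \<open>{0,\<dots>,N0}\<close> and \<open>\<phi>\<^sub>2\<close> of \<open>{0,\<dots>,M0}\<close>; \<open>th1\<close> and \<open>th2\<close> are \<open>\<theta>\<^sub>1\<close> and \<open>\<theta>\<^sub>2\<close>.\<close>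

definition mode_ordering ::
  "real \<Rightarrow> real \<Rightarrow> nat \<Rightarrow> nat \<Rightarrow> (nat \<Rightarrow> nat) \<Rightarrow> (nat \<Rightarrow> nat) \<Rightarrow> bool" where
  "mode_ordering a b N0 M0 p1 p2 \<longleftrightarrow>
     (let N\<^sub>\<Delta> = card (Delta a b) in
      \<exists>th1 th2 :: nat \<Rightarrow> nat.
        strict_mono_on {..<N\<^sub>\<Delta>} th1 \<and> strict_mono_on {..<N\<^sub>\<Delta>} th2 \<and>
        Delta a b = (\<lambda>i. (th1 i, th2 i)) ` {..<N\<^sub>\<Delta>} \<and>
        bij_betw p1 {0..N0} {0..N0} \<and> (\<forall>i<N\<^sub>\<Delta>. p1 i = th1 i) \<and> strict_mono_on {N\<^sub>\<Delta>..N0} p1 \<and>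
        bij_betw p2 {0..M0} {0..M0} \<and> (\<forall>i<N\<^sub>\<Delta>. p2 i = th2 i) \<and> strict_mono_on {N\<^sub>\<Delta>..M0} p2)"

text \<open>The column vector \<open>[w]\<close>, of dimension \<open>N0 + M0 + 2\<close>, of a family \<open>w = (w1, w2)\<close>.\<close>

definition bracket ::
  "nat \<Rightarrow> nat \<Rightarrow> nat \<Rightarrow> (nat \<Rightarrow> nat) \<Rightarrow> (nat \<Rightarrow> nat) \<Rightarrow> (nat \<Rightarrow> real) \<Rightarrow> (nat \<Rightarrow> real) \<Rightarrow> real vec" where
  "bracket N\<^sub>\<Delta> N0 M0 p1 p2 w1 w2 = vec_of_list
     (concat (map (\<lambda>i. [w1 (p1 i), w2 (p2 i)]) [0..<N\<^sub>\<Delta>])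
      @ map (\<lambda>i. w1 (p1 i)) [N\<^sub>\<Delta>..<N0 + 1] @ map (\<lambda>i. w2 (p2 i)) [N\<^sub>\<Delta>..<M0 + 1])"

definition M_block :: "real \<Rightarrow> real \<Rightarrow> real \<Rightarrow> nat \<Rightarrow> real mat" where
  "M_block a b s n = mat_of_rows_list 2
     [[lambda1 a n, - (sqrt 2 * s * mu (partner a b n))],
      [0, lambda1 a n]]"

definition A1 ::
  "real \<Rightarrow> real \<Rightarrow> real \<Rightarrow> nat \<Rightarrow> nat \<Rightarrow> (nat \<Rightarrow> nat) \<Rightarrow> (nat \<Rightarrow> nat) \<Rightarrow> real mat" where
  "A1 a b s N0 M0 p1 p2 =
     (let N\<^sub>\<Delta> = card (Delta a b) in diag_block_mat
       (map (\<lambda>i. M_block a b s (p1 i)) [0..<N\<^sub>\<Delta>]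
        @ map (\<lambda>i. mat_of_rows_list 1 [[lambda1 a (p1 i)]]) [N\<^sub>\<Delta>..<N0 + 1]
        @ map (\<lambda>i. mat_of_rows_list 1 [[lambda2 b (p2 i)]]) [N\<^sub>\<Delta>..<M0 + 1]))"

text \<open>The vector of the coefficients of a state along the retained modes; it gives \<open>X\<^sub>1\<close>,
  \<open>B\<^sub>1\<^sub>,\<^sub>u\<close> and \<open>B\<^sub>1\<^sub>,\<^sub>v\<close>.\<close>

definition mode_coeffs ::
  "real \<Rightarrow> real \<Rightarrow> real \<Rightarrow> nat \<Rightarrow> nat \<Rightarrow> (nat \<Rightarrow> nat) \<Rightarrow> (nat \<Rightarrow> nat) \<Rightarrow> state \<Rightarrow> real vec" where
  "mode_coeffs a b s N0 M0 p1 p2 X = bracket (card (Delta a b)) N0 M0 p1 p2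
     (\<lambda>n. inner X (psi1 a b s n)) (\<lambda>m. inner X (psi2 m))"

definition column :: "'a vec \<Rightarrow> 'a mat" where
  "column w = mat_of_cols (dim_vec w) [w]"

definition A1a ::
  "real \<Rightarrow> real \<Rightarrow> real \<Rightarrow> nat \<Rightarrow> nat \<Rightarrow> (nat \<Rightarrow> nat) \<Rightarrow> (nat \<Rightarrow> nat) \<Rightarrow> real mat" where
  "A1a a b s N0 M0 p1 p2 = four_block_mat
     (A1 a b s N0 M0 p1 p2) (column (mode_coeffs a b s N0 M0 p1 p2 (0, alpha b)))
     (0\<^sub>m 1 (N0 + M0 + 2)) (0\<^sub>m 1 1)"

definition B1a ::
  "real \<Rightarrow> real \<Rightarrow> real \<Rightarrow> nat \<Rightarrow> nat \<Rightarrow> (nat \<Rightarrow> nat) \<Rightarrow> (nat \<Rightarrow> nat) \<Rightarrow> real mat" where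
  "B1a a b s N0 M0 p1 p2 =
     column (mode_coeffs a b s N0 M0 p1 p2 (0, beta) @\<^sub>v vec_of_list [1])"

definition X1a ::
  "real \<Rightarrow> real \<Rightarrow> real \<Rightarrow> nat \<Rightarrow> nat \<Rightarrow> (nat \<Rightarrow> nat) \<Rightarrow> (nat \<Rightarrow> nat) \<Rightarrow> state \<Rightarrow> real \<Rightarrow> real vec" where
  "X1a a b s N0 M0 p1 p2 X u = mode_coeffs a b s N0 M0 p1 p2 X @\<^sub>v vec_of_list [u]"

definition spectral_abscissa :: "real mat \<Rightarrow> real" where
  "spectral_abscissa A = Max (Re ` spectrum (map_mat complex_of_real A))"

definition Hurwitz :: "real mat \<Rightarrow> bool" where
  "Hurwitz A \<longleftrightarrow> (\<forall>z \<in> spectrum (map_mat complex_of_real A). Re z < 0)"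

section \<open>The closed-loop system\<close>

definition homogenized :: "(real \<Rightarrow> L2) \<Rightarrow> (real \<Rightarrow> L2) \<Rightarrow> (real \<Rightarrow> real) \<Rightarrow> real \<Rightarrow> state" where
  "homogenized y z u t = (y t, z t - u t *\<^sub>R L2_of phi)"

definition closed_loop_solution ::
  "real \<Rightarrow> real \<Rightarrow> real \<Rightarrow> nat \<Rightarrow> nat \<Rightarrow> (nat \<Rightarrow> nat) \<Rightarrow> (nat \<Rightarrow> nat) \<Rightarrow> real mat \<Rightarrow>
   L2 \<Rightarrow> L2 \<Rightarrow> real \<Rightarrow> (real \<Rightarrow> L2) \<Rightarrow> (real \<Rightarrow> L2) \<Rightarrow> (real \<Rightarrow> real) \<Rightarrow> bool" where
  "closed_loop_solution a b s N0 M0 p1 p2 K y0 z0 u0 y z u \<longleftrightarrow>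
     (let X = homogenized y z u;
          v = (\<lambda>t. - vec_index (K *\<^sub>v X1a a b s N0 M0 p1 p2 (X t) (u t)) 0)
      in y 0 = y0 \<and> z 0 = z0 \<and> u 0 = u0 \<and>
         (\<forall>t\<ge>0. (u has_real_derivative v t) (at t within {0..})) \<and>
         mild_solution a b s (X 0) X u v)"

end

theory Submission
  imports Defs
begin

text \<open>
  The homogenized state \<open>X = (y, z - u \<phi>)\<close> is tested against the eigenfunctions \<open>\<psi>\<^sub>1\<^sub>,\<^sub>n\<close> and
  \<open>\<psi>\<^sub>2\<^sub>,\<^sub>m\<close> of the adjoint operator. Green's formula turns the integrated equation of a mild solution
  into scalar equations \<open>x' = \<lambda> x + u \<alpha> + v \<beta>\<close>, with one extra coupling term for the resonant indices
  (\<open>op_A_psi1\<close>, \<open>op_A_psi2\<close>, \<open>closed_loop_modes\<close>). The finitely many modes up to \<open>N0\<close> and \<open>M0\<close>,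
  together with \<open>u\<close>, form a closed system \<open>w' = F w\<close> with \<open>F = A - B K\<close>. All eigenvalues of \<open>F\<close> lie
  strictly to the left of \<open>-\<delta>\<close>, so Schur triangularization and back substitution give decay of \<open>w\<close>,
  hence of \<open>u\<close> and \<open>v\<close>, at a rate \<open>r\<close> slightly larger than \<open>\<delta>\<close> (\<open>linear_ode_decay\<close>,
  \<open>finite_model_decay\<close>). Every other mode is a scalar equation whose own rate exceeds \<open>r\<close> and which is
  forced by terms of order \<open>exp (-r t)\<close>; the gap between the rates keeps the bound free of polynomial
  factors (\<open>forced_mode_bound\<close>, \<open>all_modes_decay\<close>).

  It remains to pass from modes to norms; write \<open>z\<close> for the second component of \<open>X\<close>. The second
  components \<open>\<psi>\<^sub>2\<^sub>,\<^sub>m\<close> are the cosine basis of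
  \<open>L\<^sup>2(0,1)\<close>, so Parseval's identity controls \<open>z\<close>. The first components of \<open>\<psi>\<^sub>1\<^sub>,\<^sub>n\<close> are another
  orthonormal basis \<open>e\<^sub>n\<close>, the cosines of half-integer frequency \<open>\<omega>\<^sub>n\<close>, and
  \<open>\<langle>y, e\<^sub>n\<rangle> = \<langle>X, \<psi>\<^sub>1\<^sub>,\<^sub>n\<rangle> - \<langle>z, \<psi>\<^sub>1\<^sub>,\<^sub>n\<^sup>2\<rangle>\<close>. The correction is a perturbation that is
  already under control: \<open>\<psi>\<^sub>1\<^sub>,\<^sub>n\<^sup>2\<close> has norm of order \<open>1/\<omega>\<^sub>n\<close>, and against a function of class \<open>H\<^sup>1\<close> it is
  of order \<open>1/\<omega>\<^sub>n\<^sup>2\<close> (\<open>adj_snd_bounds\<close>). Both gains leave square summable sequences, without weight for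
  the \<open>L\<^sup>2\<close> estimate and after multiplication by \<open>\<omega>\<^sub>n\<close> for the \<open>H\<^sup>1\<close> estimate
  (\<open>homogenized_decay\<close>).

  The analytic prerequisites are the completeness of the two cosine systems (\<open>total_cos_mode\<close>,
  \<open>total_hcos_mode\<close>), and the description of \<open>H\<^sup>1(0,1)\<close> by primitives and by weighted
  Fourier coefficients (\<open>has_weak_deriv_imp_prim\<close>, \<open>H1_if_cos_coeffs\<close>, \<open>H1_if_hcos_coeffs\<close>); the
  latter also shows that a solution starting in \<open>\<H>\<^sup>1\<close> stays there.
\<close>

section \<open>Orthonormal systems in a Hilbert space\<close>

definition orthonormal :: "(nat \<Rightarrow> 'a::real_inner) \<Rightarrow> bool" where
  "orthonormal e \<longleftrightarrow> (\<forall>i j. inner (e i) (e j) = (if i = j then 1 else 0))"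

lemma orthonormalD: "orthonormal e \<Longrightarrow> inner (e i) (e j) = (if i = j then 1 else 0)"
  unfolding orthonormal_def by blast

definition total_system :: "(nat \<Rightarrow> 'a::real_inner) \<Rightarrow> bool" where
  "total_system e \<longleftrightarrow> (\<forall>f. (\<forall>n. inner f (e n) = 0) \<longrightarrow> f = 0)"

lemma orthonormal_inner_sum:
  assumes "orthonormal e" "finite A"
  shows "inner (\<Sum>n\<in>A. c n *\<^sub>R e n) (e k) = (if k \<in> A then c k else 0)"
proof -
  have e: "inner (e n) (e k) = (if n = k then 1 else 0)" for n
    by (rule orthonormalD[OF assms(1)])
  show ?thesis
    using assms(2) by (simp add: inner_sum_left e if_distrib cong: if_cong)
qed

lemma orthonormal_norm_sum:
  assumes "orthonormal e" "finite A"
  shows "(norm (\<Sum>n\<in>A. c n *\<^sub>R e n))\<^sup>2 = (\<Sum>n\<in>A. (c n)\<^sup>2)"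
  unfolding power2_norm_eq_inner
  using orthonormal_inner_sum[OF assms, of c]
  by (subst inner_sum_right) (auto simp: power2_eq_square intro!: sum.cong)

lemma bessel_finite:
  assumes "orthonormal e"
  shows "(\<Sum>n<N. (inner f (e n))\<^sup>2) \<le> (norm f)\<^sup>2"
proof -
  let ?S = "\<Sum>n<N. inner f (e n) *\<^sub>R e n"
  have "inner f ?S = (\<Sum>n<N. (inner f (e n))\<^sup>2)"
    by (simp add: inner_sum_right power2_eq_square)
  moreover have "inner ?S ?S = (\<Sum>n<N. (inner f (e n))\<^sup>2)"
    using orthonormal_norm_sum[OF assms, of "{..<N}"] by (simp add: power2_norm_eq_inner)
  moreover have "0 \<le> inner (f - ?S) (f - ?S)"
    by simp
  ultimately show ?thesis
    by (simp add: inner_diff_left inner_diff_right power2_norm_eq_inner inner_commute)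
qed

lemma bessel_summable:
  assumes "orthonormal e"
  shows "summable (\<lambda>n. (inner f (e n))\<^sup>2)"
  by (rule bounded_imp_summable[where B="(norm f)\<^sup>2"])
    (use bessel_finite[OF assms, of f "Suc _"] in \<open>auto simp: lessThan_Suc_atMost\<close>)

lemma bessel:
  assumes "orthonormal e"
  shows "(\<Sum>n. (inner f (e n))\<^sup>2) \<le> (norm f)\<^sup>2"
  by (intro suminf_le_const bessel_summable bessel_finite assms)

text \<open>By Pythagoras the norms of blocks of the vector series are those of the scalar series of
  squares, so one is Cauchy when the other is.\<close>

lemma riesz_fischer_summable:
  fixes e :: "nat \<Rightarrow> 'a::{real_inner,banach}"
  assumes "orthonormal e" "summable (\<lambda>n. (c n)\<^sup>2)"
  shows "summable (\<lambda>n. c n *\<^sub>R e n)"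
  unfolding summable_Cauchy
proof (intro allI impI)
  fix r :: real assume "r > 0"
  then obtain N where N: "\<And>m n. m \<ge> N \<Longrightarrow> norm (\<Sum>k=m..<n. (c k)\<^sup>2) < r\<^sup>2"
    using assms(2) unfolding summable_Cauchy by (metis zero_less_power)
  have "norm (\<Sum>k=m..<n. c k *\<^sub>R e k) < r" if "m \<ge> N" for m n
  proof (rule power2_less_imp_less)
    show "(norm (\<Sum>k=m..<n. c k *\<^sub>R e k))\<^sup>2 < r\<^sup>2"
      using N[OF that, of n] orthonormal_norm_sum[OF assms(1), of "{m..<n}" c] by auto
  qed (use \<open>r > 0\<close> in auto)
  then show "\<exists>N. \<forall>m\<ge>N. \<forall>n. norm (\<Sum>k=m..<n. c k *\<^sub>R e k) < r"
    by blast
qed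

lemma riesz_fischer_inner:
  fixes e :: "nat \<Rightarrow> 'a::{real_inner,banach}"
  assumes "orthonormal e" "summable (\<lambda>n. (c n)\<^sup>2)"
  shows "inner (\<Sum>n. c n *\<^sub>R e n) (e k) = c k"
proof -
  have "(\<lambda>n. inner (c n *\<^sub>R e n) (e k)) sums inner (\<Sum>n. c n *\<^sub>R e n) (e k)"
    by (intro bounded_linear.sums[OF bounded_linear_inner_left] summable_sums
        riesz_fischer_summable assms)
  moreover have "(\<lambda>n. inner (c n *\<^sub>R e n) (e k)) sums c k"
    using sums_single[of k c] by (simp add: orthonormalD[OF assms(1)] if_distrib cong: if_cong)
  ultimately show ?thesis
    by (rule sums_unique2)
qed

lemma riesz_fischer_norm:
  fixes e :: "nat \<Rightarrow> 'a::{real_inner,banach}"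
  assumes "orthonormal e" "summable (\<lambda>n. (c n)\<^sup>2)"
  shows "(norm (\<Sum>n. c n *\<^sub>R e n))\<^sup>2 = (\<Sum>n. (c n)\<^sup>2)"
proof -
  have "(\<lambda>N. (norm (\<Sum>n<N. c n *\<^sub>R e n))\<^sup>2) \<longlonglongrightarrow> (norm (\<Sum>n. c n *\<^sub>R e n))\<^sup>2"
    by (intro tendsto_intros summable_LIMSEQ riesz_fischer_summable assms)
  then have "(\<lambda>N. \<Sum>n<N. (c n)\<^sup>2) \<longlonglongrightarrow> (norm (\<Sum>n. c n *\<^sub>R e n))\<^sup>2"
    by (simp add: orthonormal_norm_sum[OF assms(1)])
  with summable_LIMSEQ[OF assms(2)] show ?thesis
    by (rule LIMSEQ_unique[symmetric])
qed

lemma orthonormal_expansion: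
  fixes e :: "nat \<Rightarrow> 'a::{real_inner,banach}"
  assumes "orthonormal e" "total_system e"
  shows "(\<Sum>n. inner f (e n) *\<^sub>R e n) = f"
proof -
  have "inner (f - (\<Sum>n. inner f (e n) *\<^sub>R e n)) (e k) = 0" for k
    by (simp add: inner_diff_left riesz_fischer_inner[OF assms(1) bessel_summable[OF assms(1)]])
  then have "f - (\<Sum>n. inner f (e n) *\<^sub>R e n) = 0"
    using assms(2) unfolding total_system_def by blast
  then show ?thesis
    by simp
qed

lemma parseval:
  fixes e :: "nat \<Rightarrow> 'a::{real_inner,banach}"
  assumes "orthonormal e" "total_system e"
  shows "(\<Sum>n. (inner f (e n))\<^sup>2) = (norm f)\<^sup>2"
  using riesz_fischer_norm[OF assms(1) bessel_summable[OF assms(1)]]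
  by (simp add: orthonormal_expansion[OF assms])

text \<open>The density argument used below: an identity between continuous linear functionals needs
  to be checked on a total orthonormal system only.\<close>

lemma bounded_linear_eq_0_if_total:
  fixes e :: "nat \<Rightarrow> 'a::{real_inner,banach}" and L :: "'a \<Rightarrow> real"
  assumes "orthonormal e" "total_system e" "bounded_linear L" "\<And>n. L (e n) = 0"
  shows "L f = 0"
proof -
  have "L f = L (\<Sum>n. inner f (e n) *\<^sub>R e n)"
    by (simp add: orthonormal_expansion[OF assms(1,2)])
  also have "\<dots> = (\<Sum>n. L (inner f (e n) *\<^sub>R e n))"
    by (intro bounded_linear.suminf assms(3) riesz_fischer_summable bessel_summable assms(1))
  also have "\<dots> = 0"
    using assms(3,4) by (simp add: linear_simps)
  finally show ?thesis .
qed

section \<open>Continuous functions as square integrable classes\<close>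

lemma continuous_imp_square_integrable:
  assumes "continuous_on {0..1} f"
  shows "square_integrable f"
proof -
  have m: "f \<in> borel_measurable leb01"
    by (intro continuous_imp_measurable_on_sets_lebesgue continuous_on_subset[OF assms]) auto
  have "compact (f ` {0..1})"
    by (intro compact_continuous_image assms) auto
  then obtain B where B: "\<And>x. x \<in> {0..1} \<Longrightarrow> norm (f x) \<le> B"
    using compact_imp_bounded bounded_iff by (metis image_eqI)
  have "integrable leb01 (\<lambda>x. (f x)\<^sup>2)"
  proof (rule leb01.integrable_const_bound[of _ "B\<^sup>2"])
    show "AE x in leb01. norm ((f x)\<^sup>2) \<le> B\<^sup>2"
    proof (rule AE_I2)
      fix x assume "x \<in> space leb01"
      then have "norm (f x) \<le> B" by (intro B) auto
      then show "norm ((f x)\<^sup>2) \<le> B\<^sup>2"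
        using power_mono[of "norm (f x)" B 2] by simp
    qed
  qed (use m in auto)
  with m show ?thesis
    by (simp add: square_integrable_def)
qed

lemma L2_of_cong:
  assumes "\<And>x. x \<in> {0<..<1} \<Longrightarrow> f x = g x" "square_integrable f"
  shows "L2_of f = L2_of g"
proof -
  have "square_integrable g"
  proof -
    have "f \<in> borel_measurable leb01 \<longleftrightarrow> g \<in> borel_measurable leb01"
      by (rule measurable_cong) (use assms(1) in auto)
    moreover have "integrable leb01 (\<lambda>x. (f x)\<^sup>2) \<longleftrightarrow> integrable leb01 (\<lambda>x. (g x)\<^sup>2)"
      by (rule Bochner_Integration.integrable_cong) (use assms(1) in auto)
    ultimately show ?thesis
      using assms(2) by (simp add: square_integrable_def)
  qed
  then show ?thesis
    using assms by (subst L2_of_eq_iff) auto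
qed

lemma L2_of_add:
  "square_integrable f \<Longrightarrow> square_integrable g \<Longrightarrow> L2_of (\<lambda>x. f x + g x) = L2_of f + L2_of g"
  by (auto simp: plus_L2.abs_eq L2_rel_def)

lemma L2_of_scale:
  "square_integrable f \<Longrightarrow> L2_of (\<lambda>x. c * f x) = c *\<^sub>R L2_of f"
  by (auto simp: scaleR_L2.abs_eq L2_rel_def)

lemma LINT_leb01_eq_integral:
  fixes f :: "real \<Rightarrow> real"
  assumes "integrable leb01 f"
  shows "(LINT x|leb01. f x) = integral {0<..<1} f"
  by (rule lebesgue_integral_eq_integral[OF assms]) auto

lemma integrable_leb01_continuous:
  fixes f :: "real \<Rightarrow> real"
  assumes "continuous_on {0..1} f"
  shows "integrable leb01 f"
  using square_integrable_mult[OF continuous_imp_square_integrable[OF assms]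
      continuous_imp_square_integrable[of "\<lambda>_. 1"]] by simp

text \<open>The measure lives on the open interval, but primitives are compared at the end points,
  so the derivative is required on the closed one.\<close>

lemma LINT_leb01_FTC:
  assumes "\<And>x. x \<in> {0..1} \<Longrightarrow> (F has_real_derivative f x) (at x within {0..1})"
    and "continuous_on {0..1} f"
  shows "(LINT x|leb01. f x) = F 1 - F (0::real)"
proof -
  have "(f has_integral (F 1 - F 0)) {0..1}"
    using assms(1) by (intro fundamental_theorem_of_calculus)
      (auto simp: has_real_derivative_iff_has_vector_derivative)
  then have "(f has_integral (F 1 - F 0)) {0<..<1}"
    by (simp add: has_integral_Icc_iff_Ioo)
  then show ?thesis
    using LINT_leb01_eq_integral[OF integrable_leb01_continuous[OF assms(2)]]
    by (simp add: integral_unique)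
qed

lemma norm_L2_of_le:
  assumes "square_integrable f" "\<And>x. x \<in> {0<..<1} \<Longrightarrow> \<bar>f x\<bar> \<le> B" "B \<ge> 0"
  shows "norm (L2_of f) \<le> B"
proof (rule power2_le_imp_le)
  have "(LINT x|leb01. (f x)\<^sup>2) \<le> (LINT x|leb01. B\<^sup>2)"
  proof (rule integral_mono)
    fix x assume "x \<in> space leb01"
    then have "\<bar>f x\<bar> \<le> B" using assms(2) by simp
    then show "(f x)\<^sup>2 \<le> B\<^sup>2" using assms(3) by (metis abs_ge_zero power2_abs power_mono)
  qed (use assms in \<open>auto simp: square_integrable_def\<close>)
  also have "\<dots> = B\<^sup>2"
    by (simp add: measure_restrict_space)
  finally show "(norm (L2_of f))\<^sup>2 \<le> B\<^sup>2"
    by (simp add: norm_L2_of_sq[OF assms(1)])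
qed (use assms in auto)

section \<open>Trigonometric bases\<close>

lemma LINT_cos_int:
  "(LINT x|leb01. cos (of_int k * pi * x)) = (if k = 0 then 1 else 0)"
proof (cases "k = 0")
  case False
  have "(LINT x|leb01. cos (of_int k * pi * x))
      = sin (of_int k * pi * 1) / (of_int k * pi) - sin (of_int k * pi * 0) / (of_int k * pi)"
    using False
    by (intro LINT_leb01_FTC) (auto intro!: derivative_eq_intros continuous_intros)
  then show ?thesis
    using False by (simp add: sin_integer_2pi sin_zero_iff_int2 mult.commute[of _ pi])
qed (simp add: measure_restrict_space)

lemma LINT_cos_cos:
  assumes "p - q = of_int i" "p + q = of_int j"
  shows "(LINT x|leb01. cos (p * pi * x) * cos (q * pi * x)) = ((if i = 0 then 1 else 0) + (if j = 0 then 1 else 0)) / 2"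
proof -
  have "(LINT x|leb01. cos (p * pi * x) * cos (q * pi * x))
      = (LINT x|leb01. (cos (of_int i * pi * x) + cos (of_int j * pi * x)) / 2)"
    unfolding assms[symmetric]
    by (intro Bochner_Integration.integral_cong refl) (simp add: cos_times_cos algebra_simps)
  also have "\<dots> = ((LINT x|leb01. cos (of_int i * pi * x)) + (LINT x|leb01. cos (of_int j * pi * x))) / 2"
    by (subst integral_divide_zero, subst Bochner_Integration.integral_add)
      (auto intro!: integrable_leb01_continuous continuous_intros)
  finally show ?thesis by (simp add: LINT_cos_int)
qed

lemma LINT_sin_sin:
  assumes "p - q = of_int i" "p + q = of_int j"
  shows "(LINT x|leb01. sin (p * pi * x) * sin (q * pi * x)) = ((if i = 0 then 1 else 0) - (if j = 0 then 1 else 0)) / 2"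
proof -
  have "(LINT x|leb01. sin (p * pi * x) * sin (q * pi * x))
      = (LINT x|leb01. (cos (of_int i * pi * x) - cos (of_int j * pi * x)) / 2)"
    unfolding assms[symmetric]
    by (intro Bochner_Integration.integral_cong refl) (simp add: sin_times_sin algebra_simps)
  also have "\<dots> = ((LINT x|leb01. cos (of_int i * pi * x)) - (LINT x|leb01. cos (of_int j * pi * x))) / 2"
    by (subst integral_divide_zero, subst Bochner_Integration.integral_diff)
      (auto intro!: integrable_leb01_continuous continuous_intros)
  finally show ?thesis by (simp add: LINT_cos_int)
qed

definition cos_mode :: "nat \<Rightarrow> L2" where
  "cos_mode m = L2_of (\<lambda>x. mu m * cos (real m * pi * x))"

definition sin_mode :: "nat \<Rightarrow> L2" where
  "sin_mode m = L2_of (\<lambda>x. sqrt 2 * sin (real (Suc m) * pi * x))"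

definition omega :: "nat \<Rightarrow> real" where
  "omega n = (real n + 1/2) * pi"

text \<open>The eigenfunctions of the second derivative with zero slope at \<open>0\<close> and zero
  value at \<open>1\<close>.\<close>

definition hcos_mode :: "nat \<Rightarrow> L2" where
  "hcos_mode n = L2_of (\<lambda>x. sqrt 2 * cos ((real n + 1/2) * pi * x))"

definition hsin_mode :: "nat \<Rightarrow> L2" where
  "hsin_mode n = L2_of (\<lambda>x. sqrt 2 * sin ((real n + 1/2) * pi * x))"

lemma inner_L2_of_scaled:
  assumes "continuous_on {0..1} f" "continuous_on {0..1} g"
  shows "inner (L2_of (\<lambda>x. c * f x)) (L2_of (\<lambda>x. d * g x)) = c * d * (LINT x|leb01. f x * g x)"
  using assms
  by (simp add: L2_of_scale inner_L2_of continuous_imp_square_integrable)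

lemma orthonormal_cos_mode: "orthonormal cos_mode"
  unfolding orthonormal_def
proof (intro allI)
  fix i j
  have "inner (cos_mode i) (cos_mode j)
      = mu i * mu j * (LINT x|leb01. cos (real i * pi * x) * cos (real j * pi * x))"
    unfolding cos_mode_def by (intro inner_L2_of_scaled continuous_intros)
  also have "(LINT x|leb01. cos (real i * pi * x) * cos (real j * pi * x))
     = ((if int i - int j = 0 then 1 else 0) + (if int i + int j = 0 then 1 else 0)) / 2"
    by (rule LINT_cos_cos) auto
  finally show "inner (cos_mode i) (cos_mode j) = (if i = j then 1 else 0)"
    by (cases "i = j"; cases "j = 0") (auto simp: mu_def)
qed

lemma orthonormal_sin_mode: "orthonormal sin_mode"
  unfolding orthonormal_def
proof (intro allI)
  fix i j
  have "inner (sin_mode i) (sin_mode j)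
      = sqrt 2 * sqrt 2 * (LINT x|leb01. sin (real (Suc i) * pi * x) * sin (real (Suc j) * pi * x))"
    unfolding sin_mode_def by (intro inner_L2_of_scaled continuous_intros)
  also have "(LINT x|leb01. sin (real (Suc i) * pi * x) * sin (real (Suc j) * pi * x))
     = ((if int i - int j = 0 then 1 else 0) - (if int i + int j + 2 = 0 then 1 else 0)) / 2"
    by (rule LINT_sin_sin) auto
  finally show "inner (sin_mode i) (sin_mode j) = (if i = j then 1 else 0)"
    by auto
qed

lemma orthonormal_hcos_mode: "orthonormal hcos_mode"
  unfolding orthonormal_def
proof (intro allI)
  fix i j
  have "inner (hcos_mode i) (hcos_mode j)
      = sqrt 2 * sqrt 2 * (LINT x|leb01. cos ((real i + 1/2) * pi * x) * cos ((real j + 1/2) * pi * x))"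
    unfolding hcos_mode_def by (intro inner_L2_of_scaled continuous_intros)
  also have "(LINT x|leb01. cos ((real i + 1/2) * pi * x) * cos ((real j + 1/2) * pi * x))
     = ((if int i - int j = 0 then 1 else 0) + (if int i + int j + 1 = 0 then 1 else 0)) / 2"
    by (rule LINT_cos_cos) auto
  finally show "inner (hcos_mode i) (hcos_mode j) = (if i = j then 1 else 0)"
    by auto
qed

lemma orthonormal_hsin_mode: "orthonormal hsin_mode"
  unfolding orthonormal_def
proof (intro allI)
  fix i j
  have "inner (hsin_mode i) (hsin_mode j)
      = sqrt 2 * sqrt 2 * (LINT x|leb01. sin ((real i + 1/2) * pi * x) * sin ((real j + 1/2) * pi * x))"
    unfolding hsin_mode_def by (intro inner_L2_of_scaled continuous_intros)
  also have "(LINT x|leb01. sin ((real i + 1/2) * pi * x) * sin ((real j + 1/2) * pi * x))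
     = ((if int i - int j = 0 then 1 else 0) - (if int i + int j + 1 = 0 then 1 else 0)) / 2"
    by (rule LINT_sin_sin) auto
  finally show "inner (hsin_mode i) (hsin_mode j) = (if i = j then 1 else 0)"
    by auto
qed

lemma square_integrable_mult_bounded:
  assumes f: "square_integrable f" and g: "g \<in> borel_measurable leb01"
    and B: "\<And>x. x \<in> {0<..<1} \<Longrightarrow> \<bar>g x\<bar> \<le> B"
  shows "square_integrable (\<lambda>x. f x * g x)"
  unfolding square_integrable_def
proof
  show m: "(\<lambda>x. f x * g x) \<in> borel_measurable leb01"
    using f g by (auto simp: square_integrable_def)
  show "integrable leb01 (\<lambda>x. (f x * g x)\<^sup>2)"
  proof (rule Bochner_Integration.integrable_bound)
    show "integrable leb01 (\<lambda>x. (f x)\<^sup>2 * B\<^sup>2)"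
      using f by (auto simp: square_integrable_def)
    show "AE x in leb01. norm ((f x * g x)\<^sup>2) \<le> norm ((f x)\<^sup>2 * B\<^sup>2)"
    proof (rule AE_I2)
      fix x assume "x \<in> space leb01"
      then have "\<bar>g x\<bar> \<le> B" using B by simp
      then have "(g x)\<^sup>2 \<le> B\<^sup>2" by (metis abs_ge_zero power2_abs power_mono)
      then show "norm ((f x * g x)\<^sup>2) \<le> norm ((f x)\<^sup>2 * B\<^sup>2)"
        by (simp add: power_mult_distrib mult_left_mono)
    qed
  qed (use m in auto)
qed

lemma borel_measurable_leb01_continuous:
  fixes f :: "real \<Rightarrow> real"
  assumes "continuous_on {0..1} f" shows "f \<in> borel_measurable leb01"
  using continuous_imp_square_integrable[OF assms] by (simp add: square_integrable_def)

text \<open>The function is tested against its own sign: as a measurable function, the sign is an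
  almost everywhere limit of continuous functions, and truncating these to \<open>[-1, 1]\<close>
  permits dominated convergence. The limit is \<open>\<integral>\<bar>f\<bar> = 0\<close>.\<close>

lemma eq_0_if_orthogonal_continuous:
  assumes f: "square_integrable f"
    and 0: "\<And>h. continuous_on UNIV h \<Longrightarrow> (LINT x|leb01. f x * h x) = 0"
  shows "L2_of f = 0"
proof -
  have fm: "f \<in> borel_measurable leb01" using f by (simp add: square_integrable_def)
  have fi: "integrable leb01 f"
    using square_integrable_mult[OF f continuous_imp_square_integrable[of "\<lambda>_. 1"]] by simp
  have "(\<lambda>x. sgn (f x)) \<in> borel_measurable leb01" using fm by measurable
  then have "(\<lambda>x. sgn (f x)) measurable_on {0<..<1}"
    by (subst measurable_on_iff_borel_measurable) auto
  then obtain N g where N: "negligible N" and gc: "\<And>n. continuous_on UNIV (g n)"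
    and lim: "\<And>x. x \<notin> N \<Longrightarrow> (\<lambda>n. g n x) \<longlonglongrightarrow> (if x \<in> {0<..<1} then sgn (f x) else 0)"
    unfolding measurable_on_def by blast
  define h where "h n x = max (-1) (min 1 (g n x))" for n x
  have hc: "continuous_on UNIV (h n)" for n
    unfolding h_def by (intro continuous_intros gc)
  have AE: "AE x in leb01. x \<notin> N"
    using N by (subst AE_restrict_space_iff)
      (auto simp: negligible_iff_null_sets intro: AE_not_in eventually_mono)
  have "(\<lambda>n. LINT x|leb01. f x * h n x) \<longlonglongrightarrow> (LINT x|leb01. \<bar>f x\<bar>)"
  proof (rule integral_dominated_convergence[where w="\<lambda>x. \<bar>f x\<bar>"])
    show "(\<lambda>x. f x * h n x) \<in> borel_measurable leb01" for n
      using borel_measurable_leb01_continuous[OF continuous_on_subset[OF hc[of n] subset_UNIV]] fm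
      by measurable
    show "AE x in leb01. (\<lambda>n. f x * h n x) \<longlonglongrightarrow> \<bar>f x\<bar>"
      using AE AE_space
    proof eventually_elim
      case (elim x)
      have "(\<lambda>n. h n x) \<longlonglongrightarrow> max (-1) (min 1 (sgn (f x)))"
        unfolding h_def using lim[of x] elim by (intro tendsto_intros) auto
      also have "max (-1) (min 1 (sgn (f x))) = sgn (f x)"
        by (simp add: sgn_if)
      finally have "(\<lambda>n. f x * h n x) \<longlonglongrightarrow> f x * sgn (f x)"
        by (intro tendsto_intros)
      then show ?case by (simp add: abs_sgn)
    qed
    show "AE x in leb01. norm (f x * h n x) \<le> \<bar>f x\<bar>" for n
      by (rule AE_I2) (auto simp: h_def abs_mult intro!: mult_left_le)
  qed (use fi fm in auto)
  then have "(LINT x|leb01. \<bar>f x\<bar>) = 0"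
    using 0[OF hc] by (simp add: LIMSEQ_const_iff)
  then have "AE x in leb01. f x = 0"
    using fi by (subst (asm) integral_nonneg_eq_0_iff_AE) auto
  then show ?thesis
    using f by (simp add: zero_L2.abs_eq L2_of_eq_iff square_integrable_zero)
qed

definition cos_orthogonal :: "(real \<Rightarrow> real) \<Rightarrow> bool" where
  "cos_orthogonal f \<longleftrightarrow> square_integrable f \<and> (\<forall>m::nat. (LINT x|leb01. f x * cos (real m * pi * x)) = 0)"

text \<open>The product formula writes \<open>cos (\<pi> x) cos (m \<pi> x)\<close> as a mean of two
  cosines of the system.\<close>

lemma cos_orthogonal_mult_cos:
  assumes "cos_orthogonal f" shows "cos_orthogonal (\<lambda>x. f x * cos (pi * x))"
proof -
  have f: "square_integrable f" and z: "\<And>m::nat. (LINT x|leb01. f x * cos (real m * pi * x)) = 0"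
    using assms by (auto simp: cos_orthogonal_def)
  have s: "square_integrable (\<lambda>x. cos (real m * pi * x))" for m :: nat
    by (intro continuous_imp_square_integrable continuous_intros)
  have "(LINT x|leb01. f x * cos (pi * x) * cos (real m * pi * x)) = 0" for m :: nat
  proof (cases m)
    case 0
    then show ?thesis using z[of 1] by simp
  next
    case (Suc k)
    have "(LINT x|leb01. f x * cos (pi * x) * cos (real m * pi * x))
       = (LINT x|leb01. (f x * cos (real k * pi * x) + f x * cos (real (k+2) * pi * x)) / 2)"
    proof (intro Bochner_Integration.integral_cong refl)
      fix x
      have "cos (pi * x) * cos (real m * pi * x) = (cos (real k * pi * x) + cos (real (k+2) * pi * x)) / 2"
        unfolding Suc cos_times_cos
        by (subst cos_minus[symmetric]) (simp add: algebra_simps)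
      then show "f x * cos (pi * x) * cos (real m * pi * x) = (f x * cos (real k * pi * x) + f x * cos (real (k+2) * pi * x)) / 2"
        by (simp add: mult.assoc distrib_left)
    qed
    also have "\<dots> = 0"
      using z[of k] z[of "k+2"] 
      by (subst integral_divide_zero, subst Bochner_Integration.integral_add)
        (auto intro!: square_integrable_mult f s[of "k+2", simplified] s)
    finally show ?thesis .
  qed
  moreover have "square_integrable (\<lambda>x. f x * cos (pi * x))"
    by (rule square_integrable_mult_bounded[where B=1])
      (auto intro!: f borel_measurable_leb01_continuous continuous_intros)
  ultimately show ?thesis by (simp add: cos_orthogonal_def)
qed

lemma cos_orthogonal_scale: "cos_orthogonal f \<Longrightarrow> cos_orthogonal (\<lambda>x. f x * c)"
  using square_integrable_scale[of f c]
  by (auto simp: cos_orthogonal_def mult.commute[of _ c] mult.assoc)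

lemma cos_orthogonal_add:
  assumes "cos_orthogonal f" "cos_orthogonal g" shows "cos_orthogonal (\<lambda>x. f x + g x)"
proof -
  have s: "square_integrable (\<lambda>x. cos (real m * pi * x))" for m :: nat
    by (intro continuous_imp_square_integrable continuous_intros)
  show ?thesis
    using assms square_integrable_add[of f g] square_integrable_mult[OF _ s]
    by (auto simp: cos_orthogonal_def distrib_right)
qed

lemma cos_orthogonal_polynomial:
  assumes "real_polynomial_function P" "cos_orthogonal f"
  shows "cos_orthogonal (\<lambda>x. f x * P (cos (pi * x)))"
  using assms
proof (induction arbitrary: f rule: real_polynomial_function.induct)
  case (linear P)
  have "P y = y * P 1" for y
    using linear_simps(5)[OF linear(1), of y 1] by simp
  then have "(\<lambda>x. f x * P (cos (pi * x))) = (\<lambda>x. (f x * cos (pi * x)) * P 1)"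
    by (metis mult.assoc)
  then show ?case
    using cos_orthogonal_scale[OF cos_orthogonal_mult_cos[OF linear(2)]] by simp
next
  case (const c)
  then show ?case by (rule cos_orthogonal_scale)
next
  case (add P Q)
  then show ?case
    using cos_orthogonal_add[OF add.IH(1)[OF add.prems] add.IH(2)[OF add.prems]]
    by (simp add: distrib_left)
next
  case (mult P Q)
  then show ?case
    using mult.IH(2)[OF mult.IH(1)[OF mult.prems]] by (simp add: mult.assoc)
qed

text \<open>The map \<open>x \<mapsto> cos (\<pi> x)\<close> is a homeomorphism of \<open>[0,
  1]\<close> onto \<open>[-1, 1]\<close>. By the Weierstrass theorem every continuous function of
  \<open>x\<close> is therefore a uniform limit of polynomials in \<open>cos (\<pi> x)\<close>, and
  \<open>f\<close> is orthogonal to those.\<close>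

lemma cos_orthogonal_imp_0:
  assumes "cos_orthogonal f" shows "L2_of f = 0"
proof (rule eq_0_if_orthogonal_continuous)
  show f: "square_integrable f" using assms by (simp add: cos_orthogonal_def)
  fix h :: "real \<Rightarrow> real" assume h: "continuous_on UNIV h"
  \<comment> \<open>\<open>h\<close> as a function of \<open>y = cos (\<pi> x)\<close>\<close>
  define H where "H y = h (arccos y / pi)" for y
  have Hc: "continuous_on {-1..1} H"
    unfolding H_def
    by (intro continuous_on_compose2[OF h] continuous_intros) auto
  have sh: "square_integrable h"
    by (intro continuous_imp_square_integrable continuous_on_subset[OF h]) auto
  have "\<bar>LINT x|leb01. f x * h x\<bar> \<le> norm (L2_of f) * e" if "e > 0" for e
  proof -
    obtain P where P0: "polynomial_function P" and Py: "\<forall>y\<in>{-1..1}. norm (H y - P y) < e"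
      using Stone_Weierstrass_polynomial_function[OF compact_Icc Hc \<open>e > 0\<close>] by blast
    have P: "real_polynomial_function P" "\<And>y. y \<in> {-1..1} \<Longrightarrow> norm (H y - P y) < e"
      using P0 Py by (simp_all only: real_polynomial_function_eq)
    have Pc: "continuous_on {0..1} (\<lambda>x. P (cos (pi * x)))"
      by (rule continuous_on_compose2[OF continuous_on_polymonial_function[OF P0, of UNIV]])
        (auto intro!: continuous_intros)
    note sP = continuous_imp_square_integrable[OF Pc]
    have orth: "(LINT x|leb01. f x * P (cos (pi * x))) = 0"
      using cos_orthogonal_polynomial[OF P(1) assms] unfolding cos_orthogonal_def
      by (auto dest: spec[of _ 0])
    have "(LINT x|leb01. f x * h x) = inner (L2_of f) (L2_of h - L2_of (\<lambda>x. P (cos (pi * x))))"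
      using orth by (simp add: inner_diff_right inner_L2_of f sh sP)
    also have "\<bar>\<dots>\<bar> \<le> norm (L2_of f) * norm (L2_of h - L2_of (\<lambda>x. P (cos (pi * x))))"
      by (rule Cauchy_Schwarz_ineq2)
    also have "norm (L2_of h - L2_of (\<lambda>x. P (cos (pi * x)))) \<le> e"
      unfolding diff_L2_of[OF sh sP]
    proof (rule norm_L2_of_le)
      fix x :: real assume x: "x \<in> {0<..<1}"
      then have "H (cos (pi * x)) = h x"
        by (simp add: H_def arccos_cos)
      then show "\<bar>h x - P (cos (pi * x))\<bar> \<le> e"
        using P(2)[of "cos (pi * x)"] by simp
    qed (use \<open>e > 0\<close> in \<open>auto intro!: square_integrable_diff sh sP\<close>)
    finally show ?thesis by (simp add: mult_left_mono)
  qed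
  note * = this
  have "\<bar>LINT x|leb01. f x * h x\<bar> \<le> 0 + e" if "e > 0" for e
  proof -
    have "\<bar>LINT x|leb01. f x * h x\<bar> \<le> norm (L2_of f) * (e / (norm (L2_of f) + 1))"
      using that by (intro *) (auto simp: add_nonneg_pos)
    also have "\<dots> \<le> e"
      using that norm_ge_zero[of "L2_of f"]
      by (simp add: pos_divide_le_eq add_pos_nonneg add_nonneg_pos algebra_simps)
    finally show ?thesis by simp
  qed
  then have "\<bar>LINT x|leb01. f x * h x\<bar> \<le> 0"
    by (rule field_le_epsilon)
  then show "(LINT x|leb01. f x * h x) = 0" by simp
qed

lemma total_cos_mode: "total_system cos_mode"
  unfolding total_system_def
proof (intro allI impI)
  fix g assume 0: "\<forall>n. inner g (cos_mode n) = 0"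
  define f where "f = L2_rep g"
  have f: "square_integrable f" "g = L2_of f"
    by (auto simp: f_def L2_rep_square_integrable L2_of_L2_rep)
  have s: "square_integrable (\<lambda>x. cos (real m * pi * x))" for m :: nat
    by (intro continuous_imp_square_integrable continuous_intros)
  have "(LINT x|leb01. f x * cos (real m * pi * x)) = 0" for m
    using spec[OF 0, of m] by (auto simp: f cos_mode_def L2_of_scale s inner_L2_of mu_def split: if_splits)
  then show "g = 0"
    using cos_orthogonal_imp_0[of f] f by (simp add: cos_orthogonal_def)
qed

text \<open>Since \<open>2 cos (\<pi> x / 2) cos (m \<pi> x)\<close> is a sum of two half-integer
  cosines, \<open>f cos (\<pi> x / 2)\<close> is orthogonal to all integer cosines and hence
  vanishes; the factor has no zero in \<open>(0, 1)\<close>.\<close>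

lemma total_hcos_mode: "total_system hcos_mode"
  unfolding total_system_def
proof (intro allI impI)
  fix g assume 0: "\<forall>n. inner g (hcos_mode n) = 0"
  define f where "f = L2_rep g"
  have f: "square_integrable f" "g = L2_of f"
    by (auto simp: f_def L2_rep_square_integrable L2_of_L2_rep)
  have s: "square_integrable (\<lambda>x. cos ((real m + 1/2) * pi * x))" for m :: nat
    by (intro continuous_imp_square_integrable continuous_intros)
  have z: "(LINT x|leb01. f x * cos ((real m + 1/2) * pi * x)) = 0" for m :: nat
    using spec[OF 0, of m] by (simp add: f hcos_mode_def L2_of_scale s inner_L2_of)
  have sf: "square_integrable (\<lambda>x. f x * cos (1/2 * pi * x))"
    by (rule square_integrable_mult_bounded[where B=1])
      (auto intro!: f borel_measurable_leb01_continuous continuous_intros)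
  have "(LINT x|leb01. f x * cos (1/2 * pi * x) * cos (real m * pi * x)) = 0" for m :: nat
  proof (cases m)
    case 0
    then show ?thesis using z[of 0] by simp
  next
    case (Suc k)
    have "(LINT x|leb01. f x * cos (1/2 * pi * x) * cos (real m * pi * x))
       = (LINT x|leb01. (f x * cos ((real k + 1/2) * pi * x) + f x * cos ((real m + 1/2) * pi * x)) / 2)"
    proof (intro Bochner_Integration.integral_cong refl)
      fix x
      have "cos (1/2 * pi * x) * cos (real m * pi * x) = (cos ((real k + 1/2) * pi * x) + cos ((real m + 1/2) * pi * x)) / 2"
        unfolding Suc cos_times_cos
        by (subst cos_minus[symmetric]) (simp add: algebra_simps)
      then show "f x * cos (1/2 * pi * x) * cos (real m * pi * x) = (f x * cos ((real k + 1/2) * pi * x) + f x * cos ((real m + 1/2) * pi * x)) / 2"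
        by (simp add: mult.assoc distrib_left)
    qed
    also have "\<dots> = 0"
      using z[of k] z[of m]
      by (subst integral_divide_zero, subst Bochner_Integration.integral_add)
        (auto intro!: square_integrable_mult f s)
    finally show ?thesis .
  qed
  then have "L2_of (\<lambda>x. f x * cos (1/2 * pi * x)) = 0"
    by (intro cos_orthogonal_imp_0) (use sf in \<open>simp add: cos_orthogonal_def\<close>)
  then have "AE x in leb01. f x * cos (1/2 * pi * x) = 0"
    using sf by (simp add: zero_L2.abs_eq L2_of_eq_iff square_integrable_zero)
  then have "AE x in leb01. f x = 0"
    using AE_space
  proof eventually_elim
    case (elim x)
    then have "cos (1/2 * pi * x) > 0"
      by (intro cos_gt_zero_pi) (auto simp: field_simps intro: order_less_trans[of _ 0])
    with elim show ?case by auto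
  qed
  then show "g = 0"
    using f by (simp add: zero_L2.abs_eq L2_of_eq_iff square_integrable_zero)
qed

section \<open>Primitives of square integrable functions\<close>

text \<open>The integral of \<open>g\<close> over \<open>[0, x]\<close>, as an inner product with an
  indicator: linearity and continuity in \<open>g\<close> are then immediate.\<close>

definition prim :: "L2 \<Rightarrow> real \<Rightarrow> real" where
  "prim g x = inner g (L2_of (indicat_real {0..x}))"

lemma square_integrable_indicator: "square_integrable (indicat_real {0..x})"
proof -
  have "indicat_real {0..x} \<in> borel_measurable leb01"
    by (intro measurable_restrict_space1 borel_measurable_indicator) auto
  then show ?thesis
    using square_integrable_mult_bounded[OF continuous_imp_square_integrable[of "\<lambda>_. 1"],
        of "indicat_real {0..x}" 1] by simp
qed

lemma norm_indicator_le: "norm (L2_of (indicat_real {0..x})) \<le> 1"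
  by (rule norm_L2_of_le[OF square_integrable_indicator]) (auto simp: indicator_def)

lemma abs_prim_le: "\<bar>prim g x\<bar> \<le> norm g"
proof -
  have "\<bar>prim g x\<bar> \<le> norm g * norm (L2_of (indicat_real {0..x}))"
    unfolding prim_def by (rule Cauchy_Schwarz_ineq2)
  also have "\<dots> \<le> norm g"
    using norm_indicator_le[of x] by (simp add: mult_left_le)
  finally show ?thesis .
qed

lemma prim_zero: "prim g 0 = 0"
proof -
  have "L2_of (indicat_real {0..0}) = L2_of (\<lambda>x. 0)"
    by (rule L2_of_cong[OF _ square_integrable_indicator]) (auto simp: indicator_def)
  then show ?thesis
    by (simp add: prim_def flip: zero_L2.abs_eq)
qed

lemma prim_linear:
  "prim (g + h) x = prim g x + prim h x" "prim (g - h) x = prim g x - prim h x"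
  "prim (c *\<^sub>R g) x = c * prim g x" "prim 0 x = 0"
  by (simp_all add: prim_def inner_add_left inner_diff_left)

text \<open>Indicators of intervals depend on the end point in a Hoelder continuous way, which makes
  every primitive continuous.\<close>

lemma norm_indicator_diff:
  assumes "0 \<le> x" "x \<le> y" "y \<le> 1"
  shows "(norm (L2_of (indicat_real {0..y}) - L2_of (indicat_real {0..x})))\<^sup>2 \<le> y - x"
proof -
  have "(norm (L2_of (indicat_real {0..y}) - L2_of (indicat_real {0..x})))\<^sup>2
      = (LINT t|leb01. (indicat_real {0..y} t - indicat_real {0..x} t)\<^sup>2)"
    by (simp add: diff_L2_of square_integrable_indicator norm_L2_of_sq square_integrable_diff)
  also have "\<dots> = (LINT t|leb01. indicat_real {x<..y} t)"
    by (intro Bochner_Integration.integral_cong refl) (use assms in \<open>auto simp: indicator_def\<close>)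
  also have "\<dots> = measure leb01 ({x<..y} \<inter> {0<..<1})"
    by simp
  also have "\<dots> = measure lebesgue ({x<..y} \<inter> {0<..<1})"
    by (rule measure_restrict_space) auto
  also have "\<dots> \<le> measure lebesgue {x..y}"
    by (rule measure_mono_fmeasurable) auto
  finally show ?thesis using assms by simp
qed

lemma continuous_on_prim: "continuous_on {0..1} (prim g)"
proof -
  have "continuous_on {0..1} (\<lambda>x. L2_of (indicat_real {0..x}))"
    unfolding continuous_on_iff
  proof (intro ballI allI impI)
    fix x e :: real assume x: "x \<in> {0..1}" and e: "0 < e"
    show "\<exists>d>0. \<forall>x'\<in>{0..1}. dist x' x < d \<longrightarrow>
        dist (L2_of (indicat_real {0..x'})) (L2_of (indicat_real {0..x})) < e"
    proof (intro exI[of _ "e\<^sup>2"] conjI ballI impI)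
      fix x' :: real assume x': "x' \<in> {0..1}" and d: "dist x' x < e\<^sup>2"
      have "(dist (L2_of (indicat_real {0..x'})) (L2_of (indicat_real {0..x})))\<^sup>2 \<le> dist x' x"
        using norm_indicator_diff[of x x'] norm_indicator_diff[of x' x] x x'
        by (cases "x \<le> x'") (auto simp: dist_norm norm_minus_commute)
      with d have "(dist (L2_of (indicat_real {0..x'})) (L2_of (indicat_real {0..x})))\<^sup>2 < e\<^sup>2"
        by linarith
      then show "dist (L2_of (indicat_real {0..x'})) (L2_of (indicat_real {0..x})) < e"
        by (rule power2_less_imp_less) (use e in auto)
    qed (use e in auto)
  qed
  then show ?thesis
    unfolding prim_def by (intro continuous_intros)
qed

lemma square_integrable_prim: "square_integrable (prim g)"
  by (rule continuous_imp_square_integrable[OF continuous_on_prim])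

lemma prim_L2_of:
  assumes F: "\<And>x. x \<in> {0..1} \<Longrightarrow> (F has_real_derivative f x) (at x within {0..1})"
    and f: "continuous_on {0..1} f" and x: "x \<in> {0..1}"
  shows "prim (L2_of f) x = F x - F 0"
proof -
  have "(f has_integral (F x - F 0)) {0..x}"
    using x
    by (intro fundamental_theorem_of_calculus has_vector_derivative_within_subset[OF
          F[unfolded has_real_derivative_iff_has_vector_derivative]]) auto
  then have "((\<lambda>t. if t \<in> {0..x} then f t else 0) has_integral (F x - F 0)) {0..1}"
    using x by (subst has_integral_restrict) auto
  also have "(\<lambda>t. if t \<in> {0..x} then f t else 0) = (\<lambda>t. f t * indicat_real {0..x} t)"
    by (auto simp: indicator_def)
  finally have "((\<lambda>t. f t * indicat_real {0..x} t) has_integral (F x - F 0)) {0<..<1}"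
    by (simp add: has_integral_Icc_iff_Ioo)
  moreover have "prim (L2_of f) x = (LINT t|leb01. f t * indicat_real {0..x} t)"
    unfolding prim_def
    by (rule inner_L2_of[OF continuous_imp_square_integrable[OF f] square_integrable_indicator])
  ultimately show ?thesis
    using LINT_leb01_eq_integral[OF square_integrable_mult[OF
          continuous_imp_square_integrable[OF f] square_integrable_indicator[of x]]]
    by (simp add: integral_unique)
qed

lemma bounded_linear_L2_of_prim: "bounded_linear (\<lambda>g. L2_of (prim g))"
proof (rule bounded_linear_intro[where K=1])
  show "L2_of (prim (g + h)) = L2_of (prim g) + L2_of (prim h)" for g h
    by (simp add: square_integrable_prim prim_linear(1)[abs_def] flip: L2_of_add)
  show "L2_of (prim (c *\<^sub>R g)) = c *\<^sub>R L2_of (prim g)" for c g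
    by (simp add: square_integrable_prim prim_linear(3)[abs_def] flip: L2_of_scale)
  show "norm (L2_of (prim g)) \<le> norm g * 1" for g
    by (rule norm_L2_of_le) (simp_all add: square_integrable_prim abs_prim_le)
qed

lemma continuous_on_has_real_derivative:
  assumes "\<And>x. x \<in> S \<Longrightarrow> (p has_real_derivative p' x) (at x within S)"
  shows "continuous_on S p"
  using assms by (auto simp: continuous_on_eq_continuous_within intro: DERIV_continuous)

lemma LINT_by_parts:
  assumes p: "\<And>x. x \<in> {0..1} \<Longrightarrow> (p has_real_derivative p' x) (at x within {0..1})"
    and q: "\<And>x. x \<in> {0..1} \<Longrightarrow> (q has_real_derivative q' x) (at x within {0..1})"
    and pc: "continuous_on {0..1} p'" and qc: "continuous_on {0..1} q'"
  shows "(LINT x|leb01. p x * q' x) = p 1 * q 1 - p 0 * q 0 - (LINT x|leb01. p' x * q x)"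
proof -
  note c = continuous_on_has_real_derivative[OF p] continuous_on_has_real_derivative[OF q] pc qc
  have "(LINT x|leb01. p x * q' x + p' x * q x) = p 1 * q 1 - p 0 * q 0"
    by (rule LINT_leb01_FTC[where F="\<lambda>x. p x * q x"])
      (auto intro!: derivative_eq_intros continuous_intros p q c)
  also have "(LINT x|leb01. p x * q' x + p' x * q x) = (LINT x|leb01. p x * q' x) + (LINT x|leb01. p' x * q x)"
    by (intro Bochner_Integration.integral_add integrable_leb01_continuous continuous_intros c)
  finally show ?thesis by simp
qed

text \<open>For fixed \<open>p\<close> the difference of both sides is a continuous linear
  functional of \<open>g\<close>, so it suffices to take \<open>g\<close> a cosine, where the
  classical formula applies.\<close>

lemma prim_by_parts:
  assumes p: "\<And>x. x \<in> {0..1} \<Longrightarrow> (p has_real_derivative p' x) (at x within {0..1})"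
    and pc: "continuous_on {0..1} p'"
  shows "inner (L2_of (prim g)) (L2_of p') = prim g 1 * p 1 - inner g (L2_of p)"
proof -
  note c = continuous_on_has_real_derivative[OF p]
  define L where "L g = inner (L2_of (prim g)) (L2_of p') + inner g (L2_of p) - prim g 1 * p 1" for g
  have "bounded_linear L"
    unfolding L_def prim_def[of _ 1]
    by (intro bounded_linear_add bounded_linear_sub bounded_linear_compose[OF bounded_linear_inner_left]
        bounded_linear_L2_of_prim bounded_linear_ident bounded_linear_mult_const bounded_linear_inner_left)
  moreover have "L (cos_mode m) = 0" for m
  proof -
    define f where "f x = mu m * cos (real m * pi * x)" for x
    define F where "F x = (if m = 0 then x else mu m * sin (real m * pi * x) / (real m * pi))" for x
    have F: "(F has_real_derivative f x) (at x within {0..1})" for x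
      unfolding F_def f_def by (cases "m = 0") (auto intro!: derivative_eq_intros simp: mu_def)
    have fc: "continuous_on {0..1} f" unfolding f_def by (intro continuous_intros)
    have m: "cos_mode m = L2_of f" by (simp add: cos_mode_def f_def[abs_def])
    have F0: "F 0 = 0" by (simp add: F_def)
    have P: "prim (L2_of f) x = F x" if "x \<in> {0..1}" for x
      using prim_L2_of[OF F fc that] F0 by simp
    have "L2_of (prim (L2_of f)) = L2_of F"
      by (rule L2_of_cong[OF _ square_integrable_prim]) (simp add: P)
    then have "L (cos_mode m) = (LINT x|leb01. F x * p' x) + (LINT x|leb01. f x * p x) - F 1 * p 1"
      using c fc pc continuous_on_has_real_derivative[OF F]
      by (simp add: L_def m P inner_L2_of continuous_imp_square_integrable)
    also have "\<dots> = 0"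
      using LINT_by_parts[OF F p fc pc] F0 by simp
    finally show ?thesis .
  qed
  ultimately have "L g = 0"
    by (rule bounded_linear_eq_0_if_total[OF orthonormal_cos_mode total_cos_mode])
  then show ?thesis by (simp add: L_def)
qed

section \<open>Weak derivatives in one dimension\<close>

lemma has_weak_deriv_const_prim: "has_weak_deriv (L2_of (\<lambda>x. c + prim g x)) g"
  unfolding has_weak_deriv_def
proof (intro allI impI)
  fix \<eta> \<eta>' assume t: "test_function \<eta> \<eta>'"
  have d: "(\<eta> has_real_derivative \<eta>' x) (at x within {0..1})" for x
    using t by (auto simp: test_function_def intro: DERIV_subset)
  have ec: "continuous_on {0..1} \<eta>'"
    using t by (auto simp: test_function_def intro: continuous_on_subset)
  obtain c' d' where cd: "0 < c'" "d' < 1" "\<And>x. x \<notin> {c'..d'} \<Longrightarrow> \<eta> x = 0"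
    using t unfolding test_function_def by blast
  have z: "\<eta> 0 = 0" "\<eta> 1 = 0" using cd by auto
  have "inner (L2_of (\<lambda>x. c)) (L2_of \<eta>') = (LINT x|leb01. c * \<eta>' x)"
    by (intro inner_L2_of continuous_imp_square_integrable ec) auto
  also have "\<dots> = c * \<eta> 1 - c * \<eta> 0"
    by (intro LINT_leb01_FTC[where F="\<lambda>x. c * \<eta> x"] continuous_intros ec DERIV_cmult d)
  finally have 1: "inner (L2_of (\<lambda>x. c)) (L2_of \<eta>') = 0" by (simp add: z)
  have "L2_of (\<lambda>x. c + prim g x) = L2_of (\<lambda>x. c) + L2_of (prim g)"
    by (intro L2_of_add continuous_imp_square_integrable continuous_on_prim) auto
  then show "inner (L2_of (\<lambda>x. c + prim g x)) (L2_of \<eta>') = - inner g (L2_of \<eta>)"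
    using 1 prim_by_parts[OF d ec, of g] z by (simp add: inner_add_left)
qed

lemma has_weak_deriv_add:
  "has_weak_deriv f g \<Longrightarrow> has_weak_deriv f' g' \<Longrightarrow> has_weak_deriv (f + f') (g + g')"
  by (auto simp: has_weak_deriv_def inner_add_left)

lemma has_weak_deriv_scale:
  "has_weak_deriv f g \<Longrightarrow> has_weak_deriv (c *\<^sub>R f) (c *\<^sub>R g)"
  by (auto simp: has_weak_deriv_def)

lemma has_weak_deriv_diff:
  "has_weak_deriv f g \<Longrightarrow> has_weak_deriv f' g' \<Longrightarrow> has_weak_deriv (f - f') (g - g')"
  by (auto simp: has_weak_deriv_def inner_diff_left)

text \<open>The primitive is constant to the left and to the right of the support, and the two
  constants agree because the mean vanishes.\<close>

lemma test_function_primitive: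
  assumes r: "continuous_on UNIV \<rho>" and cd: "0 < c" "d < 1" "\<And>x. x \<notin> {c..d} \<Longrightarrow> \<rho> x = 0"
    and z: "(LINT x|leb01. \<rho> x) = 0"
  shows "\<exists>\<eta>. test_function \<eta> \<rho>"
proof -
  obtain F where "\<forall>x. -\<infinity> < ereal x \<longrightarrow> ereal x < \<infinity> \<longrightarrow> (F has_vector_derivative \<rho> x) (at x)"
    using einterval_antiderivative[of "-\<infinity>" \<infinity> \<rho>] r by (auto simp: continuous_on_eq_continuous_at)
  then have F: "(F has_real_derivative \<rho> x) (at x)" for x
    by (simp add: has_real_derivative_iff_has_vector_derivative)
  have "\<exists>k. \<forall>x\<in>{..<c}. F x = k"
    using F cd(3) by (intro has_field_derivative_zero_constant)
      (auto, metis atLeastAtMost_iff has_field_derivative_at_within not_le)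
  then obtain k1 where k1: "\<And>x. x < c \<Longrightarrow> F x = k1" by auto
  have "\<exists>k. \<forall>x\<in>{d<..}. F x = k"
    using F cd(3) by (intro has_field_derivative_zero_constant)
      (auto, metis atLeastAtMost_iff has_field_derivative_at_within not_le)
  then obtain k2 where k2: "\<And>x. d < x \<Longrightarrow> F x = k2" by auto
  have "F 1 - F 0 = 0"
    using LINT_leb01_FTC[OF has_field_derivative_at_within[OF F] continuous_on_subset[OF r]] z by simp
  then have "k1 = k2" using k1[of 0] k2[of 1] cd by simp
  then have "test_function (\<lambda>x. F x - k1) \<rho>"
    unfolding test_function_def
    using r cd(1,2) k1 k2
    by (intro conjI exI[of _ c] exI[of _ d] allI)
      (auto intro!: derivative_eq_intros F simp: not_le)
  then show ?thesis by blast
qed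

text \<open>Piecewise linear, supported in \<open>[1/(k+1), 1 - 1/(k+1)]\<close>, and increasing to
  one inside the interval.\<close>

definition cutoff :: "nat \<Rightarrow> real \<Rightarrow> real" where
  "cutoff k x = min 1 (max 0 (real (Suc k) * min x (1 - x) - 1))"

lemma cutoff_continuous: "continuous_on S (cutoff k)"
  unfolding cutoff_def by (intro continuous_intros)

lemma cutoff_support:
  assumes "x \<notin> {1 / real (Suc K)..1 - 1 / real (Suc K)}" "k \<le> K"
  shows "cutoff k x = 0"
proof -
  have "min x (1 - x) \<le> 1 / real (Suc K)"
    using assms(1) by auto
  then have "real (Suc K) * min x (1 - x) \<le> 1"
    by (simp add: field_simps)
  moreover have "real (Suc k) * min x (1 - x) \<le> 1"
  proof (cases "min x (1 - x) \<ge> 0")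
    case True
    then have "real (Suc k) * min x (1 - x) \<le> real (Suc K) * min x (1 - x)"
      using assms(2) by (intro mult_right_mono) auto
    with calculation show ?thesis by linarith
  next
    case False
    then have "real (Suc k) * min x (1 - x) \<le> 0"
      by (intro mult_nonneg_nonpos) auto
    then show ?thesis by linarith
  qed
  ultimately show ?thesis by (simp add: cutoff_def)
qed

lemma cutoff_tendsto:
  assumes "x \<in> {0<..<1}" shows "(\<lambda>k. cutoff k x) \<longlonglongrightarrow> 1"
proof (rule tendsto_eventually)
  have m: "min x (1 - x) > 0" using assms by auto
  obtain K where K: "2 / min x (1 - x) < real K" using reals_Archimedean2 by blast
  show "\<forall>\<^sub>F k in sequentially. cutoff k x = 1"
    using eventually_ge_at_top[of K]
  proof eventually_elim
    case (elim k)
    then have "2 / min x (1 - x) < real (Suc k)" using K by linarith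
    then have "2 \<le> real (Suc k) * min x (1 - x)" using m by (simp add: field_simps)
    then show ?case by (simp add: cutoff_def)
  qed
qed

lemma LINT_cutoff_tendsto:
  assumes g: "square_integrable g" and h: "continuous_on UNIV h"
  shows "(\<lambda>k. LINT x|leb01. g x * (h x * cutoff k x)) \<longlonglongrightarrow> (LINT x|leb01. g x * h x)"
proof (rule integral_dominated_convergence[where w="\<lambda>x. \<bar>g x * h x\<bar>"])
  have hm: "h \<in> borel_measurable leb01" and cm: "cutoff k \<in> borel_measurable leb01" for k
    by (auto intro!: borel_measurable_leb01_continuous continuous_on_subset[OF h] cutoff_continuous)
  have gm: "g \<in> borel_measurable leb01" using g by (simp add: square_integrable_def)
  show "(\<lambda>x. g x * h x) \<in> borel_measurable leb01" using hm gm by measurable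
  show "(\<lambda>x. g x * (h x * cutoff k x)) \<in> borel_measurable leb01" for k
    using hm gm cm[of k] by measurable
  show "integrable leb01 (\<lambda>x. \<bar>g x * h x\<bar>)"
    by (intro integrable_abs square_integrable_mult g continuous_imp_square_integrable
        continuous_on_subset[OF h]) auto
  show "AE x in leb01. (\<lambda>k. g x * (h x * cutoff k x)) \<longlonglongrightarrow> g x * h x"
  proof (rule AE_I2)
    fix x assume "x \<in> space leb01"
    then have "(\<lambda>k. cutoff k x) \<longlonglongrightarrow> 1" by (intro cutoff_tendsto) auto
    then have "(\<lambda>k. g x * (h x * cutoff k x)) \<longlonglongrightarrow> g x * (h x * 1)" by (intro tendsto_intros)
    then show "(\<lambda>k. g x * (h x * cutoff k x)) \<longlonglongrightarrow> g x * h x" by simp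
  qed
  show "AE x in leb01. norm (g x * (h x * cutoff k x)) \<le> \<bar>g x * h x\<bar>" for k
    by (rule AE_I2) (auto simp: cutoff_def abs_mult mult.assoc[symmetric] intro!: mult_left_le)
qed

text \<open>The lemma of du Bois-Reymond. Subtracting from a compactly supported function a multiple
  of a fixed bump \<open>\<rho>0\<close> of integral one leaves the derivative of a test function.
  Hence \<open>f - c\<close>, with \<open>c\<close> the pairing of \<open>f\<close> and
  \<open>\<rho>0\<close>, is orthogonal to all such functions, and by removing the cutoff to all
  continuous functions.\<close>

lemma const_if_has_weak_deriv_0:
  assumes f: "has_weak_deriv f 0"
  shows "\<exists>c. f = L2_of (\<lambda>_. c)"
proof -
  define F where "F = L2_rep f"
  have sF: "square_integrable F" and fF: "f = L2_of F"
    by (auto simp: F_def L2_rep_square_integrable L2_of_L2_rep)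
  have s1: "square_integrable (\<lambda>x. 1)" by (intro continuous_imp_square_integrable) auto
  have one: "(LINT x|leb01. (1::real)) = 1" by (simp add: measure_restrict_space)
  have "(\<lambda>k. LINT x|leb01. 1 * (1 * cutoff k x)) \<longlonglongrightarrow> (LINT x|leb01. 1 * 1)"
    by (rule LINT_cutoff_tendsto[OF s1]) auto
  then have "\<forall>\<^sub>F k in sequentially. (LINT x|leb01. cutoff k x) \<noteq> 0"
    using tendsto_imp_eventually_ne[of "\<lambda>k. LINT x|leb01. cutoff k x" 1 sequentially 0] one by simp
  \<comment> \<open>the integrals of the cutoffs tend to one, so one of them can be normalized\<close>
  then obtain k0 where k0: "(LINT x|leb01. cutoff k0 x) \<noteq> 0"
    using eventually_happens'[OF sequentially_bot] by blast
  define \<rho>0 where "\<rho>0 x = cutoff k0 x / (LINT x|leb01. cutoff k0 x)" for x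
  have \<rho>0c: "continuous_on S \<rho>0" for S
    unfolding \<rho>0_def using k0 by (intro continuous_intros cutoff_continuous) auto
  have i\<rho>0: "(LINT x|leb01. \<rho>0 x) = 1"
    using k0 by (simp add: \<rho>0_def)
  have s\<rho>0: "square_integrable \<rho>0" by (intro continuous_imp_square_integrable \<rho>0c)
  define c where "c = (LINT x|leb01. F x * \<rho>0 x)"
  have lim: "(LINT x|leb01. F x * h x) = c * (LINT x|leb01. h x)" if h: "continuous_on UNIV h" for h
  proof -
    have step: "(LINT x|leb01. F x * (h x * cutoff k x)) = c * (LINT x|leb01. h x * cutoff k x)" for k
    proof -
      let ?I = "LINT x|leb01. h x * cutoff k x"
      define \<rho> where "\<rho> x = h x * cutoff k x - ?I * \<rho>0 x" for x
      have hkc: "continuous_on UNIV (\<lambda>x. h x * cutoff k x)"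
        by (intro continuous_intros h cutoff_continuous)
      have hki: "integrable leb01 (\<lambda>x. h x * cutoff k x)" "square_integrable (\<lambda>x. h x * cutoff k x)"
        by (auto intro!: integrable_leb01_continuous continuous_imp_square_integrable continuous_on_subset[OF hkc])
      have \<rho>c: "continuous_on UNIV \<rho>"
        unfolding \<rho>_def by (intro continuous_intros hkc \<rho>0c)
      have "(LINT x|leb01. \<rho> x) = ?I - ?I * (LINT x|leb01. \<rho>0 x)"
        unfolding \<rho>_def
        by (subst Bochner_Integration.integral_diff)
          (simp_all add: hki integrable_mult_right integrable_leb01_continuous \<rho>0c)
      then have "(LINT x|leb01. \<rho> x) = 0" by (simp only: i\<rho>0)
      moreover have "\<rho> x = 0" if "x \<notin> {1 / real (Suc (max k k0))..1 - 1 / real (Suc (max k k0))}" for x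
        using cutoff_support[OF that, of k] cutoff_support[OF that, of k0] by (simp add: \<rho>_def \<rho>0_def)
      ultimately obtain \<eta> where \<eta>: "test_function \<eta> \<rho>"
        using test_function_primitive[OF \<rho>c, of "1 / real (Suc (max k k0))" "1 - 1 / real (Suc (max k k0))"]
        by auto
      have "0 = inner f (L2_of \<rho>)"
        using f \<eta> unfolding has_weak_deriv_def by fastforce
      also have "\<dots> = (LINT x|leb01. F x * \<rho> x)"
        unfolding fF by (intro inner_L2_of sF continuous_imp_square_integrable continuous_on_subset[OF \<rho>c]) auto
      also have "\<dots> = (LINT x|leb01. F x * (h x * cutoff k x) - ?I * (F x * \<rho>0 x))"
        by (simp add: \<rho>_def algebra_simps)
      also have "\<dots> = (LINT x|leb01. F x * (h x * cutoff k x)) - ?I * c"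
        unfolding c_def
        by (subst Bochner_Integration.integral_diff)
          (auto intro!: integrable_mult_right square_integrable_mult sF s\<rho>0 hki)
      finally show ?thesis by (simp add: mult.commute)
    qed
    have "(\<lambda>k. LINT x|leb01. F x * (h x * cutoff k x)) \<longlonglongrightarrow> (LINT x|leb01. F x * h x)"
      by (rule LINT_cutoff_tendsto[OF sF h])
    moreover have "(\<lambda>k. c * (LINT x|leb01. 1 * (h x * cutoff k x))) \<longlonglongrightarrow> c * (LINT x|leb01. 1 * h x)"
      by (intro tendsto_intros LINT_cutoff_tendsto[OF s1 h])
    ultimately show ?thesis
      using LIMSEQ_unique by (simp add: step) blast
  qed
  have sc: "square_integrable (\<lambda>x. c)" by (intro continuous_imp_square_integrable) auto
  have "L2_of (\<lambda>x. F x - c) = 0"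
  proof (rule eq_0_if_orthogonal_continuous)
    show "square_integrable (\<lambda>x. F x - c)" by (intro square_integrable_diff sF sc)
    fix h :: "real \<Rightarrow> real" assume h: "continuous_on UNIV h"
    have sh: "square_integrable h"
      by (intro continuous_imp_square_integrable continuous_on_subset[OF h]) auto
    have "(LINT x|leb01. (F x - c) * h x) = (LINT x|leb01. F x * h x - c * h x)"
      by (simp add: algebra_simps)
    also have "\<dots> = (LINT x|leb01. F x * h x) - c * (LINT x|leb01. h x)"
      by (subst Bochner_Integration.integral_diff)
        (simp_all add: square_integrable_mult[OF sF sh] integrable_leb01_continuous[OF continuous_on_subset[OF h]])
    finally show "(LINT x|leb01. (F x - c) * h x) = 0" using lim[OF h] by simp
  qed
  then have "f = L2_of (\<lambda>_. c)"
    using diff_L2_of[OF sF sc] fF by simp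
  then show ?thesis by blast
qed

lemma has_weak_deriv_imp_prim:
  assumes "has_weak_deriv f g"
  shows "\<exists>c. f = L2_of (\<lambda>x. c + prim g x)"
proof -
  have "has_weak_deriv (f - L2_of (\<lambda>x. 0 + prim g x)) (g - g)"
    by (intro has_weak_deriv_diff has_weak_deriv_const_prim assms)
  then have "has_weak_deriv (f - L2_of (prim g)) 0" by simp
  from const_if_has_weak_deriv_0[OF this]
  obtain c where "f - L2_of (prim g) = L2_of (\<lambda>_. c)" by blast
  moreover have "L2_of (\<lambda>x. c + prim g x) = L2_of (\<lambda>x. c) + L2_of (prim g)"
    by (intro L2_of_add continuous_imp_square_integrable continuous_on_prim) auto
  ultimately have "f = L2_of (\<lambda>x. c + prim g x)" by (simp add: diff_eq_eq)
  then show ?thesis by (rule exI)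
qed

lemma continuous_L2_of_inj:
  assumes "continuous_on {0..1} f" "continuous_on {0..1} g" "L2_of f = L2_of g" "x \<in> {0..1}"
  shows "f x = g x"
proof -
  have s: "square_integrable f" "square_integrable g" "square_integrable (\<lambda>x. f x - g x)"
    by (intro continuous_imp_square_integrable continuous_on_diff assms(1,2))+
  have c: "continuous_on {0..1} (\<lambda>x. (f x - g x)\<^sup>2)"
    by (intro continuous_on_power continuous_on_diff assms(1,2))
  have "(LINT x|leb01. (f x - g x)\<^sup>2) = 0"
    using norm_L2_of_sq[OF s(3)] diff_L2_of[OF s(1,2)] assms(3) by simp
  moreover have "((\<lambda>x. (f x - g x)\<^sup>2) has_integral (integral {0..1} (\<lambda>x. (f x - g x)\<^sup>2))) {0..1}"
    by (intro integrable_integral integrable_continuous_interval c)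
  then have "((\<lambda>x. (f x - g x)\<^sup>2) has_integral (integral {0..1} (\<lambda>x. (f x - g x)\<^sup>2))) {0<..<1}"
    by (simp only: has_integral_Icc_iff_Ioo)
  then have "integral {0..1} (\<lambda>x. (f x - g x)\<^sup>2) = (LINT x|leb01. (f x - g x)\<^sup>2)"
    by (subst LINT_leb01_eq_integral[OF integrable_leb01_continuous[OF c]]) (simp add: integral_unique)
  ultimately have "((\<lambda>x. (f x - g x)\<^sup>2) has_integral 0) (cbox 0 1)"
    using \<open>((\<lambda>x. (f x - g x)\<^sup>2) has_integral _) {0..1}\<close> by simp
  then have "(f x - g x)\<^sup>2 = 0"
    by (rule has_integral_0_cbox_imp_0[rotated 2]) (use assms(4) c in auto)
  then show ?thesis by simp
qed

text \<open>If \<open>0\<close> has weak derivative \<open>d\<close>, then the primitive of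
  \<open>d\<close> is a constant that vanishes at the origin. Integration by parts then shows that
  \<open>d\<close> is orthogonal to every cosine.\<close>

lemma has_weak_deriv_unique:
  assumes "has_weak_deriv f g" "has_weak_deriv f g'"
  shows "g = g'"
proof -
  define d where "d = g - g'"
  have "has_weak_deriv 0 d"
    using has_weak_deriv_diff[OF assms] by (simp add: d_def)
  then obtain c where c: "0 = L2_of (\<lambda>x. c + prim d x)"
    using has_weak_deriv_imp_prim by blast
  have "c + prim d x = 0" if "x \<in> {0..1}" for x
    by (rule continuous_L2_of_inj[where g="\<lambda>x. 0"])
      (use c that in \<open>auto intro!: continuous_intros continuous_on_prim simp: zero_L2.abs_eq\<close>)
  note eq = this
  have "c = 0" using eq[of 0] by (simp add: prim_zero)
  then have P: "prim d x = 0" if "x \<in> {0..1}" for x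
    using eq[OF that] by simp
  have L: "L2_of (prim d) = 0"
    unfolding zero_L2.abs_eq by (rule L2_of_cong[OF _ square_integrable_prim]) (simp add: P)
  have "inner d (cos_mode m) = 0" for m
  proof -
    have "inner (L2_of (prim d)) (L2_of (\<lambda>x. mu m * (- sin (real m * pi * x) * (real m * pi))))
        = prim d 1 * (mu m * cos (real m * pi * 1)) - inner d (L2_of (\<lambda>x. mu m * cos (real m * pi * x)))"
      by (rule prim_by_parts[where p="\<lambda>x. mu m * cos (real m * pi * x)"
            and p'="\<lambda>x. mu m * (- sin (real m * pi * x) * (real m * pi))"])
        (auto intro!: derivative_eq_intros continuous_intros)
    then show ?thesis by (simp add: L P cos_mode_def)
  qed
  then have "d = 0" using total_cos_mode unfolding total_system_def by blast
  then show ?thesis by (simp add: d_def)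
qed

lemma H1I:
  assumes "has_weak_deriv f g" shows "f \<in> H1" "weak_deriv f = g"
  using assms has_weak_deriv_unique unfolding H1_def weak_deriv_def by (auto intro!: the_equality)

lemma H1D: assumes "f \<in> H1" shows "has_weak_deriv f (weak_deriv f)"
  using assms H1I(2) unfolding H1_def by auto

lemma point_value_L2_of:
  assumes "continuous_on {0..1} h" "x \<in> {0..1}"
  shows "point_value (L2_of h) x = h x"
proof -
  have "continuous_on {0..1} (SOME h'. continuous_on {0..1} h' \<and> L2_of h' = L2_of h) \<and>
     L2_of (SOME h'. continuous_on {0..1} h' \<and> L2_of h' = L2_of h) = L2_of h"
    by (rule someI[of _ h]) (use assms in auto)
  then show ?thesis
    unfolding point_value_def using continuous_L2_of_inj assms by blast
qed

text \<open>The right-hand side is the continuous representative, from which all point values are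
  read off.\<close>

lemma H1_eq_prim:
  assumes "f \<in> H1"
  shows "f = L2_of (\<lambda>x. point_value f 0 + prim (weak_deriv f) x)"
proof -
  obtain c where c: "f = L2_of (\<lambda>x. c + prim (weak_deriv f) x)"
    using has_weak_deriv_imp_prim[OF H1D[OF assms]] by blast
  have "point_value f 0 = point_value (L2_of (\<lambda>x. c + prim (weak_deriv f) x)) 0"
    by (rule arg_cong[OF c])
  also have "\<dots> = c"
    by (subst point_value_L2_of) (auto intro!: continuous_intros continuous_on_prim simp: prim_zero)
  finally show ?thesis by (simp only:) (rule c)
qed

lemma point_value_H1:
  assumes "f \<in> H1" "x \<in> {0..1}"
  shows "point_value f x = point_value f 0 + prim (weak_deriv f) x"
proof -
  have "continuous_on {0..1} (\<lambda>x. point_value f 0 + prim (weak_deriv f) x)"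
    by (intro continuous_intros continuous_on_prim)
  from point_value_L2_of[OF this assms(2)] show ?thesis
    by (simp only: H1_eq_prim[OF assms(1), symmetric])
qed

lemma H1_by_parts:
  assumes f: "f \<in> H1"
    and p: "\<And>x. x \<in> {0..1} \<Longrightarrow> (p has_real_derivative p' x) (at x within {0..1})"
    and pc: "continuous_on {0..1} p'"
  shows "inner f (L2_of p') = point_value f 1 * p 1 - point_value f 0 * p 0 - inner (weak_deriv f) (L2_of p)"
proof -
  let ?c = "point_value f 0" and ?g = "weak_deriv f"
  have "inner (L2_of (\<lambda>x. ?c)) (L2_of p') = (LINT x|leb01. ?c * p' x)"
    by (intro inner_L2_of continuous_imp_square_integrable pc) auto
  also have "\<dots> = ?c * p 1 - ?c * p 0"
    by (intro LINT_leb01_FTC[where F="\<lambda>x. ?c * p x"] continuous_intros pc DERIV_cmult p)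
  finally have 1: "inner (L2_of (\<lambda>x. ?c)) (L2_of p') = ?c * p 1 - ?c * p 0" .
  have "f = L2_of (\<lambda>x. ?c) + L2_of (prim ?g)"
    by (subst H1_eq_prim[OF f], intro L2_of_add continuous_imp_square_integrable continuous_on_prim) auto
  from arg_cong[OF this, of "\<lambda>t. inner t (L2_of p')"]
  have "inner f (L2_of p') = inner (L2_of (\<lambda>x. ?c)) (L2_of p') + inner (L2_of (prim ?g)) (L2_of p')"
    by (simp only: inner_add_left)
  then show ?thesis
    using 1 prim_by_parts[OF p pc, of ?g] point_value_H1[OF f, of 1] by (simp add: algebra_simps)
qed

lemma has_weak_deriv_L2_of:
  assumes p: "\<And>x. x \<in> {0..1} \<Longrightarrow> (p has_real_derivative p' x) (at x within {0..1})"
    and pc: "continuous_on {0..1} p'"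
  shows "has_weak_deriv (L2_of p) (L2_of p')"
proof -
  have "L2_of (\<lambda>x. p 0 + prim (L2_of p') x) = L2_of p"
  proof (rule L2_of_cong)
    show "p 0 + prim (L2_of p') x = p x" if "x \<in> {0<..<1}" for x
      using prim_L2_of[OF p pc, of x] that by simp
    show "square_integrable (\<lambda>x. p 0 + prim (L2_of p') x)"
      by (intro continuous_imp_square_integrable continuous_intros continuous_on_prim)
  qed
  then show ?thesis
    using has_weak_deriv_const_prim[of "p 0" "L2_of p'"] by simp
qed

text \<open>The trace estimate: the constant in the representation by a primitive is
  \<open>f\<close> minus that primitive, and its modulus is its \<open>L\<^sup>2\<close>
  norm.\<close>

lemma abs_point_value_0_le:
  assumes "f \<in> H1" shows "\<bar>point_value f 0\<bar> \<le> norm f + norm (weak_deriv f)"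
proof -
  let ?c = "point_value f 0" and ?g = "weak_deriv f"
  have "f = L2_of (\<lambda>x. ?c) + L2_of (prim ?g)"
    by (subst H1_eq_prim[OF assms], intro L2_of_add continuous_imp_square_integrable continuous_on_prim) auto
  then have "L2_of (\<lambda>x. ?c) = f - L2_of (prim ?g)"
    by (intro eq_diff_eq[THEN iffD2]) (rule sym)
  then have "norm (L2_of (\<lambda>x. ?c)) \<le> norm f + norm (L2_of (prim ?g))"
    using norm_triangle_ineq4[of f "L2_of (prim ?g)"] by (simp only:)
  moreover have "norm (L2_of (prim ?g)) \<le> norm ?g"
    by (rule norm_L2_of_le) (simp_all add: square_integrable_prim abs_prim_le)
  moreover have "(norm (L2_of (\<lambda>x. ?c)))\<^sup>2 = \<bar>?c\<bar>\<^sup>2"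
    by (subst norm_L2_of_sq) (auto intro!: continuous_imp_square_integrable simp: measure_restrict_space)
  then have "norm (L2_of (\<lambda>x. ?c)) = \<bar>?c\<bar>" by (metis abs_ge_zero norm_ge_zero power2_eq_imp_eq)
  ultimately show ?thesis by linarith
qed

section \<open>Sobolev regularity through Fourier coefficients\<close>

lemma inner_weak_deriv_sin:
  assumes "f \<in> H1"
  shows "inner (weak_deriv f) (L2_of (\<lambda>x. sqrt 2 * sin (w * x)))
    = point_value f 1 * (sqrt 2 * sin w) - w * inner f (L2_of (\<lambda>x. sqrt 2 * cos (w * x)))"
proof -
  have "inner f (L2_of (\<lambda>x. w * (sqrt 2 * cos (w * x))))
    = point_value f 1 * (sqrt 2 * sin (w * 1)) - point_value f 0 * (sqrt 2 * sin (w * 0))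
      - inner (weak_deriv f) (L2_of (\<lambda>x. sqrt 2 * sin (w * x)))"
    by (rule H1_by_parts[OF assms, where p="\<lambda>x. sqrt 2 * sin (w * x)" and p'="\<lambda>x. w * (sqrt 2 * cos (w * x))"])
      (auto intro!: derivative_eq_intros continuous_intros)
  moreover have "L2_of (\<lambda>x. w * (sqrt 2 * cos (w * x))) = w *\<^sub>R L2_of (\<lambda>x. sqrt 2 * cos (w * x))"
    by (intro L2_of_scale continuous_imp_square_integrable continuous_intros)
  ultimately show ?thesis by simp
qed

lemma inner_weak_deriv_sin_mode:
  assumes "f \<in> H1"
  shows "inner (weak_deriv f) (sin_mode m) = - (real (Suc m) * pi * inner f (cos_mode (Suc m)))"
proof -
  have "sin (real (Suc m) * pi) = 0" by (rule sin_npi)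
  moreover have "cos_mode (Suc m) = L2_of (\<lambda>x. sqrt 2 * cos (real (Suc m) * pi * x))"
    by (simp add: cos_mode_def mu_def)
  ultimately show ?thesis
    using inner_weak_deriv_sin[OF assms, of "real (Suc m) * pi"]
    unfolding sin_mode_def by (simp del: of_nat_Suc)
qed

lemma cos_half_integer_pi: "cos ((real n + 1/2) * pi) = 0"
proof -
  have "cos ((real n + 1/2) * pi) = cos (real n * pi + pi / 2)" by (simp add: algebra_simps)
  also have "\<dots> = 0" by (simp only: cos_add) (simp add: sin_npi)
  finally show ?thesis .
qed

lemma inner_weak_deriv_hsin_mode:
  assumes "f \<in> H1" "point_value f 1 = 0"
  shows "inner (weak_deriv f) (hsin_mode n) = - (omega n * inner f (hcos_mode n))"
  using inner_weak_deriv_sin[OF assms(1), of "(real n + 1/2) * pi"] assms(2)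
  unfolding hsin_mode_def hcos_mode_def omega_def by simp

text \<open>Bessel's inequality for the weak derivative in the sine system. The boundary term in the
  integration by parts vanishes because the sines do so at both ends.\<close>

lemma H1_cos_coeffs:
  assumes "f \<in> H1"
  shows "summable (\<lambda>m. (real m * pi * inner f (cos_mode m))\<^sup>2)"
    and "(\<Sum>m. (real m * pi * inner f (cos_mode m))\<^sup>2) \<le> (norm (weak_deriv f))\<^sup>2"
proof -
  have eq: "(inner (weak_deriv f) (sin_mode m))\<^sup>2 = (real (Suc m) * pi * inner f (cos_mode (Suc m)))\<^sup>2" for m
    by (simp add: inner_weak_deriv_sin_mode[OF assms])
  have s: "summable (\<lambda>m. (real (Suc m) * pi * inner f (cos_mode (Suc m)))\<^sup>2)"
    using bessel_summable[OF orthonormal_sin_mode, of "weak_deriv f"] unfolding eq .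
  then show s': "summable (\<lambda>m. (real m * pi * inner f (cos_mode m))\<^sup>2)"
    by (subst (asm) summable_Suc_iff)
  show "(\<Sum>m. (real m * pi * inner f (cos_mode m))\<^sup>2) \<le> (norm (weak_deriv f))\<^sup>2"
    using bessel[OF orthonormal_sin_mode, of "weak_deriv f"] suminf_split_head[OF s'] unfolding eq by simp
qed

text \<open>Here the sines of half-integer frequency do not vanish at \<open>1\<close>, and the
  boundary term disappears through the value of \<open>f\<close>.\<close>

lemma H1_hcos_coeffs:
  assumes "f \<in> H1" "point_value f 1 = 0"
  shows "summable (\<lambda>n. (omega n * inner f (hcos_mode n))\<^sup>2)"
    and "(\<Sum>n. (omega n * inner f (hcos_mode n))\<^sup>2) \<le> (norm (weak_deriv f))\<^sup>2"
proof -
  have eq: "(inner (weak_deriv f) (hsin_mode m))\<^sup>2 = (omega m * inner f (hcos_mode m))\<^sup>2" for m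
    by (simp add: inner_weak_deriv_hsin_mode[OF assms])
  show "summable (\<lambda>n. (omega n * inner f (hcos_mode n))\<^sup>2)"
    using bessel_summable[OF orthonormal_hsin_mode, of "weak_deriv f"] unfolding eq .
  show "(\<Sum>n. (omega n * inner f (hcos_mode n))\<^sup>2) \<le> (norm (weak_deriv f))\<^sup>2"
    using bessel[OF orthonormal_hsin_mode, of "weak_deriv f"] unfolding eq .
qed

text \<open>Riesz and Fischer provide a function \<open>g\<close> whose sine coefficients are those
  of the would-be derivative. A primitive of \<open>g\<close>, with the constant adjusted to the
  mean of \<open>f\<close>, has the cosine coefficients of \<open>f\<close>, and completeness
  identifies the two.\<close>

lemma H1_if_cos_coeffs:
  assumes s: "summable (\<lambda>m. (real m * pi * inner f (cos_mode m))\<^sup>2)"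
  shows "f \<in> H1" and "(norm (weak_deriv f))\<^sup>2 = (\<Sum>m. (real m * pi * inner f (cos_mode m))\<^sup>2)"
proof -
  define a where "a m = - (real (Suc m) * pi * inner f (cos_mode (Suc m)))" for m
  have s': "summable (\<lambda>m. (a m)\<^sup>2)"
    using s summable_Suc_iff[of "\<lambda>m. (real m * pi * inner f (cos_mode m))\<^sup>2"] by (simp add: a_def)
  define g where "g = (\<Sum>m. a m *\<^sub>R sin_mode m)"
  have gc: "inner g (sin_mode m) = a m" for m
    unfolding g_def by (rule riesz_fischer_inner[OF orthonormal_sin_mode s'])
  define c where "c = inner (f - L2_of (prim g)) (cos_mode 0)"
  define h where "h = L2_of (\<lambda>x. c + prim g x)"
  have wd: "has_weak_deriv h g" unfolding h_def by (rule has_weak_deriv_const_prim)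
  have hs: "h = c *\<^sub>R cos_mode 0 + L2_of (prim g)"
  proof -
    have "h = L2_of (\<lambda>x. c * 1) + L2_of (prim g)"
      unfolding h_def by (subst L2_of_add) (auto intro!: continuous_imp_square_integrable continuous_on_prim)
    also have "L2_of (\<lambda>x. c * 1) = c *\<^sub>R cos_mode 0"
      unfolding cos_mode_def by (subst L2_of_scale) (auto intro!: continuous_imp_square_integrable simp: mu_def)
    finally show ?thesis .
  qed
  have "inner (f - h) (cos_mode m) = 0" for m
  proof (cases m)
    case 0
    then show ?thesis
      by (simp add: hs c_def inner_diff_left inner_add_left orthonormalD[OF orthonormal_cos_mode])
  next
    case (Suc k)
    have "a k = - (real (Suc k) * pi * inner h (cos_mode (Suc k)))"
      using inner_weak_deriv_sin_mode[OF H1I(1)[OF wd], of k] gc[of k] H1I(2)[OF wd] by simp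
    then have "inner h (cos_mode (Suc k)) = inner f (cos_mode (Suc k))"
      by (simp add: a_def)
    then show ?thesis by (simp add: Suc inner_diff_left)
  qed
  then have fh: "f = h" using total_cos_mode unfolding total_system_def by (metis right_minus_eq)
  show "f \<in> H1" using H1I(1)[OF wd] fh by simp
  have "(norm (weak_deriv f))\<^sup>2 = (\<Sum>m. (a m)\<^sup>2)"
    using H1I(2)[OF wd] fh riesz_fischer_norm[OF orthonormal_sin_mode s'] by (simp add: g_def)
  also have "\<dots> = (\<Sum>m. (real m * pi * inner f (cos_mode m))\<^sup>2)"
    using suminf_split_head[OF s] by (simp add: a_def)
  finally show "(norm (weak_deriv f))\<^sup>2 = (\<Sum>m. (real m * pi * inner f (cos_mode m))\<^sup>2)" .
qed

lemma omega_pos: "omega n > 0"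
  by (simp add: omega_def add_nonneg_pos)

text \<open>As for the integer cosines, but with the primitive normalized at \<open>1\<close>, which
  yields the boundary condition as a by-product.\<close>

lemma H1_if_hcos_coeffs:
  assumes s: "summable (\<lambda>n. (omega n * inner f (hcos_mode n))\<^sup>2)"
  shows "f \<in> H1" and "point_value f 1 = 0"
    and "(norm (weak_deriv f))\<^sup>2 = (\<Sum>n. (omega n * inner f (hcos_mode n))\<^sup>2)"
proof -
  define a where "a n = - (omega n * inner f (hcos_mode n))" for n
  have s': "summable (\<lambda>n. (a n)\<^sup>2)" using s by (simp add: a_def)
  define g where "g = (\<Sum>n. a n *\<^sub>R hsin_mode n)"
  have gc: "inner g (hsin_mode n) = a n" for n
    unfolding g_def by (rule riesz_fischer_inner[OF orthonormal_hsin_mode s'])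
  define h where "h = L2_of (\<lambda>x. - prim g 1 + prim g x)"
  have wd: "has_weak_deriv h g" unfolding h_def by (rule has_weak_deriv_const_prim)
  have h1: "point_value h 1 = 0"
    unfolding h_def by (subst point_value_L2_of) (auto intro!: continuous_intros continuous_on_prim)
  have "inner (f - h) (hcos_mode n) = 0" for n
  proof -
    have "a n = - (omega n * inner h (hcos_mode n))"
      using inner_weak_deriv_hsin_mode[OF H1I(1)[OF wd] h1, of n] gc[of n] H1I(2)[OF wd] by simp
    then have "inner h (hcos_mode n) = inner f (hcos_mode n)"
      using omega_pos[of n] by (simp add: a_def)
    then show ?thesis by (simp add: inner_diff_left)
  qed
  then have fh: "f = h" using total_hcos_mode unfolding total_system_def by (metis right_minus_eq)
  show "f \<in> H1" "point_value f 1 = 0" using H1I(1)[OF wd] fh h1 by simp_all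
  have "(norm (weak_deriv f))\<^sup>2 = (\<Sum>m. (a m)\<^sup>2)"
    using H1I(2)[OF wd] fh riesz_fischer_norm[OF orthonormal_hsin_mode s'] by (simp add: g_def)
  then show "(norm (weak_deriv f))\<^sup>2 = (\<Sum>n. (omega n * inner f (hcos_mode n))\<^sup>2)"
    by (simp add: a_def)
qed

section \<open>The adjoint modes\<close>

lemma lambda1_omega: "lambda1 a n = a - (omega n)\<^sup>2"
  by (simp add: lambda1_def omega_def power_mult_distrib)

lemma Delta_iff: "(n, m) \<in> Delta a b \<longleftrightarrow> lambda1 a n = lambda2 b m"
proof -
  have "lambda1 a n = lambda2 b m \<longleftrightarrow> b - a = ((real m)\<^sup>2 - (real n + 1/2)\<^sup>2) * pi\<^sup>2"
    by (auto simp: lambda1_def lambda2_def algebra_simps)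
  also have "\<dots> \<longleftrightarrow> 4 * (b - a) = 4 * (((real m)\<^sup>2 - (real n + 1/2)\<^sup>2) * pi\<^sup>2)"
    by (metis mult_cancel_left zero_neq_numeral)
  also have "4 * (((real m)\<^sup>2 - (real n + 1/2)\<^sup>2) * pi\<^sup>2) = (4 * (real m)\<^sup>2 - (2 * real n + 1)\<^sup>2) * pi\<^sup>2"
    by (simp add: power2_eq_square algebra_simps)
  finally show ?thesis by (simp add: Delta_def)
qed

lemma lambda2_inj: "lambda2 b m = lambda2 b k \<longleftrightarrow> m = k"
  by (simp add: lambda2_def)

lemma partner_eq: "(n, m) \<in> Delta a b \<Longrightarrow> partner a b n = m"
  unfolding partner_def by (rule the_equality) (auto simp: Delta_iff lambda2_inj)

lemma not_Delta1D: "n \<notin> Delta1 a b \<Longrightarrow> lambda1 a n \<noteq> lambda2 b m"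
  unfolding Delta1_def by (metis Delta_iff fst_conv image_eqI)

lemma lambda2_of_int: "\<exists>m. lambda2 b m = b - (of_int i * pi)\<^sup>2"
proof
  have "(real (nat \<bar>i\<bar>))\<^sup>2 = (of_int i)\<^sup>2" by simp
  then show "lambda2 b (nat \<bar>i\<bar>) = b - (of_int i * pi)\<^sup>2"
    by (simp add: lambda2_def power_mult_distrib)
qed

text \<open>Below \<open>b\<close> the square root in the definition is purely imaginary and the
  hyperbolic functions turn into trigonometric ones. A zero of \<open>sin W\<close> would make
  \<open>\<lambda>\<^sub>1\<^sub>,\<^sub>n\<close> equal to some
  \<open>\<lambda>\<^sub>2\<^sub>,\<^sub>m\<close>, which is excluded off resonance.\<close>

lemma psi1_snd_oscillating:
  assumes n: "n \<notin> Delta1 a b" and less: "lambda1 a n < b"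
  defines "W \<equiv> sqrt (b - lambda1 a n)"
  shows "sin W \<noteq> 0" and "psi1_snd a b s n x = sqrt 2 * s / (W * sin W) * cos (W * (1 - x))"
proof -
  have W: "W > 0" "W\<^sup>2 = b - lambda1 a n" using less by (simp_all add: W_def)
  show "sin W \<noteq> 0"
  proof
    assume "sin W = 0"
    then obtain i :: int where "W = of_int i * pi" by (auto simp: sin_zero_iff_int2)
    then have "lambda1 a n = b - (of_int i * pi)\<^sup>2" using W(2) by simp
    then show False using lambda2_of_int[of b i] not_Delta1D[OF n] by metis
  qed
  define r where "r = csqrt (complex_of_real (lambda1 a n - b))"
  have "sqrt \<bar>lambda1 a n - b\<bar> = W" using less by (simp add: W_def)
  then have r: "r = of_real W * \<i>"
    using less by (simp add: r_def csqrt_of_real')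
  have sh: "sinh r = \<i> * of_real (sin W)"
  proof -
    have "\<i> * r = of_real (- W)" by (simp add: r complex_eq_iff)
    then show ?thesis unfolding sinh_conv_sin by (simp only: sin_of_real) simp
  qed
  have 1: "r * sinh r = of_real (- (W * sin W))"
    unfolding sh unfolding r by (simp add: complex_eq_iff)
  have 2: "cosh (r * complex_of_real (1 - x)) = of_real (cos (W * (1 - x)))"
  proof -
    have "\<i> * (r * complex_of_real (1 - x)) = of_real (- (W * (1 - x)))"
      unfolding r by (simp add: complex_eq_iff)
    then show ?thesis unfolding cosh_conv_cos by (simp only: cos_of_real cos_minus)
  qed
  have "psi1_snd a b s n x = Re (- (complex_of_real (sqrt 2 * s) / (r * sinh r)) * cosh (r * complex_of_real (1 - x)))"
    using n by (simp add: psi1_snd_def Let_def r_def)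
  also have "\<dots> = Re (complex_of_real (- (sqrt 2 * s / (- (W * sin W))) * cos (W * (1 - x))))"
    unfolding 1 2 by (simp only: of_real_mult of_real_divide of_real_minus)
  finally show "psi1_snd a b s n x = sqrt 2 * s / (W * sin W) * cos (W * (1 - x))"
    by simp
qed

lemma sinh_cosh_complex_of_real:
  "sinh (complex_of_real x) = of_real (sinh x)" "cosh (complex_of_real x) = of_real (cosh x)"
  by (simp_all add: sinh_def cosh_def scaleR_conv_of_real flip: exp_of_real of_real_minus)

lemma psi1_snd_hyperbolic:
  assumes n: "n \<notin> Delta1 a b" and less: "b < lambda1 a n"
  defines "W \<equiv> sqrt (lambda1 a n - b)"
  shows "psi1_snd a b s n x = - (sqrt 2 * s / (W * sinh W)) * cosh (W * (1 - x))"
proof -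
  define r where "r = csqrt (complex_of_real (lambda1 a n - b))"
  have r: "r = of_real W"
    using less by (simp add: r_def csqrt_of_real' W_def)
  have 1: "r * sinh r = of_real (W * sinh W)"
    by (simp add: r sinh_cosh_complex_of_real)
  have 2: "cosh (r * complex_of_real (1 - x)) = of_real (cosh (W * (1 - x)))"
    unfolding r by (simp only: sinh_cosh_complex_of_real flip: of_real_mult)
  have "psi1_snd a b s n x = Re (- (complex_of_real (sqrt 2 * s) / (r * sinh r)) * cosh (r * complex_of_real (1 - x)))"
    using n by (simp add: psi1_snd_def Let_def r_def)
  also have "\<dots> = Re (complex_of_real (- (sqrt 2 * s / (W * sinh W)) * cosh (W * (1 - x))))"
    unfolding 1 2 by (simp only: of_real_mult of_real_divide of_real_minus)
  finally show ?thesis by simp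
qed

text \<open>The off-diagonal entry of the Jordan block, extended by zero to the indices without
  resonance, so that one formula serves all \<open>n\<close>. Off resonance the values of
  \<open>partner\<close> that accompany it are arbitrary and multiplied by zero.\<close>

definition coupling :: "real \<Rightarrow> real \<Rightarrow> real \<Rightarrow> nat \<Rightarrow> real" where
  "coupling a b s n = (if n \<in> Delta1 a b then sqrt 2 * s * mu (partner a b n) else 0)"

text \<open>All three cases of the definition solve one and the same boundary value problem, and
  only this problem is used afterwards. In the resonant cases the right-hand side contains the
  second component of \<open>\<psi>\<^sub>2\<^sub>,\<^sub>m\<close>, which produces the Jordan
  block.\<close>

lemma psi1_snd_ode:
  "\<exists>q'. (\<forall>x. (psi1_snd a b s n has_real_derivative q' x) (at x)) \<and>
    (\<forall>x. (q' has_real_derivative ((lambda1 a n - b) * psi1_snd a b s n x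
        - coupling a b s n * (mu (partner a b n) * cos (real (partner a b n) * pi * x)))) (at x)) \<and>
    q' 0 = sqrt 2 * s \<and> q' 1 = 0"
proof (cases "n \<in> Delta1 a b")
  case False
  consider "lambda1 a n < b" | "b < lambda1 a n"
    using not_Delta1D[OF False, of 0] by (auto simp: lambda2_def neq_iff)
  then show ?thesis
  proof cases
    case 1
    define W where "W = sqrt (b - lambda1 a n)"
    have W: "W > 0" "lambda1 a n - b = - W\<^sup>2" using 1 by (simp_all add: W_def)
    note f = psi1_snd_oscillating[OF False 1, folded W_def]
    define c where "c = sqrt 2 * s / (W * sin W)"
    have q: "psi1_snd a b s n = (\<lambda>x. c * cos (W * (1 - x)))"
      using f(2) by (simp add: c_def fun_eq_iff)
    have "c * W * sin W = sqrt 2 * s" using f(1) W(1) by (simp add: c_def)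
    then show ?thesis
      using False W(2)
      by (intro exI[of _ "\<lambda>x. c * W * sin (W * (1 - x))"])
        (auto simp: q coupling_def power2_eq_square intro!: derivative_eq_intros)
  next
    case 2
    define W where "W = sqrt (lambda1 a n - b)"
    have W: "W > 0" "lambda1 a n - b = W\<^sup>2" using 2 by (simp_all add: W_def)
    define c where "c = sqrt 2 * s / (W * sinh W)"
    have q: "psi1_snd a b s n = (\<lambda>x. - c * cosh (W * (1 - x)))"
      using psi1_snd_hyperbolic[OF False 2, folded W_def] by (simp add: c_def fun_eq_iff)
    have "sinh W \<noteq> 0" using W(1) by simp
    then have "c * W * sinh W = sqrt 2 * s" using W(1) by (simp add: c_def)
    then show ?thesis
      using False W(2)
      by (intro exI[of _ "\<lambda>x. c * W * sinh (W * (1 - x))"])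
        (auto simp: q coupling_def power2_eq_square intro!: derivative_eq_intros)
  qed
next
  case True
  then obtain m where m: "(n, m) \<in> Delta a b" by (auto simp: Delta1_def)
  note p = partner_eq[OF m]
  have lam: "lambda1 a n - b = - (real m * pi)\<^sup>2"
    using m by (simp add: Delta_iff lambda2_def power_mult_distrib)
  show ?thesis
  proof (cases "m = 0")
    case True
    define c where "c = - s * sqrt 2 * (1/3 + 1 / ((2 * real n + 1)\<^sup>2 * pi\<^sup>2))"
    have q: "psi1_snd a b s n = (\<lambda>x. c + sqrt 2 * s * x - sqrt 2 / 2 * s * x\<^sup>2)"
      using \<open>n \<in> Delta1 a b\<close> p True by (auto simp: psi1_snd_def c_def fun_eq_iff)
    show ?thesis
      using \<open>n \<in> Delta1 a b\<close> p True lam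
      by (intro exI[of _ "\<lambda>x. sqrt 2 * s - sqrt 2 * s * x"])
        (auto simp: q coupling_def mu_def intro!: derivative_eq_intros)
  next
    case False
    define k where "k = real m * pi"
    have k: "k > 0" using False by (simp add: k_def)
    define c where "c = - (2 * s / pi\<^sup>2) * (1 / (2 * real n + 1)\<^sup>2 + 1 / (4 * (real m)\<^sup>2)) * sqrt 2"
    define d where "d = sqrt 2 * s / k"
    have dk: "d * k = sqrt 2 * s" using k by (simp add: d_def)
    have q: "psi1_snd a b s n = (\<lambda>x. d * (1 - x) * sin (k * x) + c * cos (k * x))"
      using \<open>n \<in> Delta1 a b\<close> p False by (auto simp: psi1_snd_def c_def d_def k_def Let_def fun_eq_iff)
    have sk: "sin k = 0" unfolding k_def by (rule sin_npi)
    have cpl: "coupling a b s n * (mu (partner a b n) * cos (real (partner a b n) * pi * x)) = 2 * (d * k) * cos (k * x)" for x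
      using \<open>n \<in> Delta1 a b\<close> p False dk by (simp add: coupling_def mu_def k_def)
    show ?thesis
      unfolding cpl lam unfolding k_def[symmetric] q dk[symmetric]
      by (intro exI[of _ "\<lambda>x. - d * sin (k * x) + d * (1 - x) * (k * cos (k * x)) - c * (k * sin (k * x))"])
        (auto simp: sk power2_eq_square algebra_simps intro!: derivative_eq_intros)
  qed
qed

definition psi1_snd_dx :: "real \<Rightarrow> real \<Rightarrow> real \<Rightarrow> nat \<Rightarrow> real \<Rightarrow> real" where
  "psi1_snd_dx a b s n = deriv (psi1_snd a b s n)"

lemma psi1_snd_deriv:
  shows "(psi1_snd a b s n has_real_derivative psi1_snd_dx a b s n x) (at x)"
    and "(psi1_snd_dx a b s n has_real_derivative ((lambda1 a n - b) * psi1_snd a b s n x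
        - coupling a b s n * (mu (partner a b n) * cos (real (partner a b n) * pi * x)))) (at x)"
    and "psi1_snd_dx a b s n 0 = sqrt 2 * s" and "psi1_snd_dx a b s n 1 = 0"
proof -
  obtain q' where q': "\<And>x. (psi1_snd a b s n has_real_derivative q' x) (at x)"
    "\<And>x. (q' has_real_derivative ((lambda1 a n - b) * psi1_snd a b s n x
        - coupling a b s n * (mu (partner a b n) * cos (real (partner a b n) * pi * x)))) (at x)"
    "q' 0 = sqrt 2 * s" "q' 1 = 0"
    using psi1_snd_ode by metis
  have "psi1_snd_dx a b s n = q'"
    using DERIV_imp_deriv[OF q'(1)] by (auto simp: psi1_snd_dx_def)
  then show "(psi1_snd a b s n has_real_derivative psi1_snd_dx a b s n x) (at x)"
    and "(psi1_snd_dx a b s n has_real_derivative ((lambda1 a n - b) * psi1_snd a b s n x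
        - coupling a b s n * (mu (partner a b n) * cos (real (partner a b n) * pi * x)))) (at x)"
    and "psi1_snd_dx a b s n 0 = sqrt 2 * s" and "psi1_snd_dx a b s n 1 = 0"
    using q' by simp_all
qed

lemma continuous_on_psi1_snd: "continuous_on S (psi1_snd a b s n)"
  by (rule continuous_on_has_real_derivative[OF has_field_derivative_at_within[OF psi1_snd_deriv(1)]])

lemma continuous_on_psi1_snd_dx: "continuous_on S (psi1_snd_dx a b s n)"
  by (rule continuous_on_has_real_derivative[OF has_field_derivative_at_within[OF psi1_snd_deriv(2)]])

definition adj_snd :: "real \<Rightarrow> real \<Rightarrow> real \<Rightarrow> nat \<Rightarrow> L2" where
  "adj_snd a b s n = L2_of (psi1_snd a b s n)"

lemma psi1_eq: "psi1 a b s n = (hcos_mode n, adj_snd a b s n)"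
  by (simp add: psi1_def hcos_mode_def adj_snd_def)

lemma psi2_eq: "psi2 m = (0, cos_mode m)"
  by (simp add: psi2_def cos_mode_def)

text \<open>Two integrations by parts against a smooth function; the source of the adjoint
  operator.\<close>

lemma green:
  assumes f: "f \<in> H2"
    and q: "\<And>x. x \<in> {0..1} \<Longrightarrow> (q has_real_derivative q' x) (at x within {0..1})"
    and q': "\<And>x. x \<in> {0..1} \<Longrightarrow> (q' has_real_derivative q'' x) (at x within {0..1})"
    and c: "continuous_on {0..1} q''"
  shows "inner (weak_deriv (weak_deriv f)) (L2_of q) =
    point_value (weak_deriv f) 1 * q 1 - point_value (weak_deriv f) 0 * q 0
    - point_value f 1 * q' 1 + point_value f 0 * q' 0 + inner f (L2_of q'')"
proof -
  have "f \<in> H1" "weak_deriv f \<in> H1" using f by (auto simp: H2_def)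
  from H1_by_parts[OF this(1) q' c] H1_by_parts[OF this(2) q continuous_on_has_real_derivative[OF q']]
  show ?thesis by simp
qed

lemma green_cos_mode:
  assumes "f \<in> H2" "point_value (weak_deriv f) 0 = 0" "point_value (weak_deriv f) 1 = 0"
  shows "inner (weak_deriv (weak_deriv f)) (cos_mode m) = - (real m * pi)\<^sup>2 * inner f (cos_mode m)"
proof -
  let ?w = "real m * pi"
  have "inner (weak_deriv (weak_deriv f)) (L2_of (\<lambda>x. mu m * cos (?w * x))) =
    point_value (weak_deriv f) 1 * (mu m * cos (?w * 1)) - point_value (weak_deriv f) 0 * (mu m * cos (?w * 0))
    - point_value f 1 * (- ?w * mu m * sin (?w * 1)) + point_value f 0 * (- ?w * mu m * sin (?w * 0))
    + inner f (L2_of (\<lambda>x. - ?w\<^sup>2 * (mu m * cos (?w * x))))"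
    by (rule green[OF assms(1), where q="\<lambda>x. mu m * cos (?w * x)" and q'="\<lambda>x. - ?w * mu m * sin (?w * x)"
          and q''="\<lambda>x. - ?w\<^sup>2 * (mu m * cos (?w * x))"])
      (auto intro!: derivative_eq_intros continuous_intros simp: power2_eq_square)
  moreover have "L2_of (\<lambda>x. - ?w\<^sup>2 * (mu m * cos (?w * x))) = - ?w\<^sup>2 *\<^sub>R L2_of (\<lambda>x. mu m * cos (?w * x))"
    by (intro L2_of_scale continuous_imp_square_integrable continuous_intros)
  ultimately show ?thesis using assms(2,3) by (simp add: cos_mode_def)
qed

lemma green_hcos_mode:
  assumes "f \<in> H2" "point_value f 1 = 0"
  shows "inner (weak_deriv (weak_deriv f)) (hcos_mode n)
    = - sqrt 2 * point_value (weak_deriv f) 0 - (omega n)\<^sup>2 * inner f (hcos_mode n)"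
proof -
  let ?w = "(real n + 1/2) * pi"
  have "inner (weak_deriv (weak_deriv f)) (L2_of (\<lambda>x. sqrt 2 * cos (?w * x))) =
    point_value (weak_deriv f) 1 * (sqrt 2 * cos (?w * 1)) - point_value (weak_deriv f) 0 * (sqrt 2 * cos (?w * 0))
    - point_value f 1 * (- ?w * sqrt 2 * sin (?w * 1)) + point_value f 0 * (- ?w * sqrt 2 * sin (?w * 0))
    + inner f (L2_of (\<lambda>x. - ?w\<^sup>2 * (sqrt 2 * cos (?w * x))))"
    by (rule green[OF assms(1), where q="\<lambda>x. sqrt 2 * cos (?w * x)" and q'="\<lambda>x. - ?w * sqrt 2 * sin (?w * x)"
          and q''="\<lambda>x. - ?w\<^sup>2 * (sqrt 2 * cos (?w * x))"])
      (auto intro!: derivative_eq_intros continuous_intros simp: power2_eq_square)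
  moreover have "L2_of (\<lambda>x. - ?w\<^sup>2 * (sqrt 2 * cos (?w * x))) = - ?w\<^sup>2 *\<^sub>R L2_of (\<lambda>x. sqrt 2 * cos (?w * x))"
    by (intro L2_of_scale continuous_imp_square_integrable continuous_intros)
  moreover have "cos ?w = 0" by (rule cos_half_integer_pi)
  ultimately show ?thesis using assms(2) by (simp add: hcos_mode_def omega_def)
qed

lemma L2_of_psi1_snd_deriv2:
  "L2_of (\<lambda>x. (lambda1 a n - b) * psi1_snd a b s n x
        - coupling a b s n * (mu (partner a b n) * cos (real (partner a b n) * pi * x)))
   = (lambda1 a n - b) *\<^sub>R adj_snd a b s n - coupling a b s n *\<^sub>R cos_mode (partner a b n)"
proof -
  let ?c = "\<lambda>x. mu (partner a b n) * cos (real (partner a b n) * pi * x)"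
  have c: "continuous_on {0..1} ?c" by (intro continuous_intros)
  note s = continuous_imp_square_integrable[OF continuous_on_psi1_snd] continuous_imp_square_integrable[OF c]
  show ?thesis
    unfolding adj_snd_def cos_mode_def
    using diff_L2_of[OF square_integrable_scale[OF s(1)] square_integrable_scale[OF s(2)]]
    by (simp only: L2_of_scale[OF s(1)] L2_of_scale[OF s(2)])
qed

lemma green_adj_snd:
  assumes "f \<in> H2" "point_value (weak_deriv f) 0 = 0" "point_value (weak_deriv f) 1 = 0"
  shows "inner (weak_deriv (weak_deriv f)) (adj_snd a b s n) = sqrt 2 * s * point_value f 0
    + (lambda1 a n - b) * inner f (adj_snd a b s n) - coupling a b s n * inner f (cos_mode (partner a b n))"
proof -
  have "inner (weak_deriv (weak_deriv f)) (L2_of (psi1_snd a b s n)) =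
    point_value (weak_deriv f) 1 * psi1_snd a b s n 1 - point_value (weak_deriv f) 0 * psi1_snd a b s n 0
    - point_value f 1 * psi1_snd_dx a b s n 1 + point_value f 0 * psi1_snd_dx a b s n 0
    + inner f (L2_of (\<lambda>x. (lambda1 a n - b) * psi1_snd a b s n x
        - coupling a b s n * (mu (partner a b n) * cos (real (partner a b n) * pi * x))))"
    by (rule green[OF assms(1) has_field_derivative_at_within[OF psi1_snd_deriv(1)]
          has_field_derivative_at_within[OF psi1_snd_deriv(2)]])
      (intro continuous_intros continuous_on_psi1_snd)
  then show ?thesis
    unfolding L2_of_psi1_snd_deriv2 using assms(2,3)
    by (simp add: psi1_snd_deriv(3,4) inner_diff_right flip: adj_snd_def)
qed

lemma op_A_psi2:
  assumes "Y \<in> dom_A s"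
  shows "inner (op_A a b Y) (psi2 m) = lambda2 b m * inner Y (psi2 m)"
  using assms green_cos_mode[of "snd Y" m]
  by (auto simp: dom_A_def op_A_def psi2_eq inner_prod_def inner_add_left lambda2_def algebra_simps power_mult_distrib)

text \<open>The boundary terms \<open>-\<surd>2 f'(0)\<close> of the first component and
  \<open>\<surd>2 s g(0)\<close> of the second cancel by the coupling condition \<open>f'(0) = s
  g(0)\<close> in the domain.\<close>

lemma op_A_psi1:
  assumes "Y \<in> dom_A s"
  shows "inner (op_A a b Y) (psi1 a b s n)
    = lambda1 a n * inner Y (psi1 a b s n) - coupling a b s n * inner Y (psi2 (partner a b n))"
  using assms green_hcos_mode[of "fst Y" n] green_adj_snd[of "snd Y" a b s n]
  by (auto simp: dom_A_def op_A_def psi1_eq psi2_eq inner_prod_def inner_add_left lambda1_omega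
      algebra_simps)

section \<open>Decay of the second components of the adjoint modes\<close>

lemma omega_unbounded: "\<exists>N. \<forall>n\<ge>N. M \<le> omega n"
proof -
  obtain N where "M < real N" using reals_Archimedean2 by blast
  then have "M \<le> omega n" if "n \<ge> N" for n
  proof -
    have "(real n + 1/2) * 1 \<le> (real n + 1/2) * pi"
      using pi_gt3 by (intro mult_left_mono) auto
    then have "real n + 1/2 \<le> omega n" by (simp only: omega_def mult_1_right)
    then have "real n \<le> omega n" by linarith
    then show ?thesis using \<open>M < real N\<close> that by linarith
  qed
  then show ?thesis by blast
qed

lemma lambda1_large:
  assumes "omega n \<ge> 2" "omega n \<ge> \<bar>b - a\<bar>"
  shows "b - lambda1 a n \<ge> (omega n)\<^sup>2 / 4"
proof -
  have "(omega n)\<^sup>2 \<ge> 2 * \<bar>b - a\<bar>"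
    unfolding power2_eq_square using assms by (intro mult_mono) auto
  moreover have "(omega n)\<^sup>2 \<ge> 0" by simp
  moreover have "- \<bar>b - a\<bar> \<le> b - a" by linarith
  moreover have "b - lambda1 a n = (omega n)\<^sup>2 + (b - a)" by (simp add: lambda1_omega)
  moreover have "x / 4 \<le> x + d" if "2 * y \<le> x" "0 \<le> x" "- y \<le> d" for x y d :: real
    using that by linarith
  ultimately show ?thesis by metis
qed

text \<open>For large \<open>n\<close> the frequency \<open>W\<close> is within distance one of
  \<open>\<omega>\<^sub>n\<close>, where the sine has modulus one and the cosine vanishes. Hence
  \<open>\<bar>sin W\<bar> \<ge> cos 1 \<ge> 1/2\<close>, and the denominator \<open>W sin W\<close>
  is of the order of \<open>\<omega>\<^sub>n\<close>.\<close>

lemma psi1_snd_bound_large: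
  assumes n: "n \<notin> Delta1 a b" and w: "omega n \<ge> 2" "omega n \<ge> \<bar>b - a\<bar>"
  shows "\<bar>psi1_snd a b s n x\<bar> \<le> 8 * \<bar>s\<bar> / omega n" and "\<bar>psi1_snd_dx a b s n x\<bar> \<le> 8 * \<bar>s\<bar>"
proof -
  let ?w = "omega n"
  have mu: "b - lambda1 a n \<ge> ?w\<^sup>2 / 4" by (rule lambda1_large[OF w])
  have wp: "?w > 0" by (rule omega_pos)
  have "?w\<^sup>2 / 4 > 0" using wp by simp
  then have less: "lambda1 a n < b" using mu by linarith
  define W where "W = sqrt (b - lambda1 a n)"
  have W2: "W\<^sup>2 = b - lambda1 a n" using less by (simp add: W_def)
  have W0: "W > 0" using less by (simp add: W_def)
  have Ww: "W \<ge> ?w / 2"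
    by (rule power2_le_imp_le) (use mu W0 in \<open>simp_all add: W2 power_divide\<close>)
  note f = psi1_snd_oscillating[OF n less, folded W_def]
  \<comment> \<open>the phase shift is small because \<open>W\<^sup>2\<close> and \<open>\<omega>\<^sub>n\<^sup>2\<close> differ by the constant \<open>b - a\<close>\<close>
  define \<eta> where "\<eta> = W - ?w"
  have "\<eta> * (W + ?w) = b - a"
    using W2 by (simp add: \<eta>_def lambda1_omega algebra_simps power2_eq_square)
  then have "\<bar>\<eta>\<bar> * (W + ?w) = \<bar>b - a\<bar>" using W0 wp by (metis abs_mult abs_of_pos add_pos_pos)
  moreover have "\<bar>\<eta>\<bar> * ?w \<le> \<bar>\<eta>\<bar> * (W + ?w)" using W0 by (intro mult_left_mono) auto
  ultimately have "\<bar>\<eta>\<bar> * ?w \<le> 1 * ?w" using w(2) by linarith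
  then have e1: "\<bar>\<eta>\<bar> \<le> 1" using wp by (simp only: mult_le_cancel_right_pos)
  have "cos (pi / 3) \<le> cos \<bar>\<eta>\<bar>"
    using e1 pi_gt3 by (intro cos_monotone_0_pi_le) auto
  then have ce: "1/2 \<le> cos \<eta>" by (simp add: cos_60)
  have c0: "cos ?w = 0" unfolding omega_def by (rule cos_half_integer_pi)
  have "(sin ?w)\<^sup>2 = 1" using sin_cos_squared_add[of ?w] c0 by simp
  then have s1: "\<bar>sin ?w\<bar> = 1" by (simp add: power2_eq_1_iff) (auto)
  have "sin W = sin (?w + \<eta>)" by (simp add: \<eta>_def)
  also have "\<dots> = sin ?w * cos \<eta>" by (simp add: sin_add c0)
  finally have sW: "\<bar>sin W\<bar> \<ge> 1/2" using ce s1 by (simp add: abs_mult)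
  define c where "c = sqrt 2 * s / (W * sin W)"
  have cW: "\<bar>c * W\<bar> \<le> 4 * \<bar>s\<bar>"
  proof -
    have "\<bar>c * W\<bar> = sqrt 2 * \<bar>s\<bar> / \<bar>sin W\<bar>" using W0 by (simp add: c_def abs_mult)
    also have "\<dots> \<le> sqrt 2 * \<bar>s\<bar> / (1/2)" by (intro divide_left_mono) (use sW in auto)
    also have "\<dots> \<le> 4 * \<bar>s\<bar>" using mult_right_mono[OF less_imp_le[OF sqrt2_less_2] abs_ge_zero[of s]] by (simp add: mult.commute)
    finally show ?thesis .
  qed
  have q: "psi1_snd a b s n = (\<lambda>x. c * cos (W * (1 - x)))"
    using f(2) by (simp add: c_def fun_eq_iff)
  have d: "psi1_snd_dx a b s n x = c * W * sin (W * (1 - x))"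
    by (rule DERIV_unique[OF psi1_snd_deriv(1)]) (auto simp: q intro!: derivative_eq_intros)
  have "\<bar>psi1_snd_dx a b s n x\<bar> \<le> \<bar>c * W\<bar> * 1"
    unfolding d abs_mult[of "c * W"] by (intro mult_left_mono) auto
  then show "\<bar>psi1_snd_dx a b s n x\<bar> \<le> 8 * \<bar>s\<bar>" using cW by linarith
  have "\<bar>psi1_snd a b s n x\<bar> \<le> \<bar>c\<bar> * 1"
    unfolding q abs_mult by (intro mult_left_mono) auto
  also have "\<bar>c\<bar> * ?w \<le> \<bar>c\<bar> * (2 * W)" using Ww by (intro mult_left_mono) auto
  then have "\<bar>c\<bar> * ?w \<le> 8 * \<bar>s\<bar>" using cW W0 by (simp add: abs_mult)
  then have "\<bar>c\<bar> * 1 \<le> 8 * \<bar>s\<bar> / ?w" using wp by (simp add: field_simps)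
  finally show "\<bar>psi1_snd a b s n x\<bar> \<le> 8 * \<bar>s\<bar> / omega n" .
qed

text \<open>Off resonance \<open>q = q'' / (\<lambda>\<^sub>1\<^sub>,\<^sub>n - b)\<close> for the
  second component \<open>q\<close>. One integration by parts against \<open>f\<close> then gains a
  factor of order \<open>1/\<omega>\<^sub>n\<^sup>2\<close> while \<open>q'\<close> stays
  bounded.\<close>

lemma H1_inner_adj_snd:
  assumes f: "f \<in> H1" and n: "n \<notin> Delta1 a b"
  shows "(lambda1 a n - b) * inner f (adj_snd a b s n)
    = - point_value f 0 * (sqrt 2 * s) - inner (weak_deriv f) (L2_of (psi1_snd_dx a b s n))"
proof -
  have "inner f (L2_of (\<lambda>x. (lambda1 a n - b) * psi1_snd a b s n x
        - coupling a b s n * (mu (partner a b n) * cos (real (partner a b n) * pi * x))))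
     = point_value f 1 * psi1_snd_dx a b s n 1 - point_value f 0 * psi1_snd_dx a b s n 0
      - inner (weak_deriv f) (L2_of (psi1_snd_dx a b s n))"
    by (rule H1_by_parts[OF f has_field_derivative_at_within[OF psi1_snd_deriv(2)]])
      (intro continuous_intros continuous_on_psi1_snd)
  then show ?thesis
    unfolding L2_of_psi1_snd_deriv2 using n by (simp add: coupling_def psi1_snd_deriv(3,4))
qed

text \<open>Large indices are covered by the explicit bounds, and the finitely many remaining ones
  by enlarging the constant.\<close>

lemma adj_snd_bounds:
  assumes fin: "\<forall>n\<in>Delta1 a b. n \<le> N0"
  shows "\<exists>C\<ge>0. (\<forall>n. norm (adj_snd a b s n) \<le> C / omega n) \<and>
    (\<forall>n. \<forall>f\<in>H1. \<bar>inner f (adj_snd a b s n)\<bar> \<le> C * (norm f + norm (weak_deriv f)) / (omega n)\<^sup>2)"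
proof -
  obtain N1 where N1: "\<And>n. n \<ge> N1 \<Longrightarrow> max 2 \<bar>b - a\<bar> \<le> omega n" using omega_unbounded by blast
  define N where "N = max (Suc N0) N1"
  have big: "n \<notin> Delta1 a b" "omega n \<ge> 2" "omega n \<ge> \<bar>b - a\<bar>" if "n \<ge> N" for n
    using that fin N1[of n] by (auto simp: N_def)
  define C where "C = 64 * \<bar>s\<bar> + (\<Sum>n<N. norm (adj_snd a b s n) * omega n + norm (adj_snd a b s n) * (omega n)\<^sup>2)"
  have pos: "0 \<le> norm (adj_snd a b s n) * omega n + norm (adj_snd a b s n) * (omega n)\<^sup>2" for n
    using omega_pos[of n] by (intro add_nonneg_nonneg mult_nonneg_nonneg) auto
  have C0: "C \<ge> 64 * \<bar>s\<bar>" using sum_nonneg[OF pos] by (simp add: C_def)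
  have Cs: "norm (adj_snd a b s n) * omega n \<le> C \<and> norm (adj_snd a b s n) * (omega n)\<^sup>2 \<le> C" if "n < N" for n
  proof -
    have "norm (adj_snd a b s n) * omega n + norm (adj_snd a b s n) * (omega n)\<^sup>2
      \<le> (\<Sum>n<N. norm (adj_snd a b s n) * omega n + norm (adj_snd a b s n) * (omega n)\<^sup>2)"
      by (rule member_le_sum[where f="\<lambda>n. norm (adj_snd a b s n) * omega n + norm (adj_snd a b s n) * (omega n)\<^sup>2"])
        (use that pos in auto)
    moreover have "norm (adj_snd a b s n) * omega n \<ge> 0" "norm (adj_snd a b s n) * (omega n)\<^sup>2 \<ge> 0"
      using omega_pos[of n] by auto
    ultimately show ?thesis unfolding C_def by (smt (verit) abs_ge_zero)
  qed
  have nrm: "norm (adj_snd a b s n) \<le> C / omega n" for n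
  proof (cases "n < N")
    case True
    then show ?thesis using Cs omega_pos[of n] by (simp add: pos_le_divide_eq)
  next
    case False
    then have b: "n \<notin> Delta1 a b" "omega n \<ge> 2" "omega n \<ge> \<bar>b - a\<bar>" using big by auto
    have "norm (adj_snd a b s n) \<le> 8 * \<bar>s\<bar> / omega n"
      unfolding adj_snd_def using psi1_snd_bound_large(1)[OF b] omega_pos[of n]
      by (intro norm_L2_of_le continuous_imp_square_integrable continuous_on_psi1_snd) auto
    also have "\<dots> \<le> C / omega n"
      using C0 omega_pos[of n] by (intro divide_right_mono) auto
    finally show ?thesis .
  qed
  have h1: "\<bar>inner f (adj_snd a b s n)\<bar> \<le> C * (norm f + norm (weak_deriv f)) / (omega n)\<^sup>2" if f: "f \<in> H1" for f n
  proof (cases "n < N")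
    case True
    have "\<bar>inner f (adj_snd a b s n)\<bar> * (omega n)\<^sup>2 \<le> norm f * norm (adj_snd a b s n) * (omega n)\<^sup>2"
      by (intro mult_right_mono Cauchy_Schwarz_ineq2) auto
    also have "\<dots> = norm f * (norm (adj_snd a b s n) * (omega n)\<^sup>2)" by simp
    also have "\<dots> \<le> (norm f + norm (weak_deriv f)) * C"
      using Cs[OF True] by (intro mult_mono) auto
    finally show ?thesis using omega_pos[of n] by (simp add: pos_le_divide_eq mult.commute)
  next
    case False
    then have b: "n \<notin> Delta1 a b" "omega n \<ge> 2" "omega n \<ge> \<bar>b - a\<bar>" using big by auto
    let ?I = "inner f (adj_snd a b s n)"
    have nd: "norm (L2_of (psi1_snd_dx a b s n)) \<le> 8 * \<bar>s\<bar>"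
      using psi1_snd_bound_large(2)[OF b]
      by (intro norm_L2_of_le continuous_imp_square_integrable continuous_on_psi1_snd_dx) auto
    have "(omega n)\<^sup>2 / 4 * \<bar>?I\<bar> \<le> \<bar>lambda1 a n - b\<bar> * \<bar>?I\<bar>"
    proof (rule mult_right_mono)
      show "(omega n)\<^sup>2 / 4 \<le> \<bar>lambda1 a n - b\<bar>"
        using lambda1_large[OF b(2,3)] abs_ge_minus_self[of "lambda1 a n - b"] by linarith
    qed simp
    also have "\<dots> = \<bar>point_value f 0 * (sqrt 2 * s) + inner (weak_deriv f) (L2_of (psi1_snd_dx a b s n))\<bar>"
      using H1_inner_adj_snd[OF f b(1), of s] unfolding abs_mult[symmetric] by linarith
    also have "\<dots> \<le> \<bar>point_value f 0\<bar> * (sqrt 2 * \<bar>s\<bar>) + norm (weak_deriv f) * norm (L2_of (psi1_snd_dx a b s n))"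
      using abs_triangle_ineq[of "point_value f 0 * (sqrt 2 * s)" "inner (weak_deriv f) (L2_of (psi1_snd_dx a b s n))"]
        Cauchy_Schwarz_ineq2[of "weak_deriv f" "L2_of (psi1_snd_dx a b s n)"]
      by (simp add: abs_mult)
    also have "\<dots> \<le> (norm f + norm (weak_deriv f)) * (2 * \<bar>s\<bar>) + norm (weak_deriv f) * (8 * \<bar>s\<bar>)"
      using abs_point_value_0_le[OF f] sqrt2_less_2 nd
      by (intro add_mono mult_mono mult_right_mono mult_left_mono) auto
    also have "\<dots> \<le> (norm f + norm (weak_deriv f)) * (16 * \<bar>s\<bar>)"
      using mult_nonneg_nonneg[of "norm f" "\<bar>s\<bar>"] mult_nonneg_nonneg[of "norm (weak_deriv f)" "\<bar>s\<bar>"]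
      by (simp add: algebra_simps)
    also have "\<dots> \<le> (norm f + norm (weak_deriv f)) * (C / 4)"
      using C0 by (intro mult_left_mono) auto
    finally have "\<bar>?I\<bar> * (omega n)\<^sup>2 \<le> C * (norm f + norm (weak_deriv f))"
      by (simp add: mult.commute)
    then show ?thesis using omega_pos[of n] by (simp add: pos_le_divide_eq)
  qed
  have "C \<ge> 0" using C0 by linarith
  with nrm h1 show ?thesis by blast
qed

section \<open>Exponential decay for linear differential equations\<close>

text \<open>After multiplication by the integrating factor \<open>exp (-l t)\<close> the derivative
  is bounded by the derivative of \<open>C / \<kappa> exp (\<kappa> t)\<close> with \<open>\<kappa>
  = - Re l - r > 0\<close>. A mean value inequality replaces the variation of constants formula, so
  the forcing \<open>f\<close> may be any function that satisfies the bound.\<close>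

lemma scalar_ode_decay:
  fixes x f :: "real \<Rightarrow> complex"
  assumes x: "\<And>t. t \<ge> 0 \<Longrightarrow> (x has_vector_derivative (l * x t + f t)) (at t within {0..})"
    and f: "\<And>t. t \<ge> 0 \<Longrightarrow> norm (f t) \<le> C * exp (- r * t)"
    and l: "Re l \<le> - \<rho>" "r < \<rho>" and t: "t \<ge> 0"
  shows "norm (x t) \<le> exp (- r * t) * (norm (x 0) + C / (\<rho> - r))"
proof -
  have C: "C \<ge> 0" using order_trans[OF norm_ge_zero f[of 0]] by simp
  define \<kappa> where "\<kappa> = - Re l - r"
  have \<kappa>: "\<kappa> \<ge> \<rho> - r" "\<kappa> > 0" using l by (simp_all add: \<kappa>_def)
  define g where "g t = exp (- l * of_real t) * x t" for t
  define \<phi> where "\<phi> t = C / \<kappa> * exp (\<kappa> * t)" for t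
  have e: "((\<lambda>t. exp (- l * of_real t)) has_vector_derivative (- l * exp (- l * of_real t))) (at t within S)" for t S
    by (rule has_vector_derivative_real_field) (auto intro!: derivative_eq_intros)
  have g': "(g has_vector_derivative (exp (- l * of_real t) * f t)) (at t within {0..})" if "t \<ge> 0" for t
    unfolding g_def
    by (rule has_vector_derivative_eq_rhs[OF has_vector_derivative_mult[OF e x[OF that]]])
      (simp add: algebra_simps)
  have \<phi>': "(\<phi> has_vector_derivative (C * exp (\<kappa> * t))) (at t within S)" for t S
    unfolding \<phi>_def has_real_derivative_iff_has_vector_derivative[symmetric]
    using \<kappa>(2) by (auto intro!: derivative_eq_intros)
  have nexp: "norm (exp (- l * of_real t)) = exp (- Re l * t)" for t
    by (simp add: norm_exp_eq_Re)
  have "norm (g t - g 0) \<le> \<phi> t - \<phi> 0"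
  proof (cases "t = 0")
    case False
    show ?thesis
    proof (rule differentiable_bound_general[where f'="\<lambda>t. exp (- l * of_real t) * f t" and \<phi>'="\<lambda>t. C * exp (\<kappa> * t)"])
      show "0 < t" using t False by simp
      have "continuous_on {0..} g"
        using g' by (intro continuous_on_vector_derivative) auto
      then show "continuous_on {0..t} g" by (rule continuous_on_subset) auto
      show "continuous_on {0..t} \<phi>" unfolding \<phi>_def by (intro continuous_intros)
      fix y assume y: "0 < y" "y < t"
      have "at y within {0..} = at y"
        by (rule at_within_interior) (use y in \<open>simp add: interior_Ici[of "-1"]\<close>)
      then show "(g has_vector_derivative (exp (- l * of_real y) * f y)) (at y)"
        using g'[of y] y by simp
      show "(\<phi> has_vector_derivative (C * exp (\<kappa> * y))) (at y)" by (rule \<phi>')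
      have "norm (exp (- l * of_real y) * f y) \<le> exp (- Re l * y) * (C * exp (- r * y))"
        unfolding norm_mult nexp using f[of y] y by (intro mult_left_mono) auto
      also have "\<dots> = C * exp (\<kappa> * y)"
        by (simp add: \<kappa>_def algebra_simps flip: exp_add)
      finally show "norm (exp (- l * of_real y) * f y) \<le> C * exp (\<kappa> * y)" .
    qed
  qed simp
  also have "\<phi> t - \<phi> 0 \<le> \<phi> t" using C \<kappa>(2) by (simp add: \<phi>_def)
  finally have "norm (g t) \<le> norm (x 0) + \<phi> t"
    using norm_triangle_sub[of "g t" "g 0"] by (simp add: g_def)
  moreover have "norm (g t) = exp (- Re l * t) * norm (x t)"
    unfolding g_def norm_mult nexp ..
  ultimately have "exp (Re l * t) * (exp (- Re l * t) * norm (x t)) \<le> exp (Re l * t) * (norm (x 0) + \<phi> t)"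
    by (intro mult_left_mono) auto
  also have "exp (Re l * t) * (exp (- Re l * t) * norm (x t)) = norm (x t)"
    by (simp add: mult.assoc[symmetric] flip: exp_add)
  finally have "norm (x t) \<le> exp (Re l * t) * norm (x 0) + exp (Re l * t) * \<phi> t"
    by (simp add: distrib_left)
  also have "exp (Re l * t) * \<phi> t = exp (- r * t) * (C / \<kappa>)"
    by (simp add: \<phi>_def \<kappa>_def algebra_simps flip: exp_add)
  also have "exp (- r * t) * (C / \<kappa>) \<le> exp (- r * t) * (C / (\<rho> - r))"
    using C \<kappa> l by (intro mult_left_mono divide_left_mono) auto
  also have "exp (Re l * t) * norm (x 0) \<le> exp (- r * t) * norm (x 0)"
  proof (rule mult_right_mono)
    have "Re l * t \<le> - r * t" using l t by (intro mult_right_mono) auto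
    then show "exp (Re l * t) \<le> exp (- r * t)" by simp
  qed simp
  finally show ?thesis by (simp add: distrib_left)
qed

lemma scalar_ode_decay_real:
  fixes x f :: "real \<Rightarrow> real"
  assumes x: "\<And>t. t \<ge> 0 \<Longrightarrow> (x has_real_derivative (l * x t + f t)) (at t within {0..})"
    and f: "\<And>t. t \<ge> 0 \<Longrightarrow> \<bar>f t\<bar> \<le> C * exp (- r * t)"
    and l: "l \<le> - \<rho>" "r < \<rho>" and t: "t \<ge> 0"
  shows "\<bar>x t\<bar> \<le> exp (- r * t) * (\<bar>x 0\<bar> + C / (\<rho> - r))"
proof -
  have "norm (complex_of_real (x t)) \<le> exp (- r * t) * (norm (complex_of_real (x 0)) + C / (\<rho> - r))"
  proof (rule scalar_ode_decay[where x="\<lambda>t. complex_of_real (x t)" and l="of_real l" and f="\<lambda>t. of_real (f t)" and C=C and r=r and \<rho>=\<rho>])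
    show "((\<lambda>t. complex_of_real (x t)) has_vector_derivative (of_real l * of_real (x t) + of_real (f t))) (at t within {0..})"
      if "t \<ge> 0" for t
      using has_vector_derivative_of_real[OF x[OF that]] by simp
  qed (use assms in auto)
  then show ?thesis by simp
qed

text \<open>Back substitution: the last component is unforced, and each earlier one is forced by
  components whose decay is already known. As the diagonal entries lie strictly to the left of
  \<open>-r\<close>, the rate \<open>r\<close> survives every step.\<close>

lemma triangular_ode_decay:
  fixes B :: "complex mat"
  assumes B: "B \<in> carrier_mat N N" "upper_triangular B"
    and d: "\<And>i. i < N \<Longrightarrow> Re (B $$ (i, i)) < - r"
  shows "\<exists>c\<ge>0. \<forall>u. (\<forall>i<N. \<forall>t\<ge>0. ((\<lambda>t. u t i) has_vector_derivative (\<Sum>j<N. B $$ (i, j) * u t j)) (at t within {0..}))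
    \<longrightarrow> (\<forall>t\<ge>0. \<forall>i<N. norm (u t i) \<le> c * exp (- r * t) * (\<Sum>j<N. norm (u 0 j)))"
proof -
  define sol where "sol u \<longleftrightarrow> (\<forall>i<N. \<forall>t\<ge>0. ((\<lambda>t. u t i) has_vector_derivative (\<Sum>j<N. B $$ (i, j) * u t j)) (at t within {0..}))"
    for u :: "real \<Rightarrow> nat \<Rightarrow> complex"
  have "\<exists>c\<ge>0. \<forall>u. sol u \<longrightarrow> (\<forall>t\<ge>0. \<forall>i. N - k \<le> i \<longrightarrow> i < N \<longrightarrow>
      norm (u t i) \<le> c * exp (- r * t) * (\<Sum>j<N. norm (u 0 j)))" if "k \<le> N" for k
    using that
  proof (induction k)
    case 0
    show ?case by (intro exI[of _ 0]) auto
  next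
    case (Suc k)
    then obtain c where c: "c \<ge> 0" and IH: "\<And>u t i. sol u \<Longrightarrow> t \<ge> 0 \<Longrightarrow> N - k \<le> i \<Longrightarrow> i < N \<Longrightarrow>
      norm (u t i) \<le> c * exp (- r * t) * (\<Sum>j<N. norm (u 0 j))"
      by auto
    define i where "i = N - Suc k"
    have i: "i < N" "Suc i = N - k" using Suc.prems by (auto simp: i_def)
    \<comment> \<open>the total weight with which the components already estimated force the next one\<close>
    define D where "D = (\<Sum>j\<in>{i<..<N}. norm (B $$ (i, j)))"
    define \<rho> where "\<rho> = - Re (B $$ (i, i))"
    have \<rho>: "r < \<rho>" using d[OF i(1)] by (simp add: \<rho>_def)
    have D0: "D \<ge> 0" unfolding D_def by (rule sum_nonneg) simp
    define c' where "c' = 1 + D * c / (\<rho> - r)"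
    have c'0: "c' \<ge> 0" using D0 c \<rho> by (simp add: c'_def)
    have new: "norm (u t i) \<le> c' * exp (- r * t) * (\<Sum>j<N. norm (u 0 j))" if u: "sol u" and t: "t \<ge> 0" for u t
    proof -
      define S where "S = (\<Sum>j<N. norm (u 0 j))"
      have S0: "norm (u 0 i) \<le> S" unfolding S_def using i(1) by (intro member_le_sum) auto
      define f where "f t = (\<Sum>j\<in>{i<..<N}. B $$ (i, j) * u t j)" for t
      have split: "(\<Sum>j<N. B $$ (i, j) * u t j) = B $$ (i, i) * u t i + f t" for t
      proof -
        have "(\<Sum>j<N. B $$ (i, j) * u t j) = (\<Sum>j\<in>insert i {i<..<N}. B $$ (i, j) * u t j)"
        proof (rule sum.mono_neutral_right)
          show "\<forall>j\<in>{..<N} - insert i {i<..<N}. B $$ (i, j) * u t j = 0"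
          proof
            fix j assume "j \<in> {..<N} - insert i {i<..<N}"
            then have "j < i" by auto
            then have "B $$ (i, j) = 0"
              using upper_triangularD[OF B(2)] i(1) carrier_matD(1)[OF B(1)] by simp
            then show "B $$ (i, j) * u t j = 0" by simp
          qed
        qed (use i(1) in auto)
        then show ?thesis by (simp add: f_def)
      qed
      have "norm (u t i) \<le> exp (- r * t) * (norm (u 0 i) + D * (c * S) / (\<rho> - r))"
      proof (rule scalar_ode_decay[where x="\<lambda>t. u t i" and l="B $$ (i, i)" and f=f and C="D * (c * S)" and r=r and \<rho>=\<rho>])
        show "((\<lambda>t. u t i) has_vector_derivative (B $$ (i, i) * u t i + f t)) (at t within {0..})" if "t \<ge> 0" for t
        proof -
          have "((\<lambda>t. u t i) has_vector_derivative (\<Sum>j<N. B $$ (i, j) * u t j)) (at t within {0..})"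
            using u i(1) that unfolding sol_def by blast
          then show ?thesis by (simp only: split)
        qed
        show "norm (f t) \<le> D * (c * S) * exp (- r * t)" if "t \<ge> 0" for t
        proof -
          have "norm (f t) \<le> (\<Sum>j\<in>{i<..<N}. norm (B $$ (i, j)) * (c * exp (- r * t) * S))"
            unfolding f_def
          proof (rule sum_norm_le)
            fix j assume "j \<in> {i<..<N}"
            then have "norm (u t j) \<le> c * exp (- r * t) * S"
              unfolding S_def using i(2) by (intro IH u that) auto
            then show "norm (B $$ (i, j) * u t j) \<le> norm (B $$ (i, j)) * (c * exp (- r * t) * S)"
              unfolding norm_mult by (rule mult_left_mono) simp
          qed
          also have "\<dots> = D * (c * S) * exp (- r * t)"
            unfolding D_def sum_distrib_right by (intro sum.cong refl) (simp add: mult_ac)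
          finally show ?thesis .
        qed
      qed (use \<rho> t in \<open>simp_all add: \<rho>_def\<close>)
      also have "\<dots> \<le> exp (- r * t) * (S + D * (c * S) / (\<rho> - r))"
        using S0 by (intro mult_left_mono) auto
      also have "\<dots> = c' * exp (- r * t) * S"
        by (simp add: c'_def field_simps)
      finally show ?thesis by (simp add: S_def)
    qed
    show ?case
    proof (intro exI[of _ "max c c'"] conjI allI impI)
      show "max c c' \<ge> 0" using c by simp
      fix u t j assume h: "sol u" "(0::real) \<le> t" "N - Suc k \<le> j" "j < N"
      have "norm (u t j) \<le> c * exp (- r * t) * (\<Sum>j<N. norm (u 0 j)) \<or> norm (u t j) \<le> c' * exp (- r * t) * (\<Sum>j<N. norm (u 0 j))"
      proof (cases "j = i")
        case True
        then show ?thesis using new[OF h(1,2)] by simp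
      next
        case False
        then have "N - k \<le> j" using h(3) i by (auto simp: i_def)
        then show ?thesis using IH[OF h(1,2)] h(4) by simp
      qed
      moreover have "c * exp (- r * t) * (\<Sum>j<N. norm (u 0 j)) \<le> max c c' * exp (- r * t) * (\<Sum>j<N. norm (u 0 j))"
        "c' * exp (- r * t) * (\<Sum>j<N. norm (u 0 j)) \<le> max c c' * exp (- r * t) * (\<Sum>j<N. norm (u 0 j))"
        by (intro mult_right_mono sum_nonneg; simp)+
      ultimately show "norm (u t j) \<le> max c c' * exp (- r * t) * (\<Sum>j<N. norm (u 0 j))"
        by linarith
    qed
  qed
  from this[of N] show ?thesis unfolding sol_def by auto
qed

lemma index_mult_mat_vec_sum:
  assumes "A \<in> carrier_mat n m" "v \<in> carrier_vec m" "i < n"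
  shows "vec_index (A *\<^sub>v v) i = (\<Sum>j<m. A $$ (i, j) * vec_index v j)"
proof -
  have "vec_index (A *\<^sub>v v) i = scalar_prod (row A i) v" using assms by simp
  also have "\<dots> = (\<Sum>j\<in>{0..<m}. A $$ (i, j) * vec_index v j)"
    unfolding scalar_prod_def using assms by (intro sum.cong) auto
  finally show ?thesis by (simp add: lessThan_atLeast0)
qed

text \<open>Schur triangularization over the complex numbers, with the eigenvalues on the diagonal,
  reduces the statement to the triangular case. The constant depends on the matrix only.\<close>

lemma linear_ode_decay:
  fixes F :: "real mat"
  assumes F: "F \<in> carrier_mat N N"
    and spec: "\<And>z. z \<in> spectrum (map_mat complex_of_real F) \<Longrightarrow> Re z < - r"
  shows "\<exists>c\<ge>0. \<forall>w. (\<forall>t. w t \<in> carrier_vec N) \<and>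
      (\<forall>i<N. \<forall>t\<ge>0. ((\<lambda>t. vec_index (w t) i) has_real_derivative vec_index (F *\<^sub>v w t) i) (at t within {0..}))
    \<longrightarrow> (\<forall>t\<ge>0. \<forall>i<N. \<bar>vec_index (w t) i\<bar> \<le> c * exp (- r * t) * (\<Sum>j<N. \<bar>vec_index (w 0) j\<bar>))"
proof -
  define A where "A = map_mat complex_of_real F"
  have A: "A \<in> carrier_mat N N" using F by (simp add: A_def)
  obtain es where es: "char_poly A = (\<Prod>a\<leftarrow>es. [:- a, 1:])"
    using char_poly_factorized[OF A] by blast
  obtain B P Q where BPQ: "schur_decomposition A es = (B, P, Q)"
    by (cases "schur_decomposition A es") auto
  from schur_decomposition[OF A es BPQ]
  have sim: "similar_mat_wit A B P Q" and ut: "upper_triangular B" and dg: "diag_mat B = es" by auto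
  from sim A have B: "B \<in> carrier_mat N N" and P: "P \<in> carrier_mat N N" and Q: "Q \<in> carrier_mat N N"
    and PQ: "P * Q = 1\<^sub>m N" and QP: "Q * P = 1\<^sub>m N" and APBQ: "A = P * B * Q"
    unfolding similar_mat_wit_def Let_def by auto
  have QA: "Q * A = B * Q"
  proof -
    have "Q * A = Q * (P * (B * Q))" unfolding APBQ using P B Q by (simp add: assoc_mult_mat[of _ N N _ N _ N])
    also have "\<dots> = (Q * P) * (B * Q)" using P B Q by (simp add: assoc_mult_mat[of _ N N _ N _ N])
    finally show ?thesis using B Q QP by simp
  qed
  have dd: "Re (B $$ (i, i)) < - r" if "i < N" for i
  proof -
    have "B $$ (i, i) \<in> set es"
      using that B unfolding dg[symmetric] diag_mat_def by auto
    then have "poly (char_poly A) (B $$ (i, i)) = 0"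
      unfolding es poly_prod_list prod_list_zero_iff by force
    then show ?thesis
      using spec spectrum_root_char_poly[OF A] unfolding A_def by auto
  qed
  obtain c where c: "c \<ge> 0" and dec0: "\<forall>u. (\<forall>i<N. \<forall>t\<ge>0. ((\<lambda>t. u t i) has_vector_derivative (\<Sum>j<N. B $$ (i, j) * u t j)) (at t within {0..}))
    \<longrightarrow> (\<forall>t\<ge>0. \<forall>i<N. norm (u t i) \<le> c * exp (- r * t) * (\<Sum>j<N. norm (u 0 j)))"
    using triangular_ode_decay[OF B ut, of r, OF dd] by auto
  have dec: "norm (u t i) \<le> c * exp (- r * t) * (\<Sum>j<N. norm (u 0 j))"
    if "\<And>i t. i < N \<Longrightarrow> t \<ge> 0 \<Longrightarrow>
        ((\<lambda>t. u t i) has_vector_derivative (\<Sum>j<N. B $$ (i, j) * u t j)) (at t within {0..})"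
      "t \<ge> 0" "i < N" for u t i
    by (rule dec0[rule_format]) (use that in auto)
  define q where "q = (\<Sum>i<N. \<Sum>j<N. norm (Q $$ (i, j)))"
  define p where "p = (\<Sum>i<N. \<Sum>j<N. norm (P $$ (i, j)))"
  have rowle: "(\<Sum>j<N. norm (M $$ (i, j))) \<le> (\<Sum>i<N. \<Sum>j<N. norm (M $$ (i, j)))" if "i < N" for M :: "complex mat" and i
    by (rule member_le_sum[where f="\<lambda>i. \<Sum>j<N. norm (M $$ (i, j))"]) (use that in \<open>auto intro: sum_nonneg\<close>)
  have q0: "q \<ge> 0" and p0: "p \<ge> 0" unfolding q_def p_def by (auto intro!: sum_nonneg)
  have matvec: "norm (vec_index (M *\<^sub>v v) i) \<le> (\<Sum>i<N. \<Sum>j<N. norm (M $$ (i, j))) * s"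
    if "M \<in> carrier_mat N N" "v \<in> carrier_vec N" "i < N" "\<And>j. j < N \<Longrightarrow> norm (vec_index v j) \<le> s" "s \<ge> 0"
    for M :: "complex mat" and v i s
  proof -
    have "norm (vec_index (M *\<^sub>v v) i) \<le> (\<Sum>j<N. norm (M $$ (i, j)) * s)"
      unfolding index_mult_mat_vec_sum[OF that(1-3)]
      by (rule sum_norm_le) (use that(4) in \<open>auto simp: norm_mult intro!: mult_left_mono\<close>)
    also have "\<dots> \<le> (\<Sum>i<N. \<Sum>j<N. norm (M $$ (i, j))) * s"
      unfolding sum_distrib_right[symmetric] using rowle[OF that(3)] that(5) by (rule mult_right_mono)
    finally show ?thesis .
  qed
  show ?thesis
  proof (intro exI[of _ "p * (c * (real N * q))"] conjI allI impI)
    show "p * (c * (real N * q)) \<ge> 0" using p0 q0 c by simp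
    fix w t i
    assume w: "(\<forall>t. w t \<in> carrier_vec N) \<and>
      (\<forall>i<N. \<forall>t\<ge>0. ((\<lambda>t. vec_index (w t) i) has_real_derivative vec_index (F *\<^sub>v w t) i) (at t within {0..}))"
      and t: "(0::real) \<le> t" and i: "i < N"
    have wc: "w t \<in> carrier_vec N" for t using w by blast
    define W where "W t = map_vec complex_of_real (w t)" for t
    have W: "W t \<in> carrier_vec N" for t using wc by (simp add: W_def)
    have Wi: "vec_index (W t) j = of_real (vec_index (w t) j)" if "j < N" for t j
      using that wc[of t] by (simp add: W_def)
    have AW: "A *\<^sub>v W t = map_vec complex_of_real (F *\<^sub>v w t)" for t
      unfolding A_def W_def using of_real_hom.mult_mat_vec_hom[OF F wc] by metis
    define u where "u t j = vec_index (Q *\<^sub>v W t) j" for t j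
    have uW: "Q *\<^sub>v W t \<in> carrier_vec N" for t using Q W by simp
    have du: "((\<lambda>t. u t i) has_vector_derivative (\<Sum>j<N. B $$ (i, j) * u t j)) (at t within {0..})"
      if i: "i < N" and t: "t \<ge> 0" for i t
    proof -
      have "(\<lambda>t. u t i) = (\<lambda>t. \<Sum>j<N. Q $$ (i, j) * of_real (vec_index (w t) j))"
        unfolding u_def using index_mult_mat_vec_sum[OF Q W i] Wi by auto
      moreover have "((\<lambda>t. \<Sum>j<N. Q $$ (i, j) * of_real (vec_index (w t) j)) has_vector_derivative
          (\<Sum>j<N. Q $$ (i, j) * of_real (vec_index (F *\<^sub>v w t) j))) (at t within {0..})"
        using w t
        by (intro has_vector_derivative_sum bounded_linear.has_vector_derivative[OF bounded_linear_mult_right]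
            has_vector_derivative_of_real) auto
      moreover have "(\<Sum>j<N. Q $$ (i, j) * of_real (vec_index (F *\<^sub>v w t) j)) = vec_index (Q *\<^sub>v (A *\<^sub>v W t)) i"
      proof -
        have "A *\<^sub>v W t \<in> carrier_vec N" using A W by simp
        from index_mult_mat_vec_sum[OF Q this i] show ?thesis
          using F by (simp add: AW)
      qed
      moreover have "Q *\<^sub>v (A *\<^sub>v W t) = B *\<^sub>v (Q *\<^sub>v W t)"
        using assoc_mult_mat_vec[OF Q A W[of t]] assoc_mult_mat_vec[OF B Q W[of t]] QA by simp
      moreover have "vec_index (B *\<^sub>v (Q *\<^sub>v W t)) i = (\<Sum>j<N. B $$ (i, j) * u t j)"
        unfolding u_def by (rule index_mult_mat_vec_sum[OF B uW i])
      ultimately show ?thesis by simp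
    qed
    have u_dec: "norm (u t i) \<le> c * exp (- r * t) * (\<Sum>j<N. norm (u 0 j))" if "i < N" for i
      by (rule dec[OF _ t that]) (rule du)
    define S where "S = (\<Sum>j<N. \<bar>vec_index (w 0) j\<bar>)"
    have S0: "S \<ge> 0" unfolding S_def by (rule sum_nonneg) simp
    have "(\<Sum>j<N. norm (u 0 j)) \<le> (\<Sum>j<N. q * S)"
    proof (rule sum_mono)
      fix j assume "j \<in> {..<N}"
      then show "norm (u 0 j) \<le> q * S"
        unfolding u_def q_def
        by (intro matvec[OF Q W] S0) (auto simp: Wi S_def intro!: member_le_sum)
    qed
    then have u0: "(\<Sum>j<N. norm (u 0 j)) \<le> real N * q * S" by simp
    have ut: "norm (u t j) \<le> c * exp (- r * t) * (real N * q * S)" if "j < N" for j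
      by (rule order_trans[OF u_dec[OF that]]) (use u0 c in \<open>auto intro!: mult_left_mono\<close>)
    have "W t = P *\<^sub>v (Q *\<^sub>v W t)"
      using assoc_mult_mat_vec[OF P Q W[of t]] PQ W[of t] by simp
    then have "norm (vec_index (W t) i) = norm (vec_index (P *\<^sub>v (Q *\<^sub>v W t)) i)" by simp
    also have "\<dots> \<le> p * (c * exp (- r * t) * (real N * q * S))"
      unfolding p_def
      by (rule matvec[OF P uW i]) (use ut c q0 S0 in \<open>auto simp: u_def[symmetric]\<close>)
    finally show "\<bar>vec_index (w t) i\<bar> \<le> p * (c * (real N * q)) * exp (- r * t) * (\<Sum>j<N. \<bar>vec_index (w 0) j\<bar>)"
      unfolding Wi[OF i] by (simp add: S_def mult_ac)
  qed
qed

lemma zero_mat_mult_vec: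
  "(v :: 'a::comm_ring_1 vec) \<in> carrier_vec m \<Longrightarrow> 0\<^sub>m n m *\<^sub>v v = 0\<^sub>v n"
  by (intro eq_vecI) (auto simp: scalar_prod_def)

text \<open>Each triple consists of a block, the part of the vector that it acts on, and the image
  of that part.\<close>

lemma diag_block_mat_mult_vec:
  assumes "\<And>A x y. (A, x, y) \<in> set L \<Longrightarrow> A \<in> carrier_mat (length x) (length x) \<and> length y = length x
      \<and> A *\<^sub>v vec_of_list x = vec_of_list y"
  shows "diag_block_mat (map fst L) \<in> carrier_mat (length (concat (map (fst \<circ> snd) L))) (length (concat (map (fst \<circ> snd) L)))
    \<and> length (concat (map (snd \<circ> snd) L)) = length (concat (map (fst \<circ> snd) L))
    \<and> diag_block_mat (map fst L) *\<^sub>v vec_of_list (concat (map (fst \<circ> snd) L))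
      = vec_of_list (concat (map (snd \<circ> snd) (L :: ('a::comm_ring_1 mat \<times> 'a list \<times> 'a list) list)))"
  using assms
proof (induction L)
  case Nil
  show ?case by (auto simp: mult_mat_vec_def)
next
  case (Cons T L)
  obtain A x y where T: "T = (A, x, y)" by (cases T)
  have A: "A \<in> carrier_mat (length x) (length x)" "length y = length x" "A *\<^sub>v vec_of_list x = vec_of_list y"
    using Cons.prems[of A x y] T by auto
  let ?x = "concat (map (fst \<circ> snd) L)" and ?y = "concat (map (snd \<circ> snd) L)" and ?B = "diag_block_mat (map fst L)"
  have IH: "?B \<in> carrier_mat (length ?x) (length ?x)" "length ?y = length ?x" "?B *\<^sub>v vec_of_list ?x = vec_of_list ?y"
  proof -
    have "?B \<in> carrier_mat (length ?x) (length ?x) \<and> length ?y = length ?x \<and> ?B *\<^sub>v vec_of_list ?x = vec_of_list ?y"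
      by (rule Cons.IH) (rule Cons.prems, simp)
    then show "?B \<in> carrier_mat (length ?x) (length ?x)" "length ?y = length ?x" "?B *\<^sub>v vec_of_list ?x = vec_of_list ?y"
      unfolding atomize_conj .
  qed
  have app: "vec_of_list (xs @ ys) = vec_of_list xs @\<^sub>v vec_of_list ys" for xs ys :: "'a list"
    by (induction xs) auto
  have cv: "vec_of_list x \<in> carrier_vec (length x)" "vec_of_list ?x \<in> carrier_vec (length ?x)"
    by (auto intro: carrier_vecI)
  have yv: "vec_of_list y \<in> carrier_vec (length x)" "vec_of_list ?y \<in> carrier_vec (length ?x)"
    using A IH by (auto intro!: carrier_vecI)
  let ?D = "four_block_mat A (0\<^sub>m (length x) (length ?x)) (0\<^sub>m (length ?x) (length x)) ?B"
  have D: "diag_block_mat (map fst (T # L)) = ?D"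
    using A IH by (auto simp: T Let_def)
  have "?D *\<^sub>v (vec_of_list x @\<^sub>v vec_of_list ?x)
     = (A *\<^sub>v vec_of_list x + 0\<^sub>m (length x) (length ?x) *\<^sub>v vec_of_list ?x)
       @\<^sub>v (0\<^sub>m (length ?x) (length x) *\<^sub>v vec_of_list x + ?B *\<^sub>v vec_of_list ?x)"
    by (rule four_block_mat_mult_vec[OF A(1) zero_carrier_mat zero_carrier_mat IH(1) cv])
  also have "0\<^sub>m (length x) (length ?x) *\<^sub>v vec_of_list ?x = 0\<^sub>v (length x)"
    by (rule zero_mat_mult_vec[OF cv(2)])
  also have "0\<^sub>m (length ?x) (length x) *\<^sub>v vec_of_list x = 0\<^sub>v (length ?x)"
    by (rule zero_mat_mult_vec[OF cv(1)])
  finally have "?D *\<^sub>v (vec_of_list x @\<^sub>v vec_of_list ?x) = vec_of_list y @\<^sub>v vec_of_list ?y"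
    by (simp only: A(3) IH(3) left_zero_vec[OF yv(2)] right_zero_vec[OF yv(1)])
  moreover have "?D \<in> carrier_mat (length x + length ?x) (length x + length ?x)"
    by (rule four_block_carrier_mat[OF A(1) IH(1)])
  ultimately show ?case
    unfolding D using A(2) IH(2) by (simp add: T app comp_def)
qed

section \<open>The finite-dimensional model\<close>

text \<open>The order of the retained modes in a bracket vector, as a list of tagged indices: an
  entry of the vector is then a case distinction on one list element.\<close>

definition mode_index :: "nat \<Rightarrow> nat \<Rightarrow> nat \<Rightarrow> (nat \<Rightarrow> nat) \<Rightarrow> (nat \<Rightarrow> nat) \<Rightarrow> (nat + nat) list" where
  "mode_index N N0 M0 p1 p2 = concat (map (\<lambda>i. [Inl (p1 i), Inr (p2 i)]) [0..<N])
     @ map (\<lambda>i. Inl (p1 i)) [N..<N0 + 1] @ map (\<lambda>i. Inr (p2 i)) [N..<M0 + 1]"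

lemma bracket_mode_index:
  "bracket N N0 M0 p1 p2 w1 w2 = vec_of_list (map (case_sum w1 w2) (mode_index N N0 M0 p1 p2))"
  unfolding bracket_def mode_index_def by (rule arg_cong[where f=vec_of_list]) (simp add: map_concat comp_def)

lemma length_concat_pairs: "length (concat (map (\<lambda>i. [f i, g i]) xs)) = 2 * length xs"
  by (induction xs) auto

text \<open>All that is used of the two orderings.\<close>

lemma mode_orderingD:
  assumes mo: "mode_ordering a b N0 M0 p1 p2"
    and D1: "\<forall>n\<in>Delta1 a b. n \<le> N0" and D2: "\<forall>m\<in>Delta2 a b. m \<le> M0"
  defines "N \<equiv> card (Delta a b)"
  shows "N \<le> N0 + 1" and "N \<le> M0 + 1" and "\<And>i. i < N \<Longrightarrow> (p1 i, p2 i) \<in> Delta a b"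
    and "\<And>i. N \<le> i \<Longrightarrow> i \<le> N0 \<Longrightarrow> p1 i \<notin> Delta1 a b"
    and "p1 ` {0..N0} = {0..N0}" and "p2 ` {0..M0} = {0..M0}"
proof -
  obtain th1 th2 :: "nat \<Rightarrow> nat" where th: "strict_mono_on {..<N} th1" "strict_mono_on {..<N} th2"
    "Delta a b = (\<lambda>i. (th1 i, th2 i)) ` {..<N}"
    and b1: "bij_betw p1 {0..N0} {0..N0}" and e1: "\<forall>i<N. p1 i = th1 i"
    and b2: "bij_betw p2 {0..M0} {0..M0}" and e2: "\<forall>i<N. p2 i = th2 i"
    using mo unfolding mode_ordering_def Let_def N_def by blast
  have "th1 ` {..<N} \<subseteq> {..N0}" "th2 ` {..<N} \<subseteq> {..M0}"
    using D1 D2 unfolding Delta1_def Delta2_def th(3) by auto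
  then have "card (th1 ` {..<N}) \<le> card {..N0}" "card (th2 ` {..<N}) \<le> card {..M0}"
    by (blast intro: card_mono[OF finite_atMost])+
  then show N1: "N \<le> N0 + 1" and "N \<le> M0 + 1"
    using th(1,2)[THEN strict_mono_on_imp_inj_on] by (simp_all add: card_image)
  show "(p1 i, p2 i) \<in> Delta a b" if "i < N" for i
    unfolding th(3) using e1 e2 that by auto
  show "p1 i \<notin> Delta1 a b" if "N \<le> i" "i \<le> N0" for i
  proof
    assume "p1 i \<in> Delta1 a b"
    then obtain j where j: "j < N" "p1 i = th1 j" unfolding Delta1_def th(3) by auto
    then have "p1 i = p1 j" using e1 by simp
    moreover have "j \<le> N0" using j N1 by simp
    ultimately have "i = j"
      using bij_betw_imp_inj_on[OF b1] that by (auto dest: inj_onD)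
    then show False using j that by simp
  qed
  show "p1 ` {0..N0} = {0..N0}" "p2 ` {0..M0} = {0..M0}"
    using b1 b2 by (simp_all add: bij_betw_def)
qed

lemma image_split_atLeast:
  assumes "p ` {0..N} = {0..N::nat}" "K \<le> N + 1"
  shows "p ` {0..<K} \<union> p ` {K..<N+1} = {0..N}"
proof -
  have "{0..<K} \<union> {K..<N+1} = {0..N}" using assms(2) by auto
  then show ?thesis using assms(1) by (metis image_Un)
qed

lemma mode_index_props:
  assumes "N \<le> N0 + 1" "N \<le> M0 + 1" "p1 ` {0..N0} = {0..N0}" "p2 ` {0..M0} = {0..M0}"
  shows "length (mode_index N N0 M0 p1 p2) = N0 + M0 + 2"
    and "set (mode_index N N0 M0 p1 p2) = Inl ` {0..N0} \<union> Inr ` {0..M0}"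
proof -
  show "length (mode_index N N0 M0 p1 p2) = N0 + M0 + 2"
    using assms(1,2) by (simp add: mode_index_def length_concat_pairs)
  have "set (mode_index N N0 M0 p1 p2) = Inl ` (p1 ` {0..<N} \<union> p1 ` {N..<N0+1}) \<union> Inr ` (p2 ` {0..<N} \<union> p2 ` {N..<M0+1})"
    by (auto simp: mode_index_def)
  then show "set (mode_index N N0 M0 p1 p2) = Inl ` {0..N0} \<union> Inr ` {0..M0}"
    by (simp only: image_split_atLeast[OF assms(3,1)] image_split_atLeast[OF assms(4,2)])
qed

lemma M_block_mult:
  "M_block a b s n \<in> carrier_mat 2 2"
  "M_block a b s n *\<^sub>v vec_of_list [x, y]
    = vec_of_list [lambda1 a n * x - sqrt 2 * s * mu (partner a b n) * y, lambda1 a n * y]"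
proof -
  show M: "M_block a b s n \<in> carrier_mat 2 2"
    by (auto simp: M_block_def mat_of_rows_list_def)
  have v: "vec_of_list [x, y] \<in> carrier_vec 2" by (rule carrier_vecI) simp
  show "M_block a b s n *\<^sub>v vec_of_list [x, y]
    = vec_of_list [lambda1 a n * x - sqrt 2 * s * mu (partner a b n) * y, lambda1 a n * y]"
  proof (rule eq_vecI)
    fix i assume "i < dim_vec (vec_of_list [lambda1 a n * x - sqrt 2 * s * mu (partner a b n) * y, lambda1 a n * y])"
    then have i: "i < 2" by simp
    have "vec_index (M_block a b s n *\<^sub>v vec_of_list [x, y]) i
      = M_block a b s n $$ (i, 0) * x + M_block a b s n $$ (i, 1) * y"
      unfolding index_mult_mat_vec_sum[OF M v i] vec_of_list_index by (simp add: numeral_2_eq_2)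
    also have "\<dots> = [lambda1 a n * x - sqrt 2 * s * mu (partner a b n) * y, lambda1 a n * y] ! i"
      using i by (auto simp: M_block_def mat_of_rows_list_def less_2_cases_iff)
    finally show "vec_index (M_block a b s n *\<^sub>v vec_of_list [x, y]) i
      = vec_index (vec_of_list [lambda1 a n * x - sqrt 2 * s * mu (partner a b n) * y, lambda1 a n * y]) i"
      by (simp only: vec_of_list_index)
  qed (use M in auto)
qed

lemma scalar_block_mult:
  "mat_of_rows_list 1 [[c]] \<in> carrier_mat 1 1"
  "mat_of_rows_list 1 [[c]] *\<^sub>v vec_of_list [x] = vec_of_list [c * x :: real]"
proof -
  show M: "mat_of_rows_list 1 [[c]] \<in> carrier_mat 1 1" by (auto simp: mat_of_rows_list_def)
  have v: "vec_of_list [x] \<in> carrier_vec 1" by (rule carrier_vecI) simp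
  show "mat_of_rows_list 1 [[c]] *\<^sub>v vec_of_list [x] = vec_of_list [c * x]"
  proof (rule eq_vecI)
    fix i assume "i < dim_vec (vec_of_list [c * x])"
    then have i: "i < 1" by simp
    show "vec_index (mat_of_rows_list 1 [[c]] *\<^sub>v vec_of_list [x]) i = vec_index (vec_of_list [c * x]) i"
      unfolding index_mult_mat_vec_sum[OF M v i] vec_of_list_index using i by (simp add: mat_of_rows_list_def)
  qed (use M in auto)
qed

text \<open>Each diagonal block acts on a segment of the bracket; the coupling term covers the
  \<open>2 \<times> 2\<close> blocks and vanishes on the others.\<close>

lemma A1_mult_bracket:
  assumes mo: "mode_ordering a b N0 M0 p1 p2"
    and D1: "\<forall>n\<in>Delta1 a b. n \<le> N0" and D2: "\<forall>m\<in>Delta2 a b. m \<le> M0"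
  defines "N \<equiv> card (Delta a b)"
  shows "A1 a b s N0 M0 p1 p2 \<in> carrier_mat (N0 + M0 + 2) (N0 + M0 + 2)"
    and "A1 a b s N0 M0 p1 p2 *\<^sub>v bracket N N0 M0 p1 p2 w1 w2
      = bracket N N0 M0 p1 p2 (\<lambda>n. lambda1 a n * w1 n - coupling a b s n * w2 (partner a b n))
          (\<lambda>m. lambda2 b m * w2 m)"
proof -
  note md = mode_orderingD[OF mo D1 D2, folded N_def]
  define d1 where "d1 n = lambda1 a n * w1 n - coupling a b s n * w2 (partner a b n)" for n
  define d2 where "d2 m = lambda2 b m * w2 m" for m
  define L1 where "L1 = map (\<lambda>i. (M_block a b s (p1 i), [w1 (p1 i), w2 (p2 i)], [d1 (p1 i), d2 (p2 i)])) [0..<N]"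
  define L2 where "L2 = map (\<lambda>i. (mat_of_rows_list 1 [[lambda1 a (p1 i)]], [w1 (p1 i)], [d1 (p1 i)])) [N..<N0 + 1]"
  define L3 where "L3 = map (\<lambda>i. (mat_of_rows_list 1 [[lambda2 b (p2 i)]], [w2 (p2 i)], [d2 (p2 i)])) [N..<M0 + 1]"
  define L where "L = L1 @ L2 @ L3"
  have single: "concat (map (\<lambda>i. [f i]) xs) = map f xs" for f :: "nat \<Rightarrow> real" and xs
    by (induction xs) auto
  have A: "A1 a b s N0 M0 p1 p2 = diag_block_mat (map fst L)"
    unfolding A1_def Let_def L_def L1_def L2_def L3_def N_def by (simp add: comp_def)
  have X: "concat (map (fst \<circ> snd) L) = map (case_sum w1 w2) (mode_index N N0 M0 p1 p2)"
    unfolding L_def L1_def L2_def L3_def mode_index_def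
    by (simp only: map_append concat_append map_map comp_def fst_conv snd_conv single map_concat list.map sum.case)
  have Y: "concat (map (snd \<circ> snd) L) = map (case_sum d1 d2) (mode_index N N0 M0 p1 p2)"
    unfolding L_def L1_def L2_def L3_def mode_index_def
    by (simp only: map_append concat_append map_map comp_def fst_conv snd_conv single map_concat list.map sum.case)
  have ok: "A \<in> carrier_mat (length x) (length x) \<and> length y = length x \<and> A *\<^sub>v vec_of_list x = vec_of_list y"
    if "(A, x, y) \<in> set L" for A x y
  proof -
    from that consider i where "i < N" "A = M_block a b s (p1 i)" "x = [w1 (p1 i), w2 (p2 i)]" "y = [d1 (p1 i), d2 (p2 i)]"
      | i where "N \<le> i" "i \<le> N0" "A = mat_of_rows_list 1 [[lambda1 a (p1 i)]]" "x = [w1 (p1 i)]" "y = [d1 (p1 i)]"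
      | i where "N \<le> i" "i \<le> M0" "A = mat_of_rows_list 1 [[lambda2 b (p2 i)]]" "x = [w2 (p2 i)]" "y = [d2 (p2 i)]"
      unfolding L_def L1_def L2_def L3_def by auto
    then show ?thesis
    proof cases
      case 1
      note D = md(3)[OF 1(1)]
      have p: "partner a b (p1 i) = p2 i" by (rule partner_eq[OF D])
      have "p1 i \<in> Delta1 a b" using D unfolding Delta1_def by force
      then have "coupling a b s (p1 i) = sqrt 2 * s * mu (p2 i)" by (simp add: coupling_def p)
      moreover have "lambda2 b (p2 i) = lambda1 a (p1 i)" using D by (simp add: Delta_iff)
      ultimately have "y = [lambda1 a (p1 i) * w1 (p1 i) - sqrt 2 * s * mu (partner a b (p1 i)) * w2 (p2 i), lambda1 a (p1 i) * w2 (p2 i)]"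
        by (simp add: 1(4) d1_def d2_def p)
      then show ?thesis
        unfolding 1(2,3) using M_block_mult[of a b s "p1 i"] by (simp del: vec_of_list_Cons add: numeral_2_eq_2)
    next
      case 2
      have "y = [lambda1 a (p1 i) * w1 (p1 i)]"
        using md(4)[OF 2(1,2)] by (simp add: 2(5) d1_def coupling_def)
      then show ?thesis
        unfolding 2(3,4) using scalar_block_mult[of "lambda1 a (p1 i)"] by (simp del: vec_of_list_Cons)
    next
      case 3
      have "y = [lambda2 b (p2 i) * w2 (p2 i)]"
        by (simp add: 3(5) d2_def)
      then show ?thesis
        unfolding 3(3,4) using scalar_block_mult[of "lambda2 b (p2 i)"] by (simp del: vec_of_list_Cons)
    qed
  qed
  have main: "diag_block_mat (map fst L) \<in> carrier_mat (length (concat (map (fst \<circ> snd) L))) (length (concat (map (fst \<circ> snd) L)))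
    \<and> length (concat (map (snd \<circ> snd) L)) = length (concat (map (fst \<circ> snd) L))
    \<and> diag_block_mat (map fst L) *\<^sub>v vec_of_list (concat (map (fst \<circ> snd) L))
      = vec_of_list (concat (map (snd \<circ> snd) L))"
    by (rule diag_block_mat_mult_vec) (rule ok)
  have "length (map (case_sum w1 w2) (mode_index N N0 M0 p1 p2)) = N0 + M0 + 2"
    using mode_index_props(1)[OF md(1,2,5,6)] by simp
  with main show "A1 a b s N0 M0 p1 p2 \<in> carrier_mat (N0 + M0 + 2) (N0 + M0 + 2)"
    unfolding A X by simp
  show "A1 a b s N0 M0 p1 p2 *\<^sub>v bracket N N0 M0 p1 p2 w1 w2
      = bracket N N0 M0 p1 p2 (\<lambda>n. lambda1 a n * w1 n - coupling a b s n * w2 (partner a b n))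
          (\<lambda>m. lambda2 b m * w2 m)"
    using main unfolding A[symmetric] X Y bracket_mode_index d1_def[abs_def] d2_def[abs_def]
    by (elim conjE)
qed

lemma column_mult:
  assumes "w \<in> carrier_vec d"
  shows "column w \<in> carrier_mat d 1"
    and "\<And>k i. k \<in> carrier_vec 1 \<Longrightarrow> i < d \<Longrightarrow> vec_index (column w *\<^sub>v k) i = vec_index w i * (vec_index k 0 :: real)"
proof -
  have d: "dim_vec w = d" using assms by simp
  show C: "column w \<in> carrier_mat d 1" by (simp add: column_def d mat_of_cols_def)
  fix k :: "real vec" and i assume k: "k \<in> carrier_vec 1" and i: "i < d"
  show "vec_index (column w *\<^sub>v k) i = vec_index w i * vec_index k 0"
    unfolding index_mult_mat_vec_sum[OF C k i] using i by (simp add: column_def d mat_of_cols_def)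
qed

section \<open>Modal equations\<close>

lemma continuous_on_Ici_subset: "continuous_on {0..} f \<Longrightarrow> continuous_on {0..t::real} f"
  by (rule continuous_on_subset) auto

lemma at_within_Icc_Ici:
  fixes t :: real assumes "0 \<le> t" shows "at t within {0..t + 1} = at t within {0..}"
  by (rule at_within_nhd[of _ "{..<t+1}"]) (use assms in auto)

lemma integral_equation_has_derivative:
  fixes g :: "real \<Rightarrow> real"
  assumes g: "continuous_on {0..} g" and x: "\<And>t. t \<ge> 0 \<Longrightarrow> x t = c + integral {0..t} g" and t: "t \<ge> 0"
  shows "(x has_real_derivative g t) (at t within {0..})"
proof -
  have "((\<lambda>\<tau>. c + integral {0..\<tau>} g) has_vector_derivative g t) (at t within {0..t+1})"
    using has_vector_derivative_add[OF has_vector_derivative_const[of c]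
        integral_has_vector_derivative[OF continuous_on_Ici_subset[OF g, of "t+1"], of t]] t by simp
  then have "((\<lambda>\<tau>. c + integral {0..\<tau>} g) has_vector_derivative g t) (at t within {0..})"
    by (simp only: at_within_Icc_Ici[OF t])
  then have "(x has_vector_derivative g t) (at t within {0..})"
    by (rule has_vector_derivative_transform[rotated 2]) (use t x in auto)
  then show ?thesis by (simp add: has_real_derivative_iff_has_vector_derivative)
qed

text \<open>Pairing the integrated equation with an adjoint eigenfunction \<open>p\<close> moves the
  operator from the integrated state to \<open>p\<close>, and the inner product commutes with the
  integral. What remains is a scalar integral equation with continuous integrand.\<close>

lemma mild_solution_mode:
  assumes mild: "mild_solution a b s X0 X u v"
    and u: "continuous_on {0..} u" and v: "continuous_on {0..} v"
    and adj: "\<And>Y. Y \<in> dom_A s \<Longrightarrow> inner (op_A a b Y) p = inner Y q" and t: "t \<ge> 0"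
  shows "((\<lambda>t. inner (X t) p) has_real_derivative
      (inner (X t) q + u t * inner (0, alpha b) p + v t * inner (0, beta) p)) (at t within {0..})"
proof -
  have X: "continuous_on {0..} X" using mild by (simp add: mild_solution_def)
  define G where "G \<tau> = u \<tau> *\<^sub>R ((0, alpha b) :: state) + v \<tau> *\<^sub>R (0, beta)" for \<tau>
  have G: "continuous_on {0..} G" unfolding G_def by (intro continuous_intros u v)
  have int: "inner (integral {0..t} f) w = integral {0..t} (\<lambda>\<tau>. inner (f \<tau>) w)"
    if f: "continuous_on {0..} f" for f :: "real \<Rightarrow> state" and w t
    using integral_linear[OF integrable_continuous_interval[OF continuous_on_Ici_subset[OF f, of t]]
        bounded_linear_inner_left[of w]] by (simp add: comp_def)
  define g where "g \<tau> = inner (X \<tau>) q + u \<tau> * inner (0, alpha b) p + v \<tau> * inner (0, beta) p" for \<tau>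
  have Gp: "inner (G \<tau>) p = u \<tau> * inner (0, alpha b) p + v \<tau> * inner (0, beta) p" for \<tau>
    by (simp add: G_def inner_add_left del: inner_Pair scaleR_Pair add_Pair)
  have "((\<lambda>t. inner (X t) p) has_real_derivative g t) (at t within {0..})"
  proof (rule integral_equation_has_derivative[where x="\<lambda>t. inner (X t) p" and c="inner X0 p"])
    show "continuous_on {0..} g" unfolding g_def by (intro continuous_intros u v X)
    fix t :: real assume t: "t \<ge> 0"
    have I: "integral {0..t} X \<in> dom_A s" and eq: "X t = X0 + op_A a b (integral {0..t} X) + integral {0..t} G"
      using mild t unfolding mild_solution_def G_def by auto
    have "inner (X t) p = inner X0 p + inner (integral {0..t} X) q + inner (integral {0..t} G) p"
      by (subst eq) (simp add: inner_add_left adj[OF I])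
    also have "\<dots> = inner X0 p + (integral {0..t} (\<lambda>\<tau>. inner (X \<tau>) q) + integral {0..t} (\<lambda>\<tau>. inner (G \<tau>) p))"
      by (simp add: int X G)
    also have "integral {0..t} (\<lambda>\<tau>. inner (X \<tau>) q) + integral {0..t} (\<lambda>\<tau>. inner (G \<tau>) p) = integral {0..t} g"
      unfolding g_def Gp[symmetric] add.assoc
      by (rule integral_add[symmetric]; intro integrable_continuous_interval continuous_on_Ici_subset continuous_intros X G)
    finally show "inner (X t) p = inner X0 p + integral {0..t} g" .
  qed (rule t)
  then show ?thesis by (simp add: g_def)
qed

section \<open>Forced modes and square summable families\<close>

lemma norm_psi_bound: "\<bar>inner X p\<bar> \<le> norm p * norm (X :: state)"
  using Cauchy_Schwarz_ineq2[of X p] by (simp add: mult.commute)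

text \<open>The two inputs of a mode act as one forcing term that decays at rate
  \<open>r\<close>.\<close>

lemma forced_mode_bound:
  fixes x u v :: "real \<Rightarrow> real"
  assumes x: "\<And>t. t \<ge> 0 \<Longrightarrow> (x has_real_derivative (l * x t + u t * \<alpha> + v t * \<beta>)) (at t within {0..})"
    and u: "\<And>t. t \<ge> 0 \<Longrightarrow> \<bar>u t\<bar> \<le> C * exp (- r * t) * W"
    and v: "\<And>t. t \<ge> 0 \<Longrightarrow> \<bar>v t\<bar> \<le> C * exp (- r * t) * W"
    and l: "l \<le> - \<rho>" "r < \<rho>" and t: "t \<ge> 0"
  shows "\<bar>x t\<bar> \<le> exp (- r * t) * (\<bar>x 0\<bar> + C / (\<rho> - r) * (\<bar>\<alpha>\<bar> + \<bar>\<beta>\<bar>) * W)"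
proof -
  have "\<bar>x t\<bar> \<le> exp (- r * t) * (\<bar>x 0\<bar> + C * W * (\<bar>\<alpha>\<bar> + \<bar>\<beta>\<bar>) / (\<rho> - r))"
  proof (rule scalar_ode_decay_real[where x=x and l=l and f="\<lambda>t. u t * \<alpha> + v t * \<beta>" and \<rho>=\<rho> and r=r
        and C="C * W * (\<bar>\<alpha>\<bar> + \<bar>\<beta>\<bar>)"])
    fix t :: real assume t: "t \<ge> 0"
    show "(x has_real_derivative (l * x t + (u t * \<alpha> + v t * \<beta>))) (at t within {0..})"
      using x[OF t] by (simp add: add.assoc)
    have "\<bar>u t * \<alpha> + v t * \<beta>\<bar> \<le> \<bar>u t\<bar> * \<bar>\<alpha>\<bar> + \<bar>v t\<bar> * \<bar>\<beta>\<bar>"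
      using abs_triangle_ineq[of "u t * \<alpha>" "v t * \<beta>"] by (simp add: abs_mult)
    also have "\<dots> \<le> C * exp (- r * t) * W * \<bar>\<alpha>\<bar> + C * exp (- r * t) * W * \<bar>\<beta>\<bar>"
      by (intro add_mono mult_right_mono u v t) auto
    also have "\<dots> = C * W * (\<bar>\<alpha>\<bar> + \<bar>\<beta>\<bar>) * exp (- r * t)" by (simp add: algebra_simps)
    finally show "\<bar>u t * \<alpha> + v t * \<beta>\<bar> \<le> C * W * (\<bar>\<alpha>\<bar> + \<bar>\<beta>\<bar>) * exp (- r * t)" .
  qed (use l t in auto)
  then show ?thesis by (simp add: mult_ac)
qed

lemma lambda1_antimono: "n \<le> k \<Longrightarrow> lambda1 a k \<le> lambda1 a n"
  unfolding lambda1_def by (intro diff_left_mono mult_right_mono power_mono) auto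

lemma lambda2_antimono: "n \<le> k \<Longrightarrow> lambda2 b k \<le> lambda2 b n"
  unfolding lambda2_def by (intro diff_left_mono mult_right_mono power_mono) auto

lemma omega_ge: "omega n \<ge> real (Suc n)"
proof -
  have "(real n + 1/2) * 3 \<le> (real n + 1/2) * pi" using pi_gt3 by (intro mult_left_mono) auto
  then have "(real n + 1/2) * 3 \<le> omega n" by (simp only: omega_def)
  moreover have "real (Suc n) \<le> (real n + 1/2) * 3" by (simp add: field_simps)
  ultimately show ?thesis by linarith
qed

lemma summable_inverse_omega: "summable (\<lambda>n. (c / omega n)\<^sup>2)"
proof (rule summable_comparison_test')
  have "summable (\<lambda>n. inverse ((real n)\<^sup>2))" by (rule inverse_power_summable) simp
  then have "summable (\<lambda>n. inverse ((real (Suc n))\<^sup>2))" by (subst summable_Suc_iff)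
  from summable_mult[OF this, of "c\<^sup>2"]
  show "summable (\<lambda>n. c\<^sup>2 * (1 / (real (Suc n))\<^sup>2))"
    by (simp only: inverse_eq_divide)
  fix n
  have "1 / omega n \<le> 1 / real (Suc n)" using omega_ge[of n] omega_pos[of n] by (intro divide_left_mono) auto
  then have "(1 / omega n)\<^sup>2 \<le> (1 / real (Suc n))\<^sup>2" using omega_pos[of n] by (intro power_mono) auto
  then have "c\<^sup>2 * (1 / omega n)\<^sup>2 \<le> c\<^sup>2 * (1 / real (Suc n))\<^sup>2" by (intro mult_left_mono) auto
  then show "norm ((c / omega n)\<^sup>2) \<le> c\<^sup>2 * (1 / (real (Suc n))\<^sup>2)"
    by (simp add: power_divide)
qed

text \<open>The input profiles are quadratic polynomials. Their regularity makes the weighted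
  sequences of input coefficients square summable.\<close>

lemma alpha_beta_H1: "alpha b \<in> H1" "beta \<in> H1"
proof -
  have "(phi has_real_derivative (1 - x)) (at x)" for x
    unfolding phi_def[abs_def] by (auto intro!: derivative_eq_intros)
  then have d: "deriv phi = (\<lambda>x. 1 - x)" by (auto intro: DERIV_imp_deriv)
  have "deriv (deriv phi) x = -1" for x
    unfolding d by (rule DERIV_imp_deriv) (auto intro!: derivative_eq_intros)
  then have al: "alpha b = L2_of (\<lambda>x. - 1 + b * phi x)" by (simp add: alpha_def)
  show "alpha b \<in> H1" unfolding al phi_def
    by (rule H1I(1), rule has_weak_deriv_L2_of[where p="\<lambda>x. - 1 + b * (x - x\<^sup>2 / 2)" and p'="\<lambda>x. b * (1 - x)"])
      (auto intro!: derivative_eq_intros continuous_intros)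
  show "beta \<in> H1" unfolding beta_def phi_def
    by (rule H1I(1), rule has_weak_deriv_L2_of[where p="\<lambda>x. - (x - x\<^sup>2 / 2)" and p'="\<lambda>x. x - 1"])
      (auto intro!: derivative_eq_intros continuous_intros)
qed

lemma summable_sq_add:
  fixes f g :: "nat \<Rightarrow> real"
  assumes "summable (\<lambda>n. (f n)\<^sup>2)" "summable (\<lambda>n. (g n)\<^sup>2)"
  shows "summable (\<lambda>n. (f n + g n)\<^sup>2)"
proof (rule summable_comparison_test')
  show "summable (\<lambda>n. 2 * (f n)\<^sup>2 + 2 * (g n)\<^sup>2)" by (intro summable_add summable_mult assms)
  show "norm ((f n + g n)\<^sup>2) \<le> 2 * (f n)\<^sup>2 + 2 * (g n)\<^sup>2" for n
  proof -
    have "(f n + g n)\<^sup>2 \<le> 2 * (f n)\<^sup>2 + 2 * (g n)\<^sup>2"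
      using sum_squares_bound[of "f n" "g n"] by (simp add: power2_sum)
    then show ?thesis by simp
  qed
qed

lemma summable_sq_mono:
  fixes f g :: "nat \<Rightarrow> real"
  assumes "summable (\<lambda>n. (g n)\<^sup>2)" "\<And>n. \<bar>f n\<bar> \<le> g n"
  shows "summable (\<lambda>n. (f n)\<^sup>2)"
proof (rule summable_comparison_test'[OF assms(1), where N=0])
  show "norm ((f n)\<^sup>2) \<le> (g n)\<^sup>2" for n
    using power_mono[OF assms(2) abs_ge_zero, of n 2] by simp
qed

lemma summable_sq_scale: "summable (\<lambda>n. (f n)\<^sup>2) \<Longrightarrow> summable (\<lambda>n. ((c::real) * f n)\<^sup>2)"
  by (simp add: power_mult_distrib summable_mult)

lemma summable_sq_abs: "summable (\<lambda>n. (f n)\<^sup>2) \<Longrightarrow> summable (\<lambda>n. \<bar>f n :: real\<bar>\<^sup>2)"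
  by simp

lemma summable_sq_cofinite:
  fixes f g :: "nat \<Rightarrow> real"
  assumes "summable (\<lambda>n. (g n)\<^sup>2)" "\<And>n. n > N \<Longrightarrow> f n = g n"
  shows "summable (\<lambda>n. (f n)\<^sup>2)"
proof -
  have "\<forall>\<^sub>F n in sequentially. (f n)\<^sup>2 = (g n)\<^sup>2"
    using eventually_gt_at_top[of N] by eventually_elim (simp add: assms(2))
  from summable_cong[OF this] assms(1) show ?thesis by simp
qed

section \<open>Summation of the modal estimates\<close>

lemma square_sum4_le: "(a + b + c + d)\<^sup>2 \<le> 4 * (a\<^sup>2 + b\<^sup>2 + c\<^sup>2 + d\<^sup>2)" for a b c d :: real
proof -
  have "4 * (a\<^sup>2 + b\<^sup>2 + c\<^sup>2 + d\<^sup>2) - (a + b + c + d)\<^sup>2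
    = (a - b)\<^sup>2 + (a - c)\<^sup>2 + (a - d)\<^sup>2 + (b - c)\<^sup>2 + (b - d)\<^sup>2 + (c - d)\<^sup>2"
    by (simp add: power2_eq_square algebra_simps)
  also have "\<dots> \<ge> 0" by (intro add_nonneg_nonneg) auto
  finally show ?thesis by simp
qed

text \<open>The form in which all four norms at time \<open>t\<close> are estimated:
  \<open>c0\<close> carries the initial coefficients, \<open>\<gamma>\<close> the effect of the
  inputs, and \<open>\<kappa>\<close> the correction by \<open>z\<close> at time \<open>0\<close>
  (factor \<open>p\<close>) and at time \<open>t\<close> (factor \<open>p'\<close>).\<close>

lemma cascade_sum:
  fixes c c0 \<kappa> \<gamma> :: "nat \<Rightarrow> real"
  assumes bound: "\<And>n. \<bar>c n\<bar> \<le> E * \<bar>c0 n\<bar> + E * p * \<kappa> n + E * W * \<gamma> n + p' * \<kappa> n"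
    and s: "summable (\<lambda>n. (c0 n)\<^sup>2)" "summable (\<lambda>n. (\<kappa> n)\<^sup>2)" "summable (\<lambda>n. (\<gamma> n)\<^sup>2)"
  shows "summable (\<lambda>n. (c n)\<^sup>2)"
    and "(\<Sum>n. (c n)\<^sup>2) \<le> 4 * (E\<^sup>2 * (\<Sum>n. (c0 n)\<^sup>2) + E\<^sup>2 * p\<^sup>2 * (\<Sum>n. (\<kappa> n)\<^sup>2)
      + E\<^sup>2 * W\<^sup>2 * (\<Sum>n. (\<gamma> n)\<^sup>2) + p'\<^sup>2 * (\<Sum>n. (\<kappa> n)\<^sup>2))"
proof -
  define g where "g n = 4 * (E\<^sup>2 * (c0 n)\<^sup>2 + E\<^sup>2 * p\<^sup>2 * (\<kappa> n)\<^sup>2 + E\<^sup>2 * W\<^sup>2 * (\<gamma> n)\<^sup>2 + p'\<^sup>2 * (\<kappa> n)\<^sup>2)" for n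
  have g: "summable g" unfolding g_def by (intro summable_mult summable_add s)
  have le: "(c n)\<^sup>2 \<le> g n" for n
  proof -
    have "(c n)\<^sup>2 \<le> (E * \<bar>c0 n\<bar> + E * p * \<kappa> n + E * W * \<gamma> n + p' * \<kappa> n)\<^sup>2"
      using power_mono[OF bound abs_ge_zero, of n 2] by simp
    also have "\<dots> \<le> 4 * ((E * \<bar>c0 n\<bar>)\<^sup>2 + (E * p * \<kappa> n)\<^sup>2 + (E * W * \<gamma> n)\<^sup>2 + (p' * \<kappa> n)\<^sup>2)"
      by (rule square_sum4_le)
    also have "\<dots> = g n" by (simp add: g_def power_mult_distrib)
    finally show ?thesis .
  qed
  show c: "summable (\<lambda>n. (c n)\<^sup>2)"
    by (rule summable_comparison_test'[OF g, where N=0]) (use le in simp)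
  have "(\<Sum>n. (c n)\<^sup>2) \<le> (\<Sum>n. g n)" by (rule suminf_le[OF le c g])
  also have "\<dots> = 4 * (E\<^sup>2 * (\<Sum>n. (c0 n)\<^sup>2) + E\<^sup>2 * p\<^sup>2 * (\<Sum>n. (\<kappa> n)\<^sup>2)
      + E\<^sup>2 * W\<^sup>2 * (\<Sum>n. (\<gamma> n)\<^sup>2) + p'\<^sup>2 * (\<Sum>n. (\<kappa> n)\<^sup>2))"
    unfolding g_def
    by (subst suminf_mult, (intro summable_mult summable_add s)+,
        subst suminf_add[symmetric], (intro summable_mult summable_add s)+,
        subst suminf_add[symmetric], (intro summable_mult summable_add s)+,
        subst suminf_add[symmetric], (intro summable_mult summable_add s)+)
      (simp add: suminf_mult s)
  finally show "(\<Sum>n. (c n)\<^sup>2) \<le> 4 * (E\<^sup>2 * (\<Sum>n. (c0 n)\<^sup>2) + E\<^sup>2 * p\<^sup>2 * (\<Sum>n. (\<kappa> n)\<^sup>2)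
      + E\<^sup>2 * W\<^sup>2 * (\<Sum>n. (\<gamma> n)\<^sup>2) + p'\<^sup>2 * (\<Sum>n. (\<kappa> n)\<^sup>2))" .
qed

lemma norm_calH1_sq:
  "(norm_calH1 X)\<^sup>2 = (norm (weak_deriv (fst X)))\<^sup>2 + (norm (snd X))\<^sup>2 + (norm (weak_deriv (snd X)))\<^sup>2"
  by (simp add: norm_calH1_def inner_calH1_def power2_norm_eq_inner)

lemma norm_state_sq: "(norm (X :: state))\<^sup>2 = (norm (fst X))\<^sup>2 + (norm (snd X))\<^sup>2"
  by (simp add: norm_prod_def)

text \<open>All frequencies \<open>\<omega>\<^sub>n\<close> are at least one.\<close>

lemma poincare:
  assumes "f \<in> H1" "point_value f 1 = 0"
  shows "(norm f)\<^sup>2 \<le> (norm (weak_deriv f))\<^sup>2"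
proof -
  have "(norm f)\<^sup>2 = (\<Sum>n. (inner f (hcos_mode n))\<^sup>2)"
    by (rule parseval[OF orthonormal_hcos_mode total_hcos_mode, symmetric])
  also have "\<dots> \<le> (\<Sum>n. (omega n * inner f (hcos_mode n))\<^sup>2)"
  proof (rule suminf_le[OF _ bessel_summable[OF orthonormal_hcos_mode] H1_hcos_coeffs(1)[OF assms]])
    fix n
    have "1 \<le> (omega n)\<^sup>2" using omega_ge[of n] by (simp add: one_le_power)
    from mult_right_mono[OF this zero_le_power2]
    show "(inner f (hcos_mode n))\<^sup>2 \<le> (omega n * inner f (hcos_mode n))\<^sup>2"
      by (simp add: power_mult_distrib)
  qed
  also have "\<dots> \<le> (norm (weak_deriv f))\<^sup>2" by (rule H1_hcos_coeffs(2)[OF assms])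
  finally show ?thesis .
qed

lemma square_sum2_le: "(a + b)\<^sup>2 \<le> 2 * a\<^sup>2 + 2 * b\<^sup>2" for a b :: real
  using sum_squares_bound[of a b] by (simp add: power2_sum)

section \<open>The change of coordinates\<close>

definition lift :: "state \<Rightarrow> real \<Rightarrow> state" where
  "lift X c = (fst X, snd X + c *\<^sub>R L2_of phi)"

lemma phi_H1: "L2_of phi \<in> H1"
  unfolding phi_def[abs_def]
  by (rule H1I(1), rule has_weak_deriv_L2_of[where p="\<lambda>x. x - x\<^sup>2 / 2" and p'="\<lambda>x. 1 - x"])
    (auto intro!: derivative_eq_intros continuous_intros)

text \<open>Any bound for the norms of the two changes of coordinates would do.\<close>

definition phi_const :: real where
  "phi_const = 3 + 2 * (norm (L2_of phi))\<^sup>2 + 2 * (norm (weak_deriv (L2_of phi)))\<^sup>2"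

lemma norm_add_scaled_sq: "(norm (f + c *\<^sub>R g))\<^sup>2 \<le> 2 * (norm f)\<^sup>2 + 2 * (c\<^sup>2 * (norm g)\<^sup>2)"
  for f g :: "'a::real_normed_vector"
proof -
  have "(norm (f + c *\<^sub>R g))\<^sup>2 \<le> (norm f + \<bar>c\<bar> * norm g)\<^sup>2"
    using norm_triangle_ineq[of f "c *\<^sub>R g"] by (intro power_mono) auto
  also have "\<dots> \<le> 2 * (norm f)\<^sup>2 + 2 * (\<bar>c\<bar> * norm g)\<^sup>2" by (rule square_sum2_le)
  finally show ?thesis by (simp add: power_mult_distrib)
qed

text \<open>The change of coordinates adds a multiple of the fixed \<open>H\<^sup>1\<close> function
  \<open>\<phi>\<close>, hence preserves both norms up to a constant as long as the square of the
  multiplier is included. The inverse change is the same map with \<open>-c\<close>.\<close>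

lemma lift_bounds:
  shows "(norm (lift X c))\<^sup>2 + c\<^sup>2 \<le> phi_const * ((norm X)\<^sup>2 + c\<^sup>2)"
    and "X \<in> calH1 \<Longrightarrow> lift X c \<in> calH1"
    and "X \<in> calH1 \<Longrightarrow> (norm_calH1 (lift X c))\<^sup>2 + c\<^sup>2 \<le> phi_const * ((norm_calH1 X)\<^sup>2 + c\<^sup>2)"
proof -
  define A where "A = (norm (L2_of phi))\<^sup>2"
  define B where "B = (norm (weak_deriv (L2_of phi)))\<^sup>2"
  have AB: "A \<ge> 0" "B \<ge> 0" by (simp_all add: A_def B_def)
  have nz: "(norm (snd X + c *\<^sub>R L2_of phi))\<^sup>2 \<le> 2 * (norm (snd X))\<^sup>2 + 2 * (c\<^sup>2 * A)"
    unfolding A_def by (rule norm_add_scaled_sq)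
  have gen: "(P + 2 * R + 2 * (c\<^sup>2 * A) + 2 * (c\<^sup>2 * B)) + c\<^sup>2 \<le> phi_const * (P + R + c\<^sup>2)" if "P \<ge> 0" "R \<ge> 0" for P R
  proof -
    have "0 \<le> (2 + 2 * A + 2 * B) * P + (1 + 2 * A + 2 * B) * R + 2 * c\<^sup>2"
      using AB that by (intro add_nonneg_nonneg mult_nonneg_nonneg) auto
    then show ?thesis by (simp add: phi_const_def A_def[symmetric] B_def[symmetric] algebra_simps)
  qed
  have "c\<^sup>2 * B \<ge> 0" using AB by simp
  then show "(norm (lift X c))\<^sup>2 + c\<^sup>2 \<le> phi_const * ((norm X)\<^sup>2 + c\<^sup>2)"
    using gen[of "(norm (fst X))\<^sup>2" "(norm (snd X))\<^sup>2"] nz by (simp add: norm_state_sq lift_def)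
  assume X: "X \<in> calH1"
  then have h: "fst X \<in> H1" "point_value (fst X) 1 = 0" "snd X \<in> H1" by (auto simp: calH1_def)
  have wd: "has_weak_deriv (snd X + c *\<^sub>R L2_of phi) (weak_deriv (snd X) + c *\<^sub>R weak_deriv (L2_of phi))"
    by (intro has_weak_deriv_add has_weak_deriv_scale H1D h phi_H1)
  show "lift X c \<in> calH1" using h H1I(1)[OF wd] by (simp add: lift_def calH1_def)
  have nd: "(norm (weak_deriv (snd X) + c *\<^sub>R weak_deriv (L2_of phi)))\<^sup>2
      \<le> 2 * (norm (weak_deriv (snd X)))\<^sup>2 + 2 * (c\<^sup>2 * B)"
    unfolding B_def by (rule norm_add_scaled_sq)
  have "(norm_calH1 (lift X c))\<^sup>2 + c\<^sup>2 \<le> ((norm (weak_deriv (fst X)))\<^sup>2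
      + 2 * ((norm (snd X))\<^sup>2 + (norm (weak_deriv (snd X)))\<^sup>2) + 2 * (c\<^sup>2 * A) + 2 * (c\<^sup>2 * B)) + c\<^sup>2"
    using nz nd by (simp add: norm_calH1_sq lift_def H1I(2)[OF wd])
  also have "\<dots> \<le> phi_const * ((norm (weak_deriv (fst X)))\<^sup>2 + ((norm (snd X))\<^sup>2 + (norm (weak_deriv (snd X)))\<^sup>2) + c\<^sup>2)"
    by (rule gen) auto
  finally show "(norm_calH1 (lift X c))\<^sup>2 + c\<^sup>2 \<le> phi_const * ((norm_calH1 X)\<^sup>2 + c\<^sup>2)"
    by (simp add: norm_calH1_sq add.assoc)
qed

lemma phi_const_pos: "phi_const > 0"
  by (simp add: phi_const_def add_pos_nonneg)

lemma transfer_bound: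
  assumes "x \<le> (k::real) * x'" "x' \<le> C * e * y'" "y' \<le> k * y" "0 \<le> k" "0 \<le> C" "0 \<le> e" "0 \<le> y"
  shows "x \<le> (k * C * k + 1) * e * y"
proof -
  have "x \<le> k * (C * e * (k * y))"
    using assms by (intro order_trans[OF assms(1)] mult_left_mono order_trans[OF assms(2)]) auto
  also have "\<dots> \<le> (k * C * k + 1) * e * y" using assms by (simp add: algebra_simps)
  finally show ?thesis .
qed

section \<open>The closed loop\<close>

locale stabilized_loop =
  fixes a b s \<delta> :: real and N0 M0 :: nat and p1 p2 :: "nat \<Rightarrow> nat" and K :: "real mat"
  assumes l1: "lambda1 a (N0 + 1) < - \<delta>" and l2: "lambda2 b (M0 + 1) < - \<delta>"
    and D1: "\<forall>n\<in>Delta1 a b. n \<le> N0" and D2: "\<forall>m\<in>Delta2 a b. m \<le> M0"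
    and mo: "mode_ordering a b N0 M0 p1 p2"
    and K: "K \<in> carrier_mat 1 (N0 + M0 + 3)"
    and sa: "spectral_abscissa (A1a a b s N0 M0 p1 p2 - B1a a b s N0 M0 p1 p2 * K) < - \<delta>"
begin

abbreviation "Am \<equiv> A1 a b s N0 M0 p1 p2"
abbreviation "Aa \<equiv> A1a a b s N0 M0 p1 p2"
abbreviation "Ba \<equiv> B1a a b s N0 M0 p1 p2"
abbreviation "F \<equiv> Aa - Ba * K"
abbreviation "J \<equiv> mode_index (card (Delta a b)) N0 M0 p1 p2"
abbreviation "aug \<equiv> X1a a b s N0 M0 p1 p2"
abbreviation "mvec \<equiv> mode_coeffs a b s N0 M0 p1 p2"
abbreviation "\<psi> \<equiv> psi1 a b s"
abbreviation "\<xi> \<equiv> adj_snd a b s"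

definition solution :: "(real \<Rightarrow> state) \<Rightarrow> (real \<Rightarrow> real) \<Rightarrow> (real \<Rightarrow> real) \<Rightarrow> bool" where
  "solution X u v \<longleftrightarrow> (\<forall>t. v t = - vec_index (K *\<^sub>v aug (X t) (u t)) 0) \<and>
     (\<forall>t\<ge>0. (u has_real_derivative v t) (at t within {0..})) \<and> mild_solution a b s (X 0) X u v"

abbreviation initial :: "(real \<Rightarrow> state) \<Rightarrow> (real \<Rightarrow> real) \<Rightarrow> real" where
  "initial X u \<equiv> norm (X 0) + \<bar>u 0\<bar>"

lemma X1a_index:
  shows "aug X u \<in> carrier_vec (N0 + M0 + 3)"
    and "\<And>i. i < N0 + M0 + 2 \<Longrightarrow> vec_index (aug X u) i
      = case_sum (\<lambda>n. inner X (\<psi> n)) (\<lambda>m. inner X (psi2 m)) (J ! i)"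
    and "vec_index (aug X u) (N0 + M0 + 2) = u"
    and "mvec X \<in> carrier_vec (N0 + M0 + 2)"
    and "\<And>i. i < N0 + M0 + 2 \<Longrightarrow> vec_index (mvec X) i
      = case_sum (\<lambda>n. inner X (\<psi> n)) (\<lambda>m. inner X (psi2 m)) (J ! i)"
proof -
  note md = mode_orderingD[OF mo D1 D2]
  have len: "length J = N0 + M0 + 2" by (rule mode_index_props(1)[OF md(1,2,5,6)])
  have mc: "mvec X
      = vec_of_list (map (case_sum (\<lambda>n. inner X (\<psi> n)) (\<lambda>m. inner X (psi2 m))) J)"
    unfolding mode_coeffs_def bracket_mode_index ..
  show C: "mvec X \<in> carrier_vec (N0 + M0 + 2)"
    by (rule carrier_vecI) (simp add: mc len)
  have d1: "dim_vec (vec_of_list [u]) = 1" by simp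
  show E: "vec_index (mvec X) i
      = case_sum (\<lambda>n. inner X (\<psi> n)) (\<lambda>m. inner X (psi2 m)) (J ! i)" if "i < N0 + M0 + 2" for i
    unfolding mc vec_of_list_index using that len by simp
  show "aug X u \<in> carrier_vec (N0 + M0 + 3)"
    unfolding X1a_def by (rule carrier_vecI) (use carrier_vecD[OF C] in simp)
  show "vec_index (aug X u) i
      = case_sum (\<lambda>n. inner X (\<psi> n)) (\<lambda>m. inner X (psi2 m)) (J ! i)" if "i < N0 + M0 + 2" for i
    unfolding X1a_def using that E[OF that] carrier_vecD[OF C] by simp
  show "vec_index (aug X u) (N0 + M0 + 2) = u"
    unfolding X1a_def using carrier_vecD[OF C] by simp
qed

text \<open>Continuity of the inputs is needed to differentiate the integral equations of the
  modes.\<close>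

lemma closed_loop_continuous:
  assumes cl: "solution X u v"
  shows "continuous_on {0..} u" and "continuous_on {0..} v"
proof -
  note xi = X1a_index
  have X: "continuous_on {0..} X" using cl by (simp add: solution_def mild_solution_def)
  show u: "continuous_on {0..} u"
    by (rule continuous_on_has_real_derivative[of _ _ v]) (use cl in \<open>auto simp: solution_def\<close>)
  have entry: "continuous_on {0..} (\<lambda>t. vec_index (aug (X t) (u t)) j)" if "j < N0 + M0 + 3" for j
  proof (cases "j = N0 + M0 + 2")
    case True
    show ?thesis unfolding True xi(3) using u by simp
  next
    case False
    then have j: "j < N0 + M0 + 2" using that by simp
    show ?thesis unfolding xi(2)[OF j]
      by (cases "J ! j") (auto intro!: continuous_intros X)
  qed
  have "v = (\<lambda>t. - (\<Sum>j<N0 + M0 + 3. K $$ (0, j) * vec_index (aug (X t) (u t)) j))"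
  proof
    fix t
    have "v t = - vec_index (K *\<^sub>v aug (X t) (u t)) 0"
      using cl by (simp add: solution_def)
    then show "v t = - (\<Sum>j<N0 + M0 + 3. K $$ (0, j) * vec_index (aug (X t) (u t)) j)"
      using index_mult_mat_vec_sum[OF K xi(1), of 0] by simp
  qed
  then show "continuous_on {0..} v"
    by (auto intro!: continuous_intros entry)
qed

lemma closed_loop_modes:
  assumes cl: "solution X u v" and t: "t \<ge> 0"
  shows "((\<lambda>t. inner (X t) (\<psi> n)) has_real_derivative
      (lambda1 a n * inner (X t) (\<psi> n) - coupling a b s n * inner (X t) (psi2 (partner a b n))
        + u t * inner (0, alpha b) (\<psi> n) + v t * inner (0, beta) (\<psi> n))) (at t within {0..})"
    and "((\<lambda>t. inner (X t) (psi2 m)) has_real_derivative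
      (lambda2 b m * inner (X t) (psi2 m) + u t * inner (0, alpha b) (psi2 m) + v t * inner (0, beta) (psi2 m)))
      (at t within {0..})"
proof -
  note c = closed_loop_continuous[OF cl]
  have mild: "mild_solution a b s (X 0) X u v" using cl by (simp add: solution_def)
  show "((\<lambda>t. inner (X t) (\<psi> n)) has_real_derivative
      (lambda1 a n * inner (X t) (\<psi> n) - coupling a b s n * inner (X t) (psi2 (partner a b n))
        + u t * inner (0, alpha b) (\<psi> n) + v t * inner (0, beta) (\<psi> n))) (at t within {0..})"
    using mild_solution_mode[OF mild c, of "\<psi> n"
        "lambda1 a n *\<^sub>R \<psi> n - coupling a b s n *\<^sub>R psi2 (partner a b n)" t] t
    by (simp add: op_A_psi1 inner_diff_right del: inner_Pair)
  show "((\<lambda>t. inner (X t) (psi2 m)) has_real_derivative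
      (lambda2 b m * inner (X t) (psi2 m) + u t * inner (0, alpha b) (psi2 m) + v t * inner (0, beta) (psi2 m)))
      (at t within {0..})"
    using mild_solution_mode[OF mild c, of "psi2 m" "lambda2 b m *\<^sub>R psi2 m" t] t
    by (simp add: op_A_psi2 del: inner_Pair)
qed

text \<open>Entry by entry, multiplication by \<open>F\<close> reproduces the modal equations, and
  its last row is the integrator equation of \<open>u\<close>.\<close>

lemma closed_loop_X1a:
  shows "F \<in> carrier_mat (N0 + M0 + 3) (N0 + M0 + 3)"
    and "\<And>X u v t i. solution X u v \<Longrightarrow> t \<ge> 0 \<Longrightarrow> i < N0 + M0 + 3 \<Longrightarrow>
      ((\<lambda>t. vec_index (aug (X t) (u t)) i) has_real_derivative
        vec_index (F *\<^sub>v aug (X t) (u t)) i) (at t within {0..})"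
proof -
  note xi = X1a_index
  note md = mode_orderingD[OF mo D1 D2]
  let ?d = "N0 + M0 + 2"
  note A = A1_mult_bracket[OF mo D1 D2, of s]
  let ?al = "mvec (0, alpha b)"
  let ?be = "mvec (0, beta)"
  note cu = column_mult[OF xi(4)[of "(0, alpha b)"]]
  have bv: "?be @\<^sub>v vec_of_list [1] \<in> carrier_vec (?d + 1)"
    by (rule carrier_vecI) (use carrier_vecD[OF xi(4)] in simp)
  note cv = column_mult[OF bv]
  have Aa: "Aa \<in> carrier_mat (?d + 1) (?d + 1)"
    unfolding A1a_def by (rule four_block_carrier_mat[OF A(1)]) auto
  have Ba: "Ba \<in> carrier_mat (?d + 1) 1"
    unfolding B1a_def by (rule cv(1))
  have K': "K \<in> carrier_mat 1 (?d + 1)" using K by (simp add: numeral_3_eq_3)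
  have BK: "Ba * K \<in> carrier_mat (?d + 1) (?d + 1)"
    by (rule mult_carrier_mat[OF Ba K'])
  have F': "F \<in> carrier_mat (?d + 1) (?d + 1)"
    by (rule minus_carrier_mat[OF BK])
  then show "F \<in> carrier_mat (N0 + M0 + 3) (N0 + M0 + 3)" by (simp add: numeral_3_eq_3)
  fix X :: "real \<Rightarrow> state" and u v :: "real \<Rightarrow> real" and t :: real and i
  assume cl: "solution X u v" and t: "t \<ge> 0" and i: "i < N0 + M0 + 3"
  let ?w = "aug (X t) (u t)"
  have w: "?w \<in> carrier_vec (?d + 1)" using xi(1)[of "X t" "u t"] by (simp add: numeral_3_eq_3)
  have u1: "vec_of_list [u t] \<in> carrier_vec 1" by (rule carrier_vecI) simp
  have Kw: "K *\<^sub>v ?w \<in> carrier_vec 1" using K' w by (rule mult_mat_vec_carrier)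
  have v: "vec_index (K *\<^sub>v ?w) 0 = - v t" using cl by (simp add: solution_def)
  have Fw: "F *\<^sub>v ?w = Aa *\<^sub>v ?w - Ba *\<^sub>v (K *\<^sub>v ?w)"
    unfolding minus_mult_distrib_mat_vec[OF Aa BK w] assoc_mult_mat_vec[OF Ba K' w] ..
  have Bi: "vec_index (Ba *\<^sub>v (K *\<^sub>v ?w)) i = - v t * vec_index (?be @\<^sub>v vec_of_list [1]) i"
    unfolding B1a_def using cv(2)[OF Kw, of i] i v by simp
  have Aw: "Aa *\<^sub>v ?w = (Am *\<^sub>v mvec (X t)
      + column ?al *\<^sub>v vec_of_list [u t]) @\<^sub>v (0\<^sub>v 1)"
  proof -
    have "Aa *\<^sub>v ?w = (Am *\<^sub>v mvec (X t)
      + column ?al *\<^sub>v vec_of_list [u t])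
      @\<^sub>v (0\<^sub>m 1 ?d *\<^sub>v mvec (X t) + 0\<^sub>m 1 1 *\<^sub>v vec_of_list [u t])"
      unfolding A1a_def X1a_def
      by (rule four_block_mat_mult_vec[OF A(1) cu(1) zero_carrier_mat zero_carrier_mat xi(4) u1])
    also have "0\<^sub>m 1 ?d *\<^sub>v mvec (X t) = 0\<^sub>v 1"
      by (rule zero_mat_mult_vec[OF xi(4)])
    also have "0\<^sub>m 1 1 *\<^sub>v vec_of_list [u t] = 0\<^sub>v 1"
      by (rule zero_mat_mult_vec[OF u1])
    finally show ?thesis by simp
  qed
  have AX: "Am *\<^sub>v mvec (X t) \<in> carrier_vec ?d"
    using A(1) xi(4) by (rule mult_mat_vec_carrier)
  have CU: "column ?al *\<^sub>v vec_of_list [u t] \<in> carrier_vec ?d"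
    using cu(1) u1 by (rule mult_mat_vec_carrier)
  have BKv: "Ba *\<^sub>v (K *\<^sub>v ?w) \<in> carrier_vec (?d + 1)"
    using Ba Kw by (rule mult_mat_vec_carrier)
  have Fwi: "vec_index (F *\<^sub>v ?w) i
    = vec_index (Aa *\<^sub>v ?w) i + v t * vec_index (?be @\<^sub>v vec_of_list [1]) i"
  proof -
    have "i < dim_vec (Ba *\<^sub>v (K *\<^sub>v ?w))"
      using carrier_vecD[OF BKv] i by linarith
    from index_minus_vec(1)[OF this] show ?thesis
      unfolding Fw by (simp only: Bi mult_minus_left diff_minus_eq_add)
  qed
  show "((\<lambda>t. vec_index (aug (X t) (u t)) i) has_real_derivative
        vec_index (F *\<^sub>v ?w) i) (at t within {0..})"
  proof (cases "i = ?d")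
    case True
    have "vec_index (?be @\<^sub>v vec_of_list [1]) i = 1"
      using carrier_vecD[OF xi(4)] by (simp add: True)
    moreover have "vec_index (Aa *\<^sub>v ?w) i = 0"
      unfolding Aw using carrier_vecD[OF AX] carrier_vecD[OF CU] by (simp add: True)
    ultimately have FV: "vec_index (F *\<^sub>v ?w) i = v t"
      unfolding Fwi by simp
    have ux: "(u has_real_derivative v t) (at t within {0..})"
      using cl t unfolding solution_def by blast
    show ?thesis unfolding FV unfolding True xi(3) by (rule ux)
  next
    case False
    then have id: "i < ?d" using i by simp
    have 1: "vec_index (?be @\<^sub>v vec_of_list [1]) i = vec_index ?be i"
      using carrier_vecD[OF xi(4)] id by simp
    have "vec_index (Aa *\<^sub>v ?w) i
      = vec_index (Am *\<^sub>v mvec (X t)) i + vec_index (column ?al *\<^sub>v vec_of_list [u t]) i"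
      unfolding Aw using carrier_vecD[OF AX] carrier_vecD[OF CU] id by simp
    also have "vec_index (column ?al *\<^sub>v vec_of_list [u t]) i = vec_index ?al i * u t"
      using cu(2)[OF u1 id] by simp
    finally have Fi: "vec_index (F *\<^sub>v ?w) i
      = vec_index (Am *\<^sub>v mvec (X t)) i + vec_index ?al i * u t + v t * vec_index ?be i"
      unfolding Fwi 1 by simp
    have len: "length J = ?d" by (rule mode_index_props(1)[OF md(1,2,5,6)])
    have AXi: "vec_index (Am *\<^sub>v mvec (X t)) i
      = case_sum (\<lambda>n. lambda1 a n * inner (X t) (\<psi> n) - coupling a b s n * inner (X t) (psi2 (partner a b n)))
          (\<lambda>m. lambda2 b m * inner (X t) (psi2 m)) (J ! i)"
      unfolding mode_coeffs_def A(2) unfolding bracket_mode_index vec_of_list_index using id len by simp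
    note modes = closed_loop_modes[OF cl t]
    show ?thesis
      unfolding Fi AXi xi(2)[OF id] xi(5)[OF id] using modes
      by (cases "J ! i") (simp_all add: mult.commute del: inner_Pair)
  qed
qed

text \<open>The rate \<open>r\<close> is placed strictly between \<open>\<delta>\<close> and the
  decay rates of \<open>F\<close> and of the first neglected modes; this gap is what the neglected
  modes need in order to inherit the decay of the inputs.\<close>

lemma finite_model_decay:
  shows "\<exists>r C. \<delta> < r \<and> lambda1 a (N0 + 1) < - r \<and> lambda2 b (M0 + 1) < - r \<and> 0 \<le> C \<and>
    (\<forall>X u v. solution X u v \<longrightarrow> (\<forall>t\<ge>0.
       \<bar>u t\<bar> \<le> C * exp (- r * t) * initial X u \<and>
       \<bar>v t\<bar> \<le> C * exp (- r * t) * initial X u \<and>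
       (\<forall>n\<le>N0. \<bar>inner (X t) (\<psi> n)\<bar> \<le> C * exp (- r * t) * initial X u) \<and>
       (\<forall>m\<le>M0. \<bar>inner (X t) (psi2 m)\<bar> \<le> C * exp (- r * t) * initial X u)))"
proof -
  let ?D = "N0 + M0 + 3"
  note xi = X1a_index
  note md = mode_orderingD[OF mo D1 D2]
  note ode = closed_loop_X1a
  have Fc: "map_mat complex_of_real F \<in> carrier_mat ?D ?D" using ode(1) by simp
  \<comment> \<open>the largest of the growth rates that \<open>-r\<close> has to stay above\<close>
  define q where "q = max (spectral_abscissa F) (max (lambda1 a (N0 + 1)) (lambda2 b (M0 + 1)))"
  have "q < - \<delta>" using sa l1 l2 by (simp add: q_def)
  then obtain r' where r': "q < r'" "r' < - \<delta>" using dense by blast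
  define r where "r = - r'"
  have r: "\<delta> < r" "q < - r" using r' by (simp_all add: r_def)
  have spec: "Re z < - r" if "z \<in> spectrum (map_mat complex_of_real F)" for z
  proof -
    have "Re z \<le> spectral_abscissa F"
      unfolding spectral_abscissa_def using that card_finite_spectrum(1)[OF Fc] by (intro Max_ge) auto
    then show ?thesis using r(2) by (simp add: q_def)
  qed
  obtain c where c: "c \<ge> 0" and dec: "\<forall>w. (\<forall>t. w t \<in> carrier_vec ?D) \<and>
      (\<forall>i<?D. \<forall>t\<ge>0. ((\<lambda>t. vec_index (w t) i) has_real_derivative vec_index (F *\<^sub>v w t) i) (at t within {0..}))
    \<longrightarrow> (\<forall>t\<ge>0. \<forall>i<?D. \<bar>vec_index (w t) i\<bar> \<le> c * exp (- r * t) * (\<Sum>j<?D. \<bar>vec_index (w 0) j\<bar>))"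
    using linear_ode_decay[OF ode(1) spec] by blast
  \<comment> \<open>bounds every entry of the initial vector by the initial size of the data; the summand one is for \<open>u\<close>\<close>
  define \<Psi> where "\<Psi> = (\<Sum>n\<le>N0. norm (\<psi> n)) + (\<Sum>m\<le>M0. norm (psi2 m)) + 1"
  have \<Psi>1: "norm (\<psi> n) \<le> \<Psi>" if "n \<le> N0" for n
    using member_le_sum[of n "{..N0}" "\<lambda>n. norm (\<psi> n)"] that sum_nonneg[of "{..M0}" "\<lambda>m. norm (psi2 m)"]
    by (simp add: \<Psi>_def)
  have \<Psi>2: "norm (psi2 m) \<le> \<Psi>" if "m \<le> M0" for m
    using member_le_sum[of m "{..M0}" "\<lambda>m. norm (psi2 m)"] that sum_nonneg[of "{..N0}" "\<lambda>n. norm (\<psi> n)"]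
    by (simp add: \<Psi>_def)
  have \<Psi>0: "\<Psi> \<ge> 1" unfolding \<Psi>_def by (simp add: sum_nonneg)
  define \<kappa> where "\<kappa> = (\<Sum>j<?D. \<bar>K $$ (0, j)\<bar>)"
  have \<kappa>0: "\<kappa> \<ge> 0" unfolding \<kappa>_def by (rule sum_nonneg) simp
  define C1 where "C1 = c * (real ?D * \<Psi>)"
  define C where "C = C1 + \<kappa> * C1"
  have C10: "C1 \<ge> 0" unfolding C1_def using c \<Psi>0 by (intro mult_nonneg_nonneg) auto
  have C0: "C \<ge> 0" "C1 \<le> C" "\<kappa> * C1 \<le> C" unfolding C_def using C10 \<kappa>0 by auto
  have setJ: "set J = Inl ` {0..N0} \<union> Inr ` {0..M0}" and lenJ: "length J = N0 + M0 + 2"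
    using mode_index_props[OF md(1,2,5,6)] by auto
  have main: "\<bar>u t\<bar> \<le> C * exp (- r * t) * initial X u \<and>
       \<bar>v t\<bar> \<le> C * exp (- r * t) * initial X u \<and>
       (\<forall>n\<le>N0. \<bar>inner (X t) (\<psi> n)\<bar> \<le> C * exp (- r * t) * initial X u) \<and>
       (\<forall>m\<le>M0. \<bar>inner (X t) (psi2 m)\<bar> \<le> C * exp (- r * t) * initial X u)"
    if cl: "solution X u v" and t: "t \<ge> 0" for X u v t
  proof -
    define w where "w t = aug (X t) (u t)" for t
    define W where "W = initial X u"
    have W0: "W \<ge> 0" by (simp add: W_def)
    have wdec: "\<bar>vec_index (w t) i\<bar> \<le> c * exp (- r * t) * (\<Sum>j<?D. \<bar>vec_index (w 0) j\<bar>)" if "i < ?D" for i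
    proof -
      have "(\<forall>t. w t \<in> carrier_vec ?D) \<and>
        (\<forall>i<?D. \<forall>t\<ge>0. ((\<lambda>t. vec_index (w t) i) has_real_derivative vec_index (F *\<^sub>v w t) i) (at t within {0..}))"
        unfolding w_def using xi(1) ode(2)[OF cl] by blast
      with dec t that show ?thesis by blast
    qed
    have "(\<Sum>j<?D. \<bar>vec_index (w 0) j\<bar>) \<le> (\<Sum>j<?D. \<Psi> * W)"
    proof (rule sum_mono)
      fix j assume j: "j \<in> {..<?D}"
      show "\<bar>vec_index (w 0) j\<bar> \<le> \<Psi> * W"
      proof (cases "j = N0 + M0 + 2")
        case True
        have "\<bar>vec_index (w 0) j\<bar> = \<bar>u 0\<bar>" unfolding w_def True xi(3) ..
        also have "\<dots> \<le> 1 * W" by (simp add: W_def)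
        also have "\<dots> \<le> \<Psi> * W" using \<Psi>0 W0 by (rule mult_right_mono)
        finally show ?thesis .
      next
        case False
        then have j': "j < N0 + M0 + 2" using j by simp
        have mem: "J ! j \<in> Inl ` {0..N0} \<union> Inr ` {0..M0}"
          using nth_mem[of j J] j' lenJ setJ by simp
        have "\<bar>vec_index (w 0) j\<bar> \<le> \<Psi> * norm (X 0)"
        proof -
          from mem consider n where "n \<le> N0" "J ! j = Inl n" | m where "m \<le> M0" "J ! j = Inr m" by auto
          then show ?thesis
          proof cases
            case 1
            have "\<bar>vec_index (w 0) j\<bar> = \<bar>inner (X 0) (\<psi> n)\<bar>"
              unfolding w_def xi(2)[OF j'] 1(2) by simp
            also have "\<dots> \<le> norm (\<psi> n) * norm (X 0)" by (rule norm_psi_bound)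
            also have "\<dots> \<le> \<Psi> * norm (X 0)" by (intro mult_right_mono \<Psi>1 1) simp
            finally show ?thesis .
          next
            case 2
            have "\<bar>vec_index (w 0) j\<bar> = \<bar>inner (X 0) (psi2 m)\<bar>"
              unfolding w_def xi(2)[OF j'] 2(2) by simp
            also have "\<dots> \<le> norm (psi2 m) * norm (X 0)" by (rule norm_psi_bound)
            also have "\<dots> \<le> \<Psi> * norm (X 0)" by (intro mult_right_mono \<Psi>2 2) simp
            finally show ?thesis .
          qed
        qed
        also have "\<dots> \<le> \<Psi> * W" using \<Psi>0 by (intro mult_left_mono) (auto simp: W_def)
        finally show ?thesis .
      qed
    qed
    then have S: "(\<Sum>j<?D. \<bar>vec_index (w 0) j\<bar>) \<le> real ?D * \<Psi> * W" by simp
    have w: "\<bar>vec_index (w t) i\<bar> \<le> C1 * exp (- r * t) * W" if "i < ?D" for i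
    proof -
      have "\<bar>vec_index (w t) i\<bar> \<le> c * exp (- r * t) * (real ?D * \<Psi> * W)"
        by (rule order_trans[OF wdec[OF that]]) (use S c in \<open>auto intro!: mult_left_mono\<close>)
      then show ?thesis by (simp add: C1_def mult_ac)
    qed
    have EW: "exp (- r * t) * W \<ge> 0" using W0 by simp
    have w': "\<bar>vec_index (w t) i\<bar> \<le> C * exp (- r * t) * W" if "i < ?D" for i
      using order_trans[OF w[OF that, unfolded mult.assoc] mult_right_mono[OF C0(2) EW]]
      by (simp only: mult.assoc)
    have u: "\<bar>u t\<bar> \<le> C * exp (- r * t) * W"
      using w'[of "N0 + M0 + 2"] unfolding w_def xi(3) by simp
    have v: "\<bar>v t\<bar> \<le> C * exp (- r * t) * W"
    proof -
      have "v t = - vec_index (K *\<^sub>v w t) 0" using cl by (simp add: solution_def w_def)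
      also have "vec_index (K *\<^sub>v w t) 0 = (\<Sum>j<?D. K $$ (0, j) * vec_index (w t) j)"
        unfolding w_def by (rule index_mult_mat_vec_sum[OF K xi(1)]) simp
      finally have "\<bar>v t\<bar> = \<bar>\<Sum>j<?D. K $$ (0, j) * vec_index (w t) j\<bar>" by simp
      also have "\<dots> \<le> (\<Sum>j<?D. \<bar>K $$ (0, j)\<bar> * (C1 * exp (- r * t) * W))"
        by (rule order_trans[OF sum_abs], rule sum_mono) (use w in \<open>auto simp: abs_mult intro!: mult_left_mono\<close>)
      also have "\<dots> = \<kappa> * C1 * (exp (- r * t) * W)"
        by (simp add: \<kappa>_def sum_distrib_right mult.assoc)
      also have "\<dots> \<le> C * (exp (- r * t) * W)" by (rule mult_right_mono[OF C0(3) EW])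
      finally show ?thesis by (simp add: mult.assoc)
    qed
    have "\<bar>inner (X t) (\<psi> n)\<bar> \<le> C * exp (- r * t) * W" if "n \<le> N0" for n
    proof -
      have "Inl n \<in> set J" unfolding setJ using that by auto
      then obtain i where i: "i < N0 + M0 + 2" "J ! i = Inl n" by (auto simp: in_set_conv_nth lenJ)
      have "vec_index (w t) i = inner (X t) (\<psi> n)" unfolding w_def xi(2)[OF i(1)] i(2) by simp
      then show ?thesis using w'[of i] i(1) by simp
    qed
    moreover have "\<bar>inner (X t) (psi2 m)\<bar> \<le> C * exp (- r * t) * W" if "m \<le> M0" for m
    proof -
      have "Inr m \<in> set J" unfolding setJ using that by auto
      then obtain i where i: "i < N0 + M0 + 2" "J ! i = Inr m" by (auto simp: in_set_conv_nth lenJ)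
      have "vec_index (w t) i = inner (X t) (psi2 m)" unfolding w_def xi(2)[OF i(1)] i(2) by simp
      then show ?thesis using w'[of i] i(1) by simp
    qed
    ultimately show ?thesis using u v unfolding W_def by blast
  qed
  have "lambda1 a (N0 + 1) < - r" "lambda2 b (M0 + 1) < - r" using r(2) by (auto simp: q_def)
  with r(1) C0(1) main show ?thesis by blast
qed

text \<open>The outcome of the analysis mode by mode: initial coefficient and initial size, the
  latter weighted by sequences whose summability matches the two norms to be estimated.\<close>

definition modal_envelope :: "real \<Rightarrow> (nat \<Rightarrow> real) \<Rightarrow> (nat \<Rightarrow> real) \<Rightarrow> bool" where
  "modal_envelope C \<gamma>1 \<gamma>2 \<longleftrightarrow> 0 \<le> C \<and> (\<forall>n. 0 \<le> \<gamma>1 n) \<and> (\<forall>m. 0 \<le> \<gamma>2 m) \<and>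
    summable (\<lambda>n. (omega n * \<gamma>1 n)\<^sup>2) \<and> summable (\<lambda>m. (\<gamma>2 m)\<^sup>2) \<and> summable (\<lambda>m. (real m * pi * \<gamma>2 m)\<^sup>2) \<and>
    (\<forall>X u v. solution X u v \<longrightarrow> (\<forall>t\<ge>0.
       \<bar>u t\<bar> \<le> exp (- \<delta> * t) * (C * initial X u) \<and>
       (\<forall>n. \<bar>inner (X t) (\<psi> n)\<bar> \<le> exp (- \<delta> * t) * (\<bar>inner (X 0) (\<psi> n)\<bar> + \<gamma>1 n * initial X u)) \<and>
       (\<forall>m. \<bar>inner (X t) (psi2 m)\<bar> \<le> exp (- \<delta> * t) * (\<bar>inner (X 0) (psi2 m)\<bar> + \<gamma>2 m * initial X u))))"

text \<open>A retained mode is bounded by the finite model alone. A neglected mode is not resonant,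
  so it is a scalar equation forced by the inputs, and its envelope coefficient is a multiple of its
  input coefficients. Changing finitely many coefficients does not affect summability.\<close>

lemma all_modes_decay:
  shows "\<exists>C \<gamma>1 \<gamma>2. modal_envelope C \<gamma>1 \<gamma>2"
proof -
  obtain r C where r: "\<delta> < r" "lambda1 a (N0 + 1) < - r" "lambda2 b (M0 + 1) < - r" and C: "0 \<le> C"
    and fin: "\<forall>X u v. solution X u v \<longrightarrow> (\<forall>t\<ge>0.
       \<bar>u t\<bar> \<le> C * exp (- r * t) * initial X u \<and>
       \<bar>v t\<bar> \<le> C * exp (- r * t) * initial X u \<and>
       (\<forall>n\<le>N0. \<bar>inner (X t) (\<psi> n)\<bar> \<le> C * exp (- r * t) * initial X u) \<and>
       (\<forall>m\<le>M0. \<bar>inner (X t) (psi2 m)\<bar> \<le> C * exp (- r * t) * initial X u))"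
    using finite_model_decay by (elim exE conjE)
  define \<rho>1 where "\<rho>1 = - lambda1 a (N0 + 1)"
  define \<rho>2 where "\<rho>2 = - lambda2 b (M0 + 1)"
  have \<rho>: "r < \<rho>1" "r < \<rho>2" using r by (auto simp: \<rho>1_def \<rho>2_def)
  \<comment> \<open>envelope coefficients of the neglected modes, as delivered by the bound for forced modes\<close>
  define g1 where "g1 n = C / (\<rho>1 - r) * (\<bar>inner (alpha b) (\<xi> n)\<bar> + \<bar>inner beta (\<xi> n)\<bar>)" for n
  define g2 where "g2 m = C / (\<rho>2 - r) * (\<bar>inner (alpha b) (cos_mode m)\<bar> + \<bar>inner beta (cos_mode m)\<bar>)" for m
  define \<gamma>1 where "\<gamma>1 n = (if n \<le> N0 then C else g1 n)" for n
  define \<gamma>2 where "\<gamma>2 m = (if m \<le> M0 then C else g2 m)" for m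
  have g0: "g1 n \<ge> 0" "g2 n \<ge> 0" for n using C \<rho> by (auto simp: g1_def g2_def)
  have S1: "summable (\<lambda>n. (omega n * \<gamma>1 n)\<^sup>2)"
  proof -
    obtain D where D: "D \<ge> 0"
      "\<forall>n. \<forall>f\<in>H1. \<bar>inner f (\<xi> n)\<bar> \<le> D * (norm f + norm (weak_deriv f)) / (omega n)\<^sup>2"
      using adj_snd_bounds[OF D1] by blast
    define E where "E = D * (norm (alpha b) + norm (weak_deriv (alpha b))) + D * (norm beta + norm (weak_deriv beta))"
    have bd: "\<bar>omega n * g1 n\<bar> \<le> (C / (\<rho>1 - r) * E) / omega n" for n
    proof -
      have "\<bar>inner (alpha b) (\<xi> n)\<bar> + \<bar>inner beta (\<xi> n)\<bar> \<le> E / (omega n)\<^sup>2"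
        unfolding E_def add_divide_distrib using D(2) alpha_beta_H1 by (intro add_mono) auto
      then have "g1 n \<le> C / (\<rho>1 - r) * (E / (omega n)\<^sup>2)"
        unfolding g1_def using C \<rho> by (intro mult_left_mono) auto
      then have "omega n * g1 n \<le> omega n * (C / (\<rho>1 - r) * (E / (omega n)\<^sup>2))"
        using omega_pos[of n] by (intro mult_left_mono) auto
      also have "\<dots> = (C / (\<rho>1 - r) * E) / omega n"
        using omega_pos[of n] by (simp add: power2_eq_square)
      finally show ?thesis using g0 omega_pos[of n] by (simp add: abs_mult)
    qed
    have "summable (\<lambda>n. (omega n * g1 n)\<^sup>2)"
      by (rule summable_sq_mono[OF summable_inverse_omega bd])
    then show ?thesis
      by (rule summable_sq_cofinite[where N=N0]) (simp add: \<gamma>1_def)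
  qed
  have S2: "summable (\<lambda>m. (\<gamma>2 m)\<^sup>2)"
  proof (rule summable_sq_cofinite[where N=M0 and g=g2])
    show "summable (\<lambda>m. (g2 m)\<^sup>2)"
      unfolding g2_def by (intro summable_sq_scale summable_sq_add summable_sq_abs bessel_summable orthonormal_cos_mode)
  qed (simp add: \<gamma>2_def)
  have S3: "summable (\<lambda>m. (real m * pi * \<gamma>2 m)\<^sup>2)"
  proof (rule summable_sq_cofinite[where N=M0 and g="\<lambda>m. real m * pi * g2 m"])
    have eq: "real m * pi * g2 m = C / (\<rho>2 - r) * (\<bar>real m * pi * inner (alpha b) (cos_mode m)\<bar> + \<bar>real m * pi * inner beta (cos_mode m)\<bar>)" for m
      by (simp add: g2_def abs_mult distrib_left mult_ac)
    show "summable (\<lambda>m. (real m * pi * g2 m)\<^sup>2)"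
      unfolding eq by (intro summable_sq_scale summable_sq_add summable_sq_abs H1_cos_coeffs(1) alpha_beta_H1)
  qed (simp add: \<gamma>2_def)
  have bounds: "\<bar>u t\<bar> \<le> exp (- \<delta> * t) * (C * initial X u) \<and>
       (\<forall>n. \<bar>inner (X t) (\<psi> n)\<bar> \<le> exp (- \<delta> * t) * (\<bar>inner (X 0) (\<psi> n)\<bar> + \<gamma>1 n * initial X u)) \<and>
       (\<forall>m. \<bar>inner (X t) (psi2 m)\<bar> \<le> exp (- \<delta> * t) * (\<bar>inner (X 0) (psi2 m)\<bar> + \<gamma>2 m * initial X u))"
    if cl: "solution X u v" and t: "t \<ge> 0" for X u v t
  proof -
    define W where "W = initial X u"
    have W0: "W \<ge> 0" by (simp add: W_def)
    have F: "\<bar>u t\<bar> \<le> C * exp (- r * t) * W" "\<bar>v t\<bar> \<le> C * exp (- r * t) * W"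
      "\<And>n. n \<le> N0 \<Longrightarrow> \<bar>inner (X t) (\<psi> n)\<bar> \<le> C * exp (- r * t) * W"
      "\<And>m. m \<le> M0 \<Longrightarrow> \<bar>inner (X t) (psi2 m)\<bar> \<le> C * exp (- r * t) * W" if "t \<ge> 0" for t
      using fin cl that unfolding W_def by blast+
    have E: "exp (- r * t) \<le> exp (- \<delta> * t)"
      using r(1) t by (simp add: mult_right_mono)
    note modes = closed_loop_modes[OF cl]
    have up: "exp (- r * t) * y \<le> exp (- \<delta> * t) * y" if "y \<ge> 0" for y
      using E that by (rule mult_right_mono)
    have 1: "\<bar>inner (X t) (\<psi> n)\<bar> \<le> exp (- \<delta> * t) * (\<bar>inner (X 0) (\<psi> n)\<bar> + \<gamma>1 n * W)" for n
    proof (cases "n \<le> N0")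
      case True
      have "\<bar>inner (X t) (\<psi> n)\<bar> \<le> exp (- r * t) * (0 + \<gamma>1 n * W)"
        using F(3)[OF t True] by (simp add: \<gamma>1_def True mult_ac)
      also have "\<dots> \<le> exp (- r * t) * (\<bar>inner (X 0) (\<psi> n)\<bar> + \<gamma>1 n * W)"
        by (intro mult_left_mono add_right_mono) auto
      also have "\<dots> \<le> exp (- \<delta> * t) * (\<bar>inner (X 0) (\<psi> n)\<bar> + \<gamma>1 n * W)"
        using C W0 by (intro up) (simp add: \<gamma>1_def True)
      finally show ?thesis .
    next
      case False
      then have cp: "coupling a b s n = 0" using D1 by (auto simp: coupling_def)
      have ip: "inner ((0, f) :: state) (\<psi> n) = inner f (\<xi> n)" for f by (simp add: psi1_eq)
      have "\<bar>inner (X t) (\<psi> n)\<bar> \<le> exp (- r * t) * (\<bar>inner (X 0) (\<psi> n)\<bar>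
          + C / (\<rho>1 - r) * (\<bar>inner (alpha b) (\<xi> n)\<bar> + \<bar>inner beta (\<xi> n)\<bar>) * W)"
      proof (rule forced_mode_bound[where x="\<lambda>t. inner (X t) (\<psi> n)" and l="lambda1 a n" and u=u and v=v])
        show "((\<lambda>t. inner (X t) (\<psi> n)) has_real_derivative
          (lambda1 a n * inner (X t) (\<psi> n) + u t * inner (alpha b) (\<xi> n) + v t * inner beta (\<xi> n)))
          (at t within {0..})" if "t \<ge> 0" for t
          using modes(1)[OF that, of n] unfolding cp ip by simp
        show "lambda1 a n \<le> - \<rho>1" using lambda1_antimono[of "N0 + 1" n a] False by (simp add: \<rho>1_def)
      qed (use F \<rho> t in auto)
      also have "\<dots> = exp (- r * t) * (\<bar>inner (X 0) (\<psi> n)\<bar> + \<gamma>1 n * W)"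
        using False by (simp add: \<gamma>1_def g1_def)
      also have "\<dots> \<le> exp (- \<delta> * t) * (\<bar>inner (X 0) (\<psi> n)\<bar> + \<gamma>1 n * W)"
        using g0 W0 False by (intro up) (simp add: \<gamma>1_def)
      finally show ?thesis .
    qed
    have 2: "\<bar>inner (X t) (psi2 m)\<bar> \<le> exp (- \<delta> * t) * (\<bar>inner (X 0) (psi2 m)\<bar> + \<gamma>2 m * W)" for m
    proof (cases "m \<le> M0")
      case True
      have "\<bar>inner (X t) (psi2 m)\<bar> \<le> exp (- r * t) * (0 + \<gamma>2 m * W)"
        using F(4)[OF t True] by (simp add: \<gamma>2_def True mult_ac)
      also have "\<dots> \<le> exp (- r * t) * (\<bar>inner (X 0) (psi2 m)\<bar> + \<gamma>2 m * W)"
        by (intro mult_left_mono add_right_mono) auto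
      also have "\<dots> \<le> exp (- \<delta> * t) * (\<bar>inner (X 0) (psi2 m)\<bar> + \<gamma>2 m * W)"
        using C W0 by (intro up) (simp add: \<gamma>2_def True)
      finally show ?thesis .
    next
      case False
      have ip: "inner ((0, f) :: state) (psi2 m) = inner f (cos_mode m)" for f by (simp add: psi2_eq)
      have "\<bar>inner (X t) (psi2 m)\<bar> \<le> exp (- r * t) * (\<bar>inner (X 0) (psi2 m)\<bar>
          + C / (\<rho>2 - r) * (\<bar>inner (alpha b) (cos_mode m)\<bar> + \<bar>inner beta (cos_mode m)\<bar>) * W)"
      proof (rule forced_mode_bound[where x="\<lambda>t. inner (X t) (psi2 m)" and l="lambda2 b m" and u=u and v=v])
        show "((\<lambda>t. inner (X t) (psi2 m)) has_real_derivative
          (lambda2 b m * inner (X t) (psi2 m) + u t * inner (alpha b) (cos_mode m) + v t * inner beta (cos_mode m)))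
          (at t within {0..})" if "t \<ge> 0" for t
          using modes(2)[OF that, of m] unfolding ip by simp
        show "lambda2 b m \<le> - \<rho>2" using lambda2_antimono[of "M0 + 1" m b] False by (simp add: \<rho>2_def)
      qed (use F \<rho> t in auto)
      also have "\<dots> = exp (- r * t) * (\<bar>inner (X 0) (psi2 m)\<bar> + \<gamma>2 m * W)"
        using False by (simp add: \<gamma>2_def g2_def)
      also have "\<dots> \<le> exp (- \<delta> * t) * (\<bar>inner (X 0) (psi2 m)\<bar> + \<gamma>2 m * W)"
        using g0 W0 False by (intro up) (simp add: \<gamma>2_def)
      finally show ?thesis .
    qed
    have "\<bar>u t\<bar> \<le> exp (- r * t) * (C * W)" using F(1)[OF t] by (simp add: mult_ac)
    also have "\<dots> \<le> exp (- \<delta> * t) * (C * W)" using C W0 by (intro up) simp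
    finally show ?thesis using 1 2 unfolding W_def by blast
  qed
  have nn: "\<gamma>1 n \<ge> 0" "\<gamma>2 n \<ge> 0" for n using C g0 by (auto simp: \<gamma>1_def \<gamma>2_def)
  show ?thesis
    unfolding modal_envelope_def
    by (intro exI[of _ C] exI[of _ \<gamma>1] exI[of _ \<gamma>2] conjI allI impI C nn S1 S2 S3;
        use bounds in blast)
qed
text \<open>The first estimate uses the norm of
  \<open>\<psi>\<^sub>1\<^sub>,\<^sub>n\<^sup>2\<close> in the correction term. For the second one
  the coefficients are multiplied by their frequencies, the finer bound for functions of class
  \<open>H\<^sup>1\<close> is used, and the summability of the weighted coefficients shows that the
  state lies in \<open>\<H>\<^sup>1\<close>. The estimate of \<open>z\<close> comes first, since
  \<open>y\<close> is corrected by \<open>z\<close>.\<close>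

lemma homogenized_decay:
  shows "\<exists>C\<ge>0. \<forall>X u v. solution X u v \<longrightarrow> (\<forall>t\<ge>0.
     (norm (X t))\<^sup>2 + (u t)\<^sup>2 \<le> C * (exp (- \<delta> * t))\<^sup>2 * ((norm (X 0))\<^sup>2 + (u 0)\<^sup>2) \<and>
     (X 0 \<in> calH1 \<longrightarrow> X t \<in> calH1 \<and>
       (norm_calH1 (X t))\<^sup>2 + (u t)\<^sup>2 \<le> C * (exp (- \<delta> * t))\<^sup>2 * ((norm_calH1 (X 0))\<^sup>2 + (u 0)\<^sup>2)))"
proof -
  obtain C \<gamma>1 \<gamma>2 where env: "modal_envelope C \<gamma>1 \<gamma>2" using all_modes_decay by blast
  then have C: "0 \<le> C" and \<gamma>0: "\<forall>n. 0 \<le> \<gamma>1 n" "\<forall>m. 0 \<le> \<gamma>2 m"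
    and S: "summable (\<lambda>n. (omega n * \<gamma>1 n)\<^sup>2)" "summable (\<lambda>m. (\<gamma>2 m)\<^sup>2)" "summable (\<lambda>m. (real m * pi * \<gamma>2 m)\<^sup>2)"
    by (simp_all add: modal_envelope_def)
  obtain D where D: "D \<ge> 0" "\<forall>n. norm (\<xi> n) \<le> D / omega n"
      "\<forall>n. \<forall>f\<in>H1. \<bar>inner f (\<xi> n)\<bar> \<le> D * (norm f + norm (weak_deriv f)) / (omega n)\<^sup>2"
    using adj_snd_bounds[OF D1] by blast
  have om1: "1 \<le> omega n" for n using omega_ge[of n] by simp
  have S1: "summable (\<lambda>n. (\<gamma>1 n)\<^sup>2)"
  proof (rule summable_sq_mono[OF S(1)])
    show "\<bar>\<gamma>1 n\<bar> \<le> omega n * \<gamma>1 n" for n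
      using \<gamma>0(1) mult_right_mono[OF om1, of "\<gamma>1 n" n] by simp
  qed
  define \<kappa> where "\<kappa> n = D / omega n" for n
  have S\<kappa>: "summable (\<lambda>n. (\<kappa> n)\<^sup>2)" unfolding \<kappa>_def by (rule summable_inverse_omega)
  define \<Omega> where "\<Omega> = (\<Sum>n. (\<kappa> n)\<^sup>2)"
  define G1 where "G1 = (\<Sum>n. (\<gamma>1 n)\<^sup>2)"
  define G1' where "G1' = (\<Sum>n. (omega n * \<gamma>1 n)\<^sup>2)"
  define G2 where "G2 = (\<Sum>n. (\<gamma>2 n)\<^sup>2)"
  define G2' where "G2' = (\<Sum>n. (real n * pi * \<gamma>2 n)\<^sup>2)"
  have nn: "0 \<le> \<Omega>" "0 \<le> G1" "0 \<le> G1'" "0 \<le> G2" "0 \<le> G2'"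
    unfolding \<Omega>_def G1_def G1'_def G2_def G2'_def by (intro suminf_nonneg S S1 S\<kappa>; simp)+
  \<comment> \<open>the factor 4 comes from the sum of four terms, the factor 2 from squaring the initial size\<close>
  define k2 where "k2 = 4 * (1 + 2 * G2)"
  define k2' where "k2' = 4 * (1 + 2 * G2')"
  define k1 where "k1 = 4 * (1 + \<Omega> + 2 * G1 + k2 * \<Omega>)"
  define k1' where "k1' = 4 * (1 + 2 * \<Omega> + 2 * G1' + 2 * (k2 + k2') * \<Omega>)"
  define k0 where "k0 = 2 * C\<^sup>2"
  have kn: "0 \<le> k0" "0 \<le> k1" "0 \<le> k1'" "0 \<le> k2" "0 \<le> k2'"
    unfolding k0_def k1_def k1'_def k2_def k2'_def using nn by auto
  define CC where "CC = k0 + k1 + k1' + k2 + k2'"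
  have main: "(norm (X t))\<^sup>2 + (u t)\<^sup>2 \<le> CC * (exp (- \<delta> * t))\<^sup>2 * ((norm (X 0))\<^sup>2 + (u 0)\<^sup>2) \<and>
     (X 0 \<in> calH1 \<longrightarrow> X t \<in> calH1 \<and>
       (norm_calH1 (X t))\<^sup>2 + (u t)\<^sup>2 \<le> CC * (exp (- \<delta> * t))\<^sup>2 * ((norm_calH1 (X 0))\<^sup>2 + (u 0)\<^sup>2))"
    if cl: "solution X u v" and t: "t \<ge> 0" for X u v t
  proof -
    define E where "E = exp (- \<delta> * t)"
    have E0: "E > 0" by (simp add: E_def)
    define W where "W = initial X u"
    have W0: "W \<ge> 0" by (simp add: W_def)
    define q where "q = (norm (X 0))\<^sup>2 + (u 0)\<^sup>2"
    have q0: "q \<ge> 0" by (simp add: q_def)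
    have Wq: "W\<^sup>2 \<le> 2 * q" unfolding W_def q_def using square_sum2_le[of "norm (X 0)" "\<bar>u 0\<bar>"] by simp
    have u: "\<bar>u t\<bar> \<le> E * (C * W)"
      and x1: "\<And>n. \<bar>inner (X t) (\<psi> n)\<bar> \<le> E * (\<bar>inner (X 0) (\<psi> n)\<bar> + \<gamma>1 n * W)"
      and x2: "\<And>m. \<bar>inner (X t) (psi2 m)\<bar> \<le> E * (\<bar>inner (X 0) (psi2 m)\<bar> + \<gamma>2 m * W)"
      using env cl t unfolding modal_envelope_def E_def W_def by blast+
    have scale: "E\<^sup>2 * x \<le> E\<^sup>2 * y" if "x \<le> y" for x y
      using that by (rule mult_left_mono) simp
    have ut: "(u t)\<^sup>2 \<le> E\<^sup>2 * (k0 * q)"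
    proof -
      have "(u t)\<^sup>2 \<le> (E * (C * W))\<^sup>2" using power_mono[OF u abs_ge_zero, of 2] by simp
      also have "\<dots> = E\<^sup>2 * (C\<^sup>2 * W\<^sup>2)" by (simp add: power_mult_distrib)
      also have "\<dots> \<le> E\<^sup>2 * (C\<^sup>2 * (2 * q))" by (intro scale mult_left_mono Wq) simp
      finally show ?thesis by (simp add: k0_def mult_ac)
    qed
    let ?y = "\<lambda>t. fst (X t)" and ?z = "\<lambda>t. snd (X t)"
    have z: "\<bar>inner (?z t) (cos_mode m)\<bar> \<le> E * (\<bar>inner (?z 0) (cos_mode m)\<bar> + \<gamma>2 m * W)" for m
      using x2[of m] by (simp add: psi2_eq inner_prod_def)
    have x1y: "inner (X t) (\<psi> n) = inner (?y t) (hcos_mode n) + inner (?z t) (\<xi> n)" for t n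
      by (simp add: psi1_eq inner_prod_def)
    have y: "\<bar>inner (?y t) (hcos_mode n)\<bar> \<le> E * \<bar>inner (?y 0) (hcos_mode n)\<bar>
        + E * \<bar>inner (?z 0) (\<xi> n)\<bar> + E * W * \<gamma>1 n + \<bar>inner (?z t) (\<xi> n)\<bar>" for n
    proof -
      have "\<bar>inner (?y t) (hcos_mode n)\<bar> \<le> \<bar>inner (X t) (\<psi> n)\<bar> + \<bar>inner (?z t) (\<xi> n)\<bar>"
        unfolding x1y[of t] by linarith
      moreover have "E * (\<bar>inner (X 0) (\<psi> n)\<bar> + \<gamma>1 n * W)
        \<le> E * (\<bar>inner (?y 0) (hcos_mode n)\<bar> + \<bar>inner (?z 0) (\<xi> n)\<bar> + \<gamma>1 n * W)"
        unfolding x1y[of 0] using E0 by (intro mult_left_mono add_right_mono abs_triangle_ineq) simp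
      ultimately show ?thesis using x1[of n] by (simp add: distrib_left mult_ac)
    qed
    have zt: "(norm (?z t))\<^sup>2 \<le> E\<^sup>2 * (k2 * q)"
    proof -
      have "(\<Sum>m. (inner (?z t) (cos_mode m))\<^sup>2) \<le> 4 * (E\<^sup>2 * (\<Sum>m. (inner (?z 0) (cos_mode m))\<^sup>2)
          + E\<^sup>2 * 0\<^sup>2 * (\<Sum>n. 0\<^sup>2) + E\<^sup>2 * W\<^sup>2 * (\<Sum>n. (\<gamma>2 n)\<^sup>2) + 0\<^sup>2 * (\<Sum>n. 0\<^sup>2))"
      proof (rule cascade_sum(2)[where \<kappa>="\<lambda>n. 0"])
        show "\<bar>inner (?z t) (cos_mode m)\<bar> \<le> E * \<bar>inner (?z 0) (cos_mode m)\<bar> + E * 0 * 0 + E * W * \<gamma>2 m + 0 * 0" for m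
          using z[of m] by (simp add: distrib_left mult_ac)
      qed (auto intro: bessel_summable[OF orthonormal_cos_mode] S)
      then have "(norm (?z t))\<^sup>2 \<le> E\<^sup>2 * (4 * ((norm (?z 0))\<^sup>2 + W\<^sup>2 * G2))"
        unfolding parseval[OF orthonormal_cos_mode total_cos_mode] G2_def[symmetric] by (simp add: algebra_simps)
      also have "\<dots> \<le> E\<^sup>2 * (k2 * q)"
      proof (rule scale)
        have "(norm (?z 0))\<^sup>2 \<le> q" by (simp add: q_def norm_state_sq)
        moreover have "W\<^sup>2 * G2 \<le> 2 * q * G2" using Wq nn by (intro mult_right_mono) auto
        ultimately show "4 * ((norm (?z 0))\<^sup>2 + W\<^sup>2 * G2) \<le> k2 * q" by (simp add: k2_def algebra_simps)
      qed
      finally show ?thesis .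
    qed
    have adjL2: "\<bar>inner f (\<xi> n)\<bar> \<le> norm f * \<kappa> n" for f n
      using order_trans[OF Cauchy_Schwarz_ineq2[of f "\<xi> n"] mult_left_mono[OF D(2)[rule_format, of n] norm_ge_zero[of f]]]
      by (simp add: \<kappa>_def)
    have yt: "(norm (?y t))\<^sup>2 \<le> E\<^sup>2 * (k1 * q)"
    proof -
      have "(\<Sum>n. (inner (?y t) (hcos_mode n))\<^sup>2) \<le> 4 * (E\<^sup>2 * (\<Sum>n. (inner (?y 0) (hcos_mode n))\<^sup>2)
          + E\<^sup>2 * (norm (?z 0))\<^sup>2 * (\<Sum>n. (\<kappa> n)\<^sup>2) + E\<^sup>2 * W\<^sup>2 * (\<Sum>n. (\<gamma>1 n)\<^sup>2) + (norm (?z t))\<^sup>2 * (\<Sum>n. (\<kappa> n)\<^sup>2))"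
      proof (rule cascade_sum(2))
        show "\<bar>inner (?y t) (hcos_mode n)\<bar> \<le> E * \<bar>inner (?y 0) (hcos_mode n)\<bar> + E * norm (?z 0) * \<kappa> n
            + E * W * \<gamma>1 n + norm (?z t) * \<kappa> n" for n
          using y[of n] adjL2[of "?z t" n] mult_left_mono[OF adjL2[of "?z 0" n] less_imp_le[OF E0]]
          by (simp add: mult.assoc)
      qed (auto intro: bessel_summable[OF orthonormal_hcos_mode] S1 S\<kappa>)
      then have "(norm (?y t))\<^sup>2 \<le> 4 * (E\<^sup>2 * (norm (?y 0))\<^sup>2 + E\<^sup>2 * (norm (?z 0))\<^sup>2 * \<Omega> + E\<^sup>2 * W\<^sup>2 * G1 + (norm (?z t))\<^sup>2 * \<Omega>)"
        unfolding parseval[OF orthonormal_hcos_mode total_hcos_mode] G1_def[symmetric] \<Omega>_def[symmetric] .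
      also have "\<dots> \<le> 4 * (E\<^sup>2 * (norm (?y 0))\<^sup>2 + E\<^sup>2 * (norm (?z 0))\<^sup>2 * \<Omega> + E\<^sup>2 * W\<^sup>2 * G1 + E\<^sup>2 * (k2 * q) * \<Omega>)"
        using mult_right_mono[OF zt nn(1)] by simp
      also have "\<dots> = E\<^sup>2 * (4 * ((norm (?y 0))\<^sup>2 + (norm (?z 0))\<^sup>2 * \<Omega> + W\<^sup>2 * G1 + k2 * q * \<Omega>))"
        by (simp add: algebra_simps)
      also have "\<dots> \<le> E\<^sup>2 * (k1 * q)"
      proof (rule scale)
        have "(norm (?y 0))\<^sup>2 \<le> q" by (simp add: q_def norm_state_sq)
        moreover have "(norm (?z 0))\<^sup>2 * \<Omega> \<le> q * \<Omega>" using nn by (intro mult_right_mono) (simp_all add: q_def norm_state_sq)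
        moreover have "W\<^sup>2 * G1 \<le> 2 * q * G1" using Wq nn by (intro mult_right_mono) auto
        ultimately show "4 * ((norm (?y 0))\<^sup>2 + (norm (?z 0))\<^sup>2 * \<Omega> + W\<^sup>2 * G1 + k2 * q * \<Omega>) \<le> k1 * q"
          by (simp add: k1_def algebra_simps)
      qed
      finally show ?thesis .
    qed
    have L2: "(norm (X t))\<^sup>2 + (u t)\<^sup>2 \<le> CC * E\<^sup>2 * q"
    proof -
      have "(norm (X t))\<^sup>2 + (u t)\<^sup>2 \<le> E\<^sup>2 * ((k0 + k1 + k2) * q)"
        using yt zt ut by (simp add: norm_state_sq[of "X t"] algebra_simps)
      also have "\<dots> \<le> E\<^sup>2 * (CC * q)"
        using kn q0 by (intro scale mult_right_mono) (auto simp: CC_def)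
      finally show ?thesis by (simp add: mult_ac)
    qed
    have H: "X t \<in> calH1 \<and> (norm_calH1 (X t))\<^sup>2 + (u t)\<^sup>2 \<le> CC * E\<^sup>2 * ((norm_calH1 (X 0))\<^sup>2 + (u 0)\<^sup>2)"
      if X0: "X 0 \<in> calH1"
    proof -
      have h: "?y 0 \<in> H1" "point_value (?y 0) 1 = 0" "?z 0 \<in> H1" using X0 by (auto simp: calH1_def)
      let ?dy = "\<lambda>t. weak_deriv (?y t)" and ?dz = "\<lambda>t. weak_deriv (?z t)"
      define Q where "Q = (norm_calH1 (X 0))\<^sup>2 + (u 0)\<^sup>2"
      have Q: "Q = (norm (?dy 0))\<^sup>2 + (norm (?z 0))\<^sup>2 + (norm (?dz 0))\<^sup>2 + (u 0)\<^sup>2"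
        by (simp add: Q_def norm_calH1_sq)
      have qQ: "q \<le> Q"
        using poincare[OF h(1,2)] zero_le_power2[of "norm (?dz 0)"]
        unfolding q_def Q norm_state_sq by linarith
      have Q0: "Q \<ge> 0" using q0 qQ by simp
      have Qd: "(norm (?dy 0))\<^sup>2 \<le> Q" "(norm (?dz 0))\<^sup>2 \<le> Q" by (simp_all add: Q)
      have Qz: "2 * (norm (?z 0))\<^sup>2 + 2 * (norm (?dz 0))\<^sup>2 \<le> 2 * Q" by (simp add: Q)
      have WQ: "W\<^sup>2 \<le> 2 * Q" using Wq qQ by simp
      have sumz: "summable (\<lambda>m. (real m * pi * inner (?z t) (cos_mode m))\<^sup>2)"
        and lez: "(\<Sum>m. (real m * pi * inner (?z t) (cos_mode m))\<^sup>2)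
          \<le> 4 * (E\<^sup>2 * (\<Sum>m. (real m * pi * inner (?z 0) (cos_mode m))\<^sup>2)
          + E\<^sup>2 * 0\<^sup>2 * (\<Sum>n. (0::real)\<^sup>2) + E\<^sup>2 * W\<^sup>2 * (\<Sum>n. (real n * pi * \<gamma>2 n)\<^sup>2) + 0\<^sup>2 * (\<Sum>n. (0::real)\<^sup>2))"
      proof -
        have b: "\<bar>real m * pi * inner (?z t) (cos_mode m)\<bar> \<le> E * \<bar>real m * pi * inner (?z 0) (cos_mode m)\<bar>
            + E * 0 * 0 + E * W * (real m * pi * \<gamma>2 m) + 0 * 0" for m
          using mult_left_mono[OF z[of m], of "real m * pi"] by (simp add: abs_mult algebra_simps)
        have s0: "summable (\<lambda>n::nat. (0::real)\<^sup>2)" by simp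
        show "summable (\<lambda>m. (real m * pi * inner (?z t) (cos_mode m))\<^sup>2)"
          by (rule cascade_sum(1)[where \<kappa>="\<lambda>n. 0", OF b H1_cos_coeffs(1)[OF h(3)] s0 S(3)])
        show "(\<Sum>m. (real m * pi * inner (?z t) (cos_mode m))\<^sup>2)
          \<le> 4 * (E\<^sup>2 * (\<Sum>m. (real m * pi * inner (?z 0) (cos_mode m))\<^sup>2)
          + E\<^sup>2 * 0\<^sup>2 * (\<Sum>n. (0::real)\<^sup>2) + E\<^sup>2 * W\<^sup>2 * (\<Sum>n. (real n * pi * \<gamma>2 n)\<^sup>2) + 0\<^sup>2 * (\<Sum>n. (0::real)\<^sup>2))"
          by (rule cascade_sum(2)[where \<kappa>="\<lambda>n. 0", OF b H1_cos_coeffs(1)[OF h(3)] s0 S(3)])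
      qed
      note zH = H1_if_cos_coeffs[OF sumz]
      have dzt: "(norm (?dz t))\<^sup>2 \<le> E\<^sup>2 * (k2' * Q)"
      proof -
        have "(norm (?dz t))\<^sup>2 \<le> E\<^sup>2 * (4 * ((\<Sum>m. (real m * pi * inner (?z 0) (cos_mode m))\<^sup>2) + W\<^sup>2 * G2'))"
          using lez unfolding zH(2) G2'_def[symmetric] by (simp add: algebra_simps)
        also have "\<dots> \<le> E\<^sup>2 * (k2' * Q)"
        proof (rule scale)
          have "(\<Sum>m. (real m * pi * inner (?z 0) (cos_mode m))\<^sup>2) \<le> Q"
            by (rule order_trans[OF H1_cos_coeffs(2)[OF h(3)] Qd(2)])
          moreover have "W\<^sup>2 * G2' \<le> 2 * Q * G2'" using WQ nn by (intro mult_right_mono) auto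
          ultimately show "4 * ((\<Sum>m. (real m * pi * inner (?z 0) (cos_mode m))\<^sup>2) + W\<^sup>2 * G2') \<le> k2' * Q"
            by (simp add: k2'_def algebra_simps)
        qed
        finally show ?thesis .
      qed
      have ztQ: "(norm (?z t))\<^sup>2 \<le> E\<^sup>2 * (k2 * Q)"
        using zt scale[OF mult_left_mono[OF qQ kn(4)]] by simp
      define P0 where "P0 = norm (?z 0) + norm (?dz 0)"
      define Pt where "Pt = norm (?z t) + norm (?dz t)"
      have P0: "P0\<^sup>2 \<le> 2 * Q" unfolding P0_def by (rule order_trans[OF square_sum2_le Qz])
      have Pt: "Pt\<^sup>2 \<le> E\<^sup>2 * (2 * (k2 + k2') * Q)"
        unfolding Pt_def using square_sum2_le[of "norm (?z t)" "norm (?dz t)"] ztQ dzt by (simp add: algebra_simps)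
      have adjH1: "omega n * \<bar>inner f (\<xi> n)\<bar> \<le> (norm f + norm (weak_deriv f)) * \<kappa> n" if "f \<in> H1" for f n
      proof -
        have "omega n * \<bar>inner f (\<xi> n)\<bar> \<le> omega n * (D * (norm f + norm (weak_deriv f)) / (omega n)\<^sup>2)"
          using D(3) that omega_pos[of n] by (intro mult_left_mono) auto
        also have "\<dots> = (norm f + norm (weak_deriv f)) * \<kappa> n"
          using omega_pos[of n] by (simp add: \<kappa>_def power2_eq_square)
        finally show ?thesis .
      qed
      have b: "\<bar>omega n * inner (?y t) (hcos_mode n)\<bar> \<le> E * \<bar>omega n * inner (?y 0) (hcos_mode n)\<bar>
          + E * P0 * \<kappa> n + E * W * (omega n * \<gamma>1 n) + Pt * \<kappa> n" for n
      proof -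
        have "\<bar>omega n * inner (?y t) (hcos_mode n)\<bar> = omega n * \<bar>inner (?y t) (hcos_mode n)\<bar>"
          using omega_pos[of n] by (simp add: abs_mult)
        also have "\<dots> \<le> omega n * (E * \<bar>inner (?y 0) (hcos_mode n)\<bar>
          + E * \<bar>inner (?z 0) (\<xi> n)\<bar> + E * W * \<gamma>1 n + \<bar>inner (?z t) (\<xi> n)\<bar>)"
          using omega_pos[of n] by (intro mult_left_mono y) simp
        also have "\<dots> = E * (omega n * \<bar>inner (?y 0) (hcos_mode n)\<bar>) + E * (omega n * \<bar>inner (?z 0) (\<xi> n)\<bar>)
          + E * W * (omega n * \<gamma>1 n) + omega n * \<bar>inner (?z t) (\<xi> n)\<bar>"
          by (simp add: algebra_simps)
        also have "\<dots> \<le> E * (omega n * \<bar>inner (?y 0) (hcos_mode n)\<bar>) + E * (P0 * \<kappa> n) + E * W * (omega n * \<gamma>1 n) + Pt * \<kappa> n"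
          unfolding P0_def Pt_def
          using mult_left_mono[OF adjH1[OF h(3), of n] less_imp_le[OF E0]] adjH1[OF zH(1), of n] by linarith
        finally show ?thesis using omega_pos[of n] by (simp add: abs_mult mult.assoc)
      qed
      note sy = cascade_sum[OF b H1_hcos_coeffs(1)[OF h(1,2)] S\<kappa> S(1)]
      note yH = H1_if_hcos_coeffs[OF sy(1)]
      have dyt: "(norm (?dy t))\<^sup>2 \<le> E\<^sup>2 * (k1' * Q)"
      proof -
        have "(norm (?dy t))\<^sup>2 \<le> 4 * (E\<^sup>2 * (\<Sum>n. (omega n * inner (?y 0) (hcos_mode n))\<^sup>2)
          + E\<^sup>2 * P0\<^sup>2 * \<Omega> + E\<^sup>2 * W\<^sup>2 * G1' + Pt\<^sup>2 * \<Omega>)"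
          using sy(2) unfolding yH(3) \<Omega>_def[symmetric] G1'_def[symmetric] .
        also have "\<dots> \<le> 4 * (E\<^sup>2 * (\<Sum>n. (omega n * inner (?y 0) (hcos_mode n))\<^sup>2)
          + E\<^sup>2 * P0\<^sup>2 * \<Omega> + E\<^sup>2 * W\<^sup>2 * G1' + E\<^sup>2 * (2 * (k2 + k2') * Q) * \<Omega>)"
          using mult_right_mono[OF Pt nn(1)] by simp
        also have "\<dots> = E\<^sup>2 * (4 * ((\<Sum>n. (omega n * inner (?y 0) (hcos_mode n))\<^sup>2)
          + P0\<^sup>2 * \<Omega> + W\<^sup>2 * G1' + 2 * (k2 + k2') * Q * \<Omega>))"
          by (simp add: algebra_simps)
        also have "\<dots> \<le> E\<^sup>2 * (k1' * Q)"
        proof (rule scale)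
          have "(\<Sum>n. (omega n * inner (?y 0) (hcos_mode n))\<^sup>2) \<le> Q"
            by (rule order_trans[OF H1_hcos_coeffs(2)[OF h(1,2)] Qd(1)])
          moreover have "P0\<^sup>2 * \<Omega> \<le> 2 * Q * \<Omega>" using P0 nn by (intro mult_right_mono) auto
          moreover have "W\<^sup>2 * G1' \<le> 2 * Q * G1'" using WQ nn by (intro mult_right_mono) auto
          ultimately show "4 * ((\<Sum>n. (omega n * inner (?y 0) (hcos_mode n))\<^sup>2)
            + P0\<^sup>2 * \<Omega> + W\<^sup>2 * G1' + 2 * (k2 + k2') * Q * \<Omega>) \<le> k1' * Q"
            by (simp add: k1'_def algebra_simps)
        qed
        finally show ?thesis .
      qed
      have "X t \<in> calH1"
        using yH(1,2) zH(1) by (auto simp: calH1_def case_prod_beta)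
      moreover have "(norm_calH1 (X t))\<^sup>2 + (u t)\<^sup>2 \<le> CC * E\<^sup>2 * Q"
      proof -
        have "(u t)\<^sup>2 \<le> E\<^sup>2 * (k0 * Q)" using ut scale[OF mult_left_mono[OF qQ kn(1)]] by simp
        then have "(norm_calH1 (X t))\<^sup>2 + (u t)\<^sup>2 \<le> E\<^sup>2 * ((k0 + k1' + k2 + k2') * Q)"
          using dyt ztQ dzt by (simp add: norm_calH1_sq algebra_simps)
        also have "\<dots> \<le> E\<^sup>2 * (CC * Q)"
          using kn Q0 by (intro scale mult_right_mono) (auto simp: CC_def)
        finally show ?thesis by (simp add: mult_ac)
      qed
      ultimately show ?thesis by (simp add: Q_def)
    qed
    show ?thesis using L2 H unfolding E_def q_def by blast
  qed
  have "CC \<ge> 0" using kn by (simp add: CC_def)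
  with main show ?thesis by blast
qed

end

section \<open>Exponential stability\<close>

theorem theorem2:
  fixes a b s \<delta> :: real and N0 M0 :: nat and p1 p2 :: "nat \<Rightarrow> nat" and K :: "real mat"
  assumes "s \<noteq> 0" and "\<delta> > 0"
    and "lambda1 a (N0 + 1) < - \<delta>" and "lambda2 b (M0 + 1) < - \<delta>"
    and "\<forall>n \<in> Delta1 a b. n \<le> N0" and "\<forall>m \<in> Delta2 a b. m \<le> M0"
    and "Theta a b \<inter> {0..N0} = {}"
    and "mode_ordering a b N0 M0 p1 p2"
    and "K \<in> carrier_mat 1 (N0 + M0 + 3)"
    and "Hurwitz (A1a a b s N0 M0 p1 p2 - B1a a b s N0 M0 p1 p2 * K)"
    and "spectral_abscissa (A1a a b s N0 M0 p1 p2 - B1a a b s N0 M0 p1 p2 * K) < - \<delta>"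
  shows "\<exists>C>0. \<forall>y0 z0 u0 y z u.
    closed_loop_solution a b s N0 M0 p1 p2 K y0 z0 u0 y z u \<longrightarrow>
      (\<forall>t\<ge>0. (norm (y t, z t))\<^sup>2 + (u t)\<^sup>2
         \<le> C * exp (- 2 * \<delta> * t) * ((norm (y0, z0))\<^sup>2 + u0\<^sup>2)) \<and>
      (y0 \<in> H2 \<and> z0 \<in> H2 \<and> point_value y0 1 = 0 \<and> point_value (weak_deriv z0) 1 = 0 \<and>
       point_value (weak_deriv y0) 0 = s * point_value z0 0 \<and>
       point_value (weak_deriv z0) 0 = u0 \<longrightarrow>
         (\<forall>t\<ge>0. (y t, z t) \<in> calH1 \<and>
            (norm_calH1 (y t, z t))\<^sup>2 + (u t)\<^sup>2
              \<le> C * exp (- 2 * \<delta> * t) * ((norm_calH1 (y0, z0))\<^sup>2 + u0\<^sup>2)))"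
proof -
  interpret stabilized_loop a b s \<delta> N0 M0 p1 p2 K
    by unfold_locales (fact assms)+
  obtain C where C: "C \<ge> 0" and dec: "\<forall>X u v. solution X u v \<longrightarrow> (\<forall>t\<ge>0.
     (norm (X t))\<^sup>2 + (u t)\<^sup>2 \<le> C * (exp (- \<delta> * t))\<^sup>2 * ((norm (X 0))\<^sup>2 + (u 0)\<^sup>2) \<and>
     (X 0 \<in> calH1 \<longrightarrow> X t \<in> calH1 \<and>
       (norm_calH1 (X t))\<^sup>2 + (u t)\<^sup>2 \<le> C * (exp (- \<delta> * t))\<^sup>2 * ((norm_calH1 (X 0))\<^sup>2 + (u 0)\<^sup>2)))"
    using homogenized_decay by blast
  define C' where "C' = phi_const * C * phi_const + 1"
  have C': "C' > 0" unfolding C'_def using C phi_const_pos by (intro add_nonneg_pos mult_nonneg_nonneg) auto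
  have "(norm (y t, z t))\<^sup>2 + (u t)\<^sup>2 \<le> C' * exp (- 2 * \<delta> * t) * ((norm (y0, z0))\<^sup>2 + u0\<^sup>2) \<and>
    ((y0, z0) \<in> calH1 \<longrightarrow> (y t, z t) \<in> calH1 \<and>
      (norm_calH1 (y t, z t))\<^sup>2 + (u t)\<^sup>2 \<le> C' * exp (- 2 * \<delta> * t) * ((norm_calH1 (y0, z0))\<^sup>2 + u0\<^sup>2))"
    if sol: "closed_loop_solution a b s N0 M0 p1 p2 K y0 z0 u0 y z u" and t: "t \<ge> 0" for y0 z0 u0 y z u t
  proof -
    define X where "X = homogenized y z u"
    have cl: "solution X u
      (\<lambda>t. - vec_index (K *\<^sub>v X1a a b s N0 M0 p1 p2 (X t) (u t)) 0)"
      and ini: "y 0 = y0" "z 0 = z0" "u 0 = u0"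
      using sol unfolding closed_loop_solution_def solution_def Let_def X_def by auto
    have Xt: "(y t, z t) = lift (X t) (u t)" for t by (simp add: X_def homogenized_def lift_def)
    have X0: "X 0 = lift (y0, z0) (- u0)" by (simp add: X_def homogenized_def lift_def ini)
    have e: "exp (- 2 * \<delta> * t) = (exp (- \<delta> * t))\<^sup>2"
      by (simp add: power2_eq_square flip: exp_add)
    note D = dec[rule_format, OF cl t, unfolded ini]
    have 1: "(norm (y t, z t))\<^sup>2 + (u t)\<^sup>2 \<le> C' * exp (- 2 * \<delta> * t) * ((norm (y0, z0))\<^sup>2 + u0\<^sup>2)"
      unfolding C'_def e
    proof (rule transfer_bound[OF _ conjunct1[OF D]])
      show "(norm (y t, z t))\<^sup>2 + (u t)\<^sup>2 \<le> phi_const * ((norm (X t))\<^sup>2 + (u t)\<^sup>2)"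
        unfolding Xt by (rule lift_bounds(1))
      show "(norm (X 0))\<^sup>2 + u0\<^sup>2 \<le> phi_const * ((norm (y0, z0))\<^sup>2 + u0\<^sup>2)"
        unfolding X0 using lift_bounds(1)[of "(y0, z0)" "- u0"] by simp
    qed (use C phi_const_pos in auto)
    have 2: "(y t, z t) \<in> calH1 \<and>
      (norm_calH1 (y t, z t))\<^sup>2 + (u t)\<^sup>2 \<le> C' * exp (- 2 * \<delta> * t) * ((norm_calH1 (y0, z0))\<^sup>2 + u0\<^sup>2)"
      if init: "(y0, z0) \<in> calH1"
    proof -
      have X0H: "X 0 \<in> calH1" unfolding X0 by (rule lift_bounds(2)[OF init])
      note H = mp[OF conjunct2[OF D] X0H]
      have "(norm_calH1 (y t, z t))\<^sup>2 + (u t)\<^sup>2 \<le> C' * exp (- 2 * \<delta> * t) * ((norm_calH1 (y0, z0))\<^sup>2 + u0\<^sup>2)"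
        unfolding C'_def e
      proof (rule transfer_bound[OF _ conjunct2[OF H]])
        show "(norm_calH1 (y t, z t))\<^sup>2 + (u t)\<^sup>2 \<le> phi_const * ((norm_calH1 (X t))\<^sup>2 + (u t)\<^sup>2)"
          unfolding Xt by (rule lift_bounds(3)[OF conjunct1[OF H]])
        show "(norm_calH1 (X 0))\<^sup>2 + u0\<^sup>2 \<le> phi_const * ((norm_calH1 (y0, z0))\<^sup>2 + u0\<^sup>2)"
          unfolding X0 using lift_bounds(3)[OF init, of "- u0"] by simp
      qed (use C phi_const_pos in auto)
      moreover have "(y t, z t) \<in> calH1" unfolding Xt by (rule lift_bounds(2)[OF conjunct1[OF H]])
      ultimately show ?thesis by blast
    qed
    show ?thesis using 1 2 by blast
  qed
  moreover have "(y0, z0) \<in> calH1" if "y0 \<in> H2" "z0 \<in> H2" "point_value y0 1 = 0" for y0 z0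
    using that by (simp add: H2_def calH1_def)
  ultimately show ?thesis using C' by blast
qed

end
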